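(* Let $n,d$ be integers with $1\le d<n-2$, let $\alpha>0$ with $\alpha\neq n-d-2$, and let $E=\mathbb{R}^d\subset\mathbb{R}^n$. Then there is no non-trivial one-parameter differentiable family of flat perturbations (as defined in the context) of the flat solution $D_{\alpha,\mu}$, with $\mu=\mathcal{H}^d|_E$, of the equation $L_{\alpha,\mu}D_{\alpha,\mu}=0$ in $\mathbb{R}^n\setminus E$.
   Context: Identify $\mathbb{R}^d$ with $\mathbb{R}^d\times\{0\}\subset\mathbb{R}^n$; $\mathcal{H}^d$ is $d$-dimensional Hausdorff measure. A measure $\mu$ is a $d$-Ahlfors regular measure on a closed set $E$ if its closed support is $E$ and there is $C_0\ge1$ with $C_0^{-1}r^d\le\mu(B(x,r))\le C_0r^d$ for all $x\in E$ and $0<r<\mathrm{diam}(E)$. For such $\mu$ and $x\in\Omega=\mathbb{R}^n\setminus E$ set $$D_{\alpha,\mu}(x)=\left(\int_E|x-y|^{-d-\alpha}\,d\mu(y)\right)^{-1/\alpha},\qquad L_{\alpha,\mu}=-\mathrm{div}\,\big(D_{\alpha,\mu}^{-n+d+1}\nabla\,\cdot\,\big).$$ All measures $\mu$ considered are assumed to be $d$-Ahlfors regular on $E$. For $f$ locally integrable on $\mathbb{R}^d$, $\|f\|_{BMO}=\sup_B\frac1{|B|}\int_B|f-m_Bf|\,dy$, the supremum being over balls $B\subset\mathbb{R}^d$, with $m_Bf=\frac1{|B|}\int_Bf\,dy$. Definition. Let $E=\mathbb{R}^d$. A non-trivial one-parameter differentiable family of flat perturbations of the flat solution is a family $\{D_{\alpha,\mu_t}\}_{t\in[0,t_0)}$,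 $t_0>0$, such that for every $t$ one has $L_{\alpha,\mu_t}D_{\alpha,\mu_t}=0$ in $\mathbb{R}^n\setminus E$, the measure $\mu_t$ is supported on $E$ and has density $1+\phi_t$ with respect to $\mathcal{H}^d$, $\phi_t\in L^\infty(\mathbb{R}^d)$, and: 1. $\phi_0=0$; 2. the family of densities is Fréchet differentiable at zero in $BMO(\mathbb{R}^d)$: there is a function $\frac{\partial\phi_t}{\partial t}(0,\cdot)$ on $\mathbb{R}^d$ with $\big\|\phi_t-t\frac{\partial\phi_t}{\partial t}(0,\cdot)\big\|_{BMO}=o(t)$ as $t\to0$; 3. $\frac{\partial\phi_t}{\partial t}(0,\cdot)$ is a non-constant function; 4. for a constant $C$ independent of $t$, $\|\phi_t\|_{BMO}\le Ct$ and $\big|\int_{B(0,1)}\phi_t(y)\,dy\big|\le Ct$, and $\big|\int_{B(0,1)}\big(\phi_t(y)-t\frac{\partial\phi_t}{\partial t}(0,y)\big)dy\big|=o(t)$ as $t\to0$ (here $B(0,1)$ is the unit ball of $\mathbb{R}^d$). *)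

theory Defs
  imports "HOL-Analysis.Analysis" "HOL-Library.Landau_Symbols"
begin

section \<open>Hausdorff measure\<close>

text \<open>The library function \<^const>\<open>diameter\<close> is real-valued and carries no information for
  unbounded sets, so the extended-valued diameter is used.\<close>

definition ediam :: "'a::metric_space set \<Rightarrow> ennreal" where
  "ediam U = (SUP x\<in>U. SUP y\<in>U. ennreal (dist x y))"

text \<open>The factor \<^term>\<open>unit_ball_vol d\<close> is the usual normalization, for which
  \<open>d\<close>-dimensional Hausdorff measure agrees with Lebesgue measure on \<open>d\<close>-dimensional planes.
  The case distinction only matters for \<open>d = 0\<close>, where \<open>0 ^ 0 = 1\<close>.\<close>

definition hausdorff_weight :: "nat \<Rightarrow> 'a::metric_space set \<Rightarrow> ennreal" where
  "hausdorff_weight d U =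
     (if U = {} then 0 else ennreal (unit_ball_vol (real d)) * (ediam U / 2) ^ d)"

definition hausdorff_content :: "nat \<Rightarrow> real \<Rightarrow> 'a::metric_space set \<Rightarrow> ennreal" where
  "hausdorff_content d \<delta> A =
     (INF U \<in> {U :: nat \<Rightarrow> 'a set. A \<subseteq> (\<Union>i. U i) \<and> (\<forall>i. ediam (U i) \<le> ennreal \<delta>)}.
        \<Sum>i. hausdorff_weight d (U i))"

definition hausdorff_outer :: "nat \<Rightarrow> 'a::metric_space set \<Rightarrow> ennreal" where
  "hausdorff_outer d A = (SUP \<delta>\<in>{0<..}. hausdorff_content d \<delta> A)"

definition hausdorff_measure :: "nat \<Rightarrow> 'a::metric_space measure" where
  "hausdorff_measure d = measure_of UNIV (sets borel) (hausdorff_outer d)"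

lemma hausdorff_content_mono:
  "A \<subseteq> B \<Longrightarrow> hausdorff_content d \<delta> A \<le> hausdorff_content d \<delta> B"
  unfolding hausdorff_content_def by (rule INF_superset_mono) auto

lemma hausdorff_content_antimono:
  assumes "\<delta> \<le> \<epsilon>"
  shows "hausdorff_content d \<epsilon> A \<le> hausdorff_content d \<delta> A"
  unfolding hausdorff_content_def
  by (rule INF_superset_mono) (use assms in \<open>auto intro: order_trans ennreal_leI\<close>)

lemma ediam_empty [simp]: "ediam {} = 0"
  by (simp add: ediam_def bot_ennreal)

lemma dist_le_ediam: "x \<in> U \<Longrightarrow> y \<in> U \<Longrightarrow> ennreal (dist x y) \<le> ediam U"
  unfolding ediam_def by (rule SUP_upper2, assumption, rule SUP_upper)

lemma hausdorff_content_empty [simp]: "hausdorff_content d \<delta> {} = 0"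
proof -
  have "hausdorff_content d \<delta> ({} :: 'a set) \<le> (\<Sum>i::nat. hausdorff_weight d ({} :: 'a set))"
    unfolding hausdorff_content_def by (rule INF_lower2[of "\<lambda>_. {}"]) auto
  then show ?thesis by (simp add: hausdorff_weight_def)
qed

lemma hausdorff_content_UN:
  fixes A :: "nat \<Rightarrow> 'a::metric_space set"
  shows "hausdorff_content d \<delta> (\<Union>i. A i) \<le> (\<Sum>i. hausdorff_content d \<delta> (A i))"
proof (rule ennreal_le_epsilon)
  fix e :: real
  assume fin: "(\<Sum>i. hausdorff_content d \<delta> (A i)) < top" and e: "0 < e"
  have "\<exists>U. A i \<subseteq> (\<Union>j. U j) \<and> (\<forall>j. ediam (U j) \<le> ennreal \<delta>) \<and>
      (\<Sum>j. hausdorff_weight d (U j)) < hausdorff_content d \<delta> (A i) + ennreal (e * (1/2)^Suc i)" for i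
  proof -
    have "hausdorff_content d \<delta> (A i) \<noteq> top"
      using fin by (metis ennreal_suminf_lessD infinity_ennreal_def top.not_eq_extremum)
    then have "hausdorff_content d \<delta> (A i) < hausdorff_content d \<delta> (A i) + ennreal (e * (1/2)^Suc i)"
      using e by (simp add: ennreal_add_left_cancel_less ennreal_less_zero_iff top.not_eq_extremum)
    then show ?thesis
      unfolding hausdorff_content_def Inf_less_iff by (auto simp: INF_less_iff)
  qed
  then obtain U where U: "\<And>i. A i \<subseteq> (\<Union>j. U i j)" "\<And>i j. ediam (U i j) \<le> ennreal \<delta>"
    "\<And>i. (\<Sum>j. hausdorff_weight d (U i j)) < hausdorff_content d \<delta> (A i) + ennreal (e * (1/2)^Suc i)"
    by metis
  let ?V = "\<lambda>n. case prod_decode n of (i, j) \<Rightarrow> U i j"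
  have "hausdorff_content d \<delta> (\<Union>i. A i) \<le> (\<Sum>n. hausdorff_weight d (?V n))"
    unfolding hausdorff_content_def
  proof (rule INF_lower, safe)
    fix x i assume "x \<in> A i"
    then obtain j where "x \<in> U i j" using U(1) by blast
    then show "x \<in> (\<Union>n. ?V n)" by (intro UN_I[of "prod_encode (i, j)"]) auto
  next
    fix n show "ediam (?V n) \<le> ennreal \<delta>"
      using U(2) by (simp split: prod.split)
  qed
  also have "\<dots> = (\<Sum>n. (\<lambda>(i,j). hausdorff_weight d (U i j)) (prod_decode n))"
    by (simp add: case_prod_beta)
  also have "\<dots> = (\<Sum>i. \<Sum>j. hausdorff_weight d (U i j))"
    by (subst suminf_ennreal_2dimen[of "\<lambda>i. \<Sum>j. hausdorff_weight d (U i j)"]) (auto simp: comp_def)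
  also have "\<dots> \<le> (\<Sum>i. hausdorff_content d \<delta> (A i) + ennreal (e * (1/2)^Suc i))"
    by (intro suminf_le less_imp_le[OF U(3)]) auto
  also have "\<dots> = (\<Sum>i. hausdorff_content d \<delta> (A i)) + (\<Sum>i. ennreal (e * (1/2)^Suc i))"
    by (intro suminf_add[symmetric]) auto
  also have "(\<Sum>i. ennreal (e * (1/2)^Suc i)) = ennreal e"
    using sums_mult[OF power_half_series, of e] e by (intro suminf_ennreal_eq) auto
  finally show "hausdorff_content d \<delta> (\<Union>i. A i) \<le> (\<Sum>i. hausdorff_content d \<delta> (A i)) + ennreal e" .
qed

lemma hausdorff_outer_mono: "A \<subseteq> B \<Longrightarrow> hausdorff_outer d A \<le> hausdorff_outer d B"
  unfolding hausdorff_outer_def by (intro SUP_mono) (blast intro: hausdorff_content_mono)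

lemma hausdorff_outer_empty [simp]: "hausdorff_outer d {} = 0"
  unfolding hausdorff_outer_def by (simp add: SUP_constant bot_ennreal)

lemma hausdorff_outer_UN:
  "hausdorff_outer d (\<Union>i::nat. A i) \<le> (\<Sum>i. hausdorff_outer d (A i))"
  unfolding hausdorff_outer_def[of d "\<Union>i. A i"]
proof (rule SUP_least)
  fix \<delta> :: real assume "\<delta> \<in> {0<..}"
  then have "(\<Sum>i. hausdorff_content d \<delta> (A i)) \<le> (\<Sum>i. hausdorff_outer d (A i))"
    by (intro suminf_le) (auto simp: hausdorff_outer_def intro: SUP_upper)
  then show "hausdorff_content d \<delta> (\<Union>i. A i) \<le> (\<Sum>i. hausdorff_outer d (A i))"
    using hausdorff_content_UN order_trans by blast
qed

lemma hausdorff_outer_Un: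
  "hausdorff_outer d (A \<union> B) \<le> hausdorff_outer d A + hausdorff_outer d B"
proof -
  have "hausdorff_outer d (A \<union> B) = hausdorff_outer d (\<Union>i. if i = 0 then A else if i = Suc 0 then B else {})"
    by (rule arg_cong[where f = "hausdorff_outer d"]) (auto split: if_splits)
  also have "\<dots> \<le> (\<Sum>i. hausdorff_outer d (if i = 0 then A else if i = Suc 0 then B else {}))"
    by (rule hausdorff_outer_UN)
  also have "\<dots> = (\<Sum>i\<in>{0, Suc 0}. hausdorff_outer d (if i = 0 then A else if i = Suc 0 then B else {}))"
    by (rule suminf_finite) auto
  finally show ?thesis by simp
qed

lemma hausdorff_outer_separated:
  assumes "0 < e" and sep: "\<And>x y. x \<in> A \<Longrightarrow> y \<in> B \<Longrightarrow> e \<le> dist x y"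
  shows "hausdorff_outer d A + hausdorff_outer d B \<le> hausdorff_outer d (A \<union> B)"
proof -
  have main: "hausdorff_content d \<delta> A + hausdorff_content d \<delta> B \<le> hausdorff_content d \<delta> (A \<union> B)"
    if \<delta>: "0 < \<delta>" "\<delta> < e" for \<delta>
    unfolding hausdorff_content_def[of d \<delta> "A \<union> B"]
  proof (rule INF_greatest, safe)
    fix U :: "nat \<Rightarrow> 'a set"
    assume cov: "A \<union> B \<subseteq> (\<Union>i. U i)" and diam: "\<forall>i. ediam (U i) \<le> ennreal \<delta>"
    let ?V = "\<lambda>S i. if U i \<inter> S = {} then {} else U i"
    have dV: "ediam (?V S i) \<le> ennreal \<delta>" for S i using diam by simp
    have "hausdorff_content d \<delta> A \<le> (\<Sum>i. hausdorff_weight d (?V A i))"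
      unfolding hausdorff_content_def
      by (rule INF_lower) (use cov dV in \<open>fastforce split: if_splits\<close>)
    moreover have "hausdorff_content d \<delta> B \<le> (\<Sum>i. hausdorff_weight d (?V B i))"
      unfolding hausdorff_content_def
      by (rule INF_lower) (use cov dV in \<open>fastforce split: if_splits\<close>)
    ultimately have "hausdorff_content d \<delta> A + hausdorff_content d \<delta> B
        \<le> (\<Sum>i. hausdorff_weight d (?V A i)) + (\<Sum>i. hausdorff_weight d (?V B i))"
      by (rule add_mono)
    also have "\<dots> = (\<Sum>i. hausdorff_weight d (?V A i) + hausdorff_weight d (?V B i))"
      by (rule suminf_add) auto
    also have "\<dots> \<le> (\<Sum>i. hausdorff_weight d (U i))"
    proof (rule suminf_le)
      fix i
      have "U i \<inter> A = {} \<or> U i \<inter> B = {}"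
      proof (rule ccontr)
        assume "\<not> ?thesis"
        then obtain x y where xy: "x \<in> U i" "x \<in> A" "y \<in> U i" "y \<in> B" by blast
        then have "ennreal (dist x y) \<le> ennreal \<delta>"
          using dist_le_ediam diam order_trans by blast
        with sep[OF xy(2,4)] \<delta> show False by simp
      qed
      then show "hausdorff_weight d (?V A i) + hausdorff_weight d (?V B i) \<le> hausdorff_weight d (U i)"
        by (auto simp: hausdorff_weight_def)
    qed auto
    finally show "hausdorff_content d \<delta> A + hausdorff_content d \<delta> B \<le> (\<Sum>i. hausdorff_weight d (U i))" .
  qed
  have "hausdorff_outer d A + hausdorff_outer d B
      = (SUP \<delta>\<in>{0<..}. hausdorff_content d \<delta> A + hausdorff_content d \<delta> B)"
    unfolding hausdorff_outer_def
  proof (rule SUP_add_directed_ennreal[symmetric])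
    fix i j :: real assume "i \<in> {0<..}" "j \<in> {0<..}"
    then show "\<exists>k\<in>{0<..}. hausdorff_content d i A + hausdorff_content d j B
        \<le> hausdorff_content d k A + hausdorff_content d k B"
      by (intro bexI[of _ "min i j"] add_mono hausdorff_content_antimono) auto
  qed
  also have "\<dots> \<le> hausdorff_outer d (A \<union> B)"
  proof (rule SUP_least)
    fix \<delta> :: real assume "\<delta> \<in> {0<..}"
    define \<delta>' where "\<delta>' = min \<delta> (e / 2)"
    have \<delta>': "0 < \<delta>'" "\<delta>' < e" "\<delta>' \<le> \<delta>"
      using \<open>0 < e\<close> \<open>\<delta> \<in> {0<..}\<close> by (auto simp: \<delta>'_def)
    have "hausdorff_content d \<delta> A + hausdorff_content d \<delta> B
        \<le> hausdorff_content d \<delta>' A + hausdorff_content d \<delta>' B"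
      using \<delta>'(3) by (intro add_mono hausdorff_content_antimono)
    also have "\<dots> \<le> hausdorff_content d \<delta>' (A \<union> B)" using main \<delta>' by blast
    also have "\<dots> \<le> hausdorff_outer d (A \<union> B)"
      unfolding hausdorff_outer_def using \<delta>' by (intro SUP_upper) auto
    finally show "hausdorff_content d \<delta> A + hausdorff_content d \<delta> B \<le> hausdorff_outer d (A \<union> B)" .
  qed
  finally show ?thesis .
qed

lemma ennreal_suminf_tail_tendsto_0:
  fixes f :: "nat \<Rightarrow> ennreal"
  assumes "(\<Sum>i. f i) < top"
  shows "(\<lambda>k. \<Sum>i. f (i + k)) \<longlonglongrightarrow> 0"
proof -
  have eq: "(\<Sum>i. f (i + k)) = (\<Sum>i. f i) - (\<Sum>i<k. f i)" for k
  proof -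
    have split: "(\<Sum>i. f i) = (\<Sum>i. f (i + k)) + (\<Sum>i<k. f i)"
      by (rule suminf_offset) auto
    have "(\<Sum>i<k. f i) \<le> (\<Sum>i. f i)" by (rule sum_le_suminf) auto
    then have "(\<Sum>i<k. f i) < top" using assms by (rule order_le_less_trans)
    then show ?thesis
      unfolding split by (intro ennreal_add_diff_cancel_right[symmetric] less_imp_neq)
  qed
  have "(\<lambda>k. (\<Sum>i. f i) - (\<Sum>i<k. f i)) \<longlonglongrightarrow> (\<Sum>i. f i) - (\<Sum>i. f i)"
    using assms by (intro tendsto_diff_ennreal) (auto intro!: summable_LIMSEQ)
  then show ?thesis using assms by (simp add: eq diff_eq_0_ennreal)
qed

lemma hausdorff_outer_closed_split:
  fixes F :: "'a::metric_space set"
  assumes F: "closed F"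
  shows "hausdorff_outer d (A \<inter> F) + hausdorff_outer d (A - F) \<le> hausdorff_outer d A"
proof (cases "F = {} \<or> hausdorff_outer d A = top")
  case True
  then show ?thesis by auto
next
  case False
  then have ne: "F \<noteq> {}" and fin: "hausdorff_outer d A < top" by (auto simp: top.not_eq_extremum)
  let ?h = "hausdorff_outer d"
  define D where "D x = infdist x F" for x
  have D_lip: "D x \<le> D y + dist x y" for x y
    unfolding D_def using infdist_triangle by blast
  have D_F: "x \<in> F \<Longrightarrow> D x = 0" for x by (simp add: D_def)
  define P where "P k = {x\<in>A. inverse (real (Suc k)) \<le> D x}" for k
  define R where "R k = P (Suc k) - P k" for k
  have inv_less: "inverse (real (Suc (Suc k))) < inverse (real (Suc k))" for k by simp
  have inv_mono: "inverse (real (Suc m)) \<le> inverse (real (Suc k))" if "k \<le> m" for k m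
    using that by (intro le_imp_inverse_le) auto
  have P_sub: "P k \<subseteq> A" and R_sub: "R k \<subseteq> A" for k by (auto simp: P_def R_def)
  have R_lo: "x \<in> R k \<Longrightarrow> inverse (real (Suc (Suc k))) \<le> D x"
    and R_hi: "x \<in> R k \<Longrightarrow> D x < inverse (real (Suc k))" for x k
    by (auto simp: R_def P_def)
  have step1: "?h (A \<inter> F) + ?h (P k) \<le> ?h A" for k
  proof -
    have "?h (A \<inter> F) + ?h (P k) \<le> ?h (A \<inter> F \<union> P k)"
    proof (rule hausdorff_outer_separated)
      fix x y assume "x \<in> A \<inter> F" "y \<in> P k"
      then show "inverse (real (Suc k)) \<le> dist x y"
        using D_lip[of y x] D_F[of x] by (auto simp: P_def dist_commute)
    qed simp
    also have "\<dots> \<le> ?h A" using P_sub by (intro hausdorff_outer_mono) auto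
    finally show ?thesis .
  qed
  have half: "(\<Sum>j<N. ?h (R (2 * j + c))) \<le> ?h (\<Union>j<N. R (2 * j + c))" for N c
  proof (induction N)
    case (Suc N)
    have "?h (\<Union>j<N. R (2 * j + c)) + ?h (R (2 * N + c)) \<le> ?h ((\<Union>j<N. R (2 * j + c)) \<union> R (2 * N + c))"
    proof (cases "N = 0")
      case False
      let ?M = "2 * N + c"
      show ?thesis
      proof (rule hausdorff_outer_separated)
        show "0 < inverse (real ?M) - inverse (real (Suc ?M))"
          using False by (simp del: of_nat_Suc add: less_imp_inverse_less)
        fix x y assume "x \<in> (\<Union>j<N. R (2 * j + c))" and y: "y \<in> R ?M"
        then obtain j where j: "j < N" "x \<in> R (2 * j + c)" by auto
        have "inverse (real ?M) \<le> inverse (real (Suc (Suc (2 * j + c))))"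
          using j by (intro le_imp_inverse_le) auto
        also have "\<dots> \<le> D x" using R_lo[OF j(2)] .
        also have "\<dots> \<le> D y + dist x y" by (rule D_lip)
        finally show "inverse (real ?M) - inverse (real (Suc ?M)) \<le> dist x y"
          using R_hi[OF y] by linarith
      qed
    qed simp
    moreover have "(\<Union>j<Suc N. R (2 * j + c)) = (\<Union>j<N. R (2 * j + c)) \<union> R (2 * N + c)"
      by (auto simp: less_Suc_eq)
    ultimately show ?case
      using order_trans[OF add_right_mono[OF Suc.IH]] by simp
  qed simp
  have half_fin: "(\<Sum>j. ?h (R (2 * j + c))) \<le> ?h A" for c
  proof (rule suminf_le_const)
    fix N
    have "?h (\<Union>j<N. R (2 * j + c)) \<le> ?h A" using R_sub by (intro hausdorff_outer_mono) auto
    with half[of c N] show "(\<Sum>j<N. ?h (R (2 * j + c))) \<le> ?h A" by (rule order_trans)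
  qed auto
  have "(\<Sum>j. ?h (R j)) \<le> ?h A + ?h A"
  proof (rule suminf_le_const)
    fix N
    have "(\<Sum>j<N. ?h (R j)) \<le> (\<Sum>j<2 * N. ?h (R j))" by (rule sum_mono2) auto
    also have "\<dots> = (\<Sum>j<N. ?h (R (2 * j + 0))) + (\<Sum>j<N. ?h (R (2 * j + 1)))"
      by (induction N) (auto simp: ac_simps)
    also have "\<dots> \<le> (\<Sum>j. ?h (R (2 * j + 0))) + (\<Sum>j. ?h (R (2 * j + 1)))"
      by (intro add_mono sum_le_suminf) auto
    also have "\<dots> \<le> ?h A + ?h A" by (intro add_mono half_fin)
    finally show "(\<Sum>j<N. ?h (R j)) \<le> ?h A + ?h A" .
  qed auto
  then have "(\<Sum>j. ?h (R j)) < top" using fin by (simp add: order_le_less_trans)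
  then have tail: "(\<lambda>k. \<Sum>j. ?h (R (j + k))) \<longlonglongrightarrow> 0"
    by (rule ennreal_suminf_tail_tendsto_0)
  have step2: "?h (A - F) \<le> ?h (P k) + (\<Sum>j. ?h (R (j + k)))" for k
  proof -
    have "A - F \<subseteq> P k \<union> (\<Union>j. R (j + k))"
    proof
      fix x assume x: "x \<in> A - F"
      then have "0 < D x"
        using F ne by (simp add: D_def infdist_pos_not_in_closed)
      then obtain m where m: "inverse (real (Suc m)) < D x" using reals_Archimedean by blast
      show "x \<in> P k \<union> (\<Union>j. R (j + k))"
      proof (rule ccontr)
        assume no: "\<not> ?thesis"
        have "x \<notin> P (j + k)" for j
        proof (induction j)
          case (Suc j)
          then show ?case using no by (auto simp: R_def)
        qed (use no in auto)
        then have "x \<notin> P (m + k)" .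
        moreover have "inverse (real (Suc (m + k))) \<le> inverse (real (Suc m))" by (rule inv_mono) simp
        ultimately show False using x m unfolding P_def mem_Collect_eq Diff_iff by linarith
      qed
    qed
    then have "?h (A - F) \<le> ?h (P k \<union> (\<Union>j. R (j + k)))" by (rule hausdorff_outer_mono)
    also have "\<dots> \<le> ?h (P k) + ?h (\<Union>j. R (j + k))" by (rule hausdorff_outer_Un)
    also have "\<dots> \<le> ?h (P k) + (\<Sum>j. ?h (R (j + k)))"
      by (intro add_left_mono hausdorff_outer_UN)
    finally show ?thesis .
  qed
  have "?h (A \<inter> F) + ?h (A - F) \<le> ?h A + (\<Sum>j. ?h (R (j + k)))" for k
  proof -
    have "?h (A \<inter> F) + ?h (A - F) \<le> (?h (A \<inter> F) + ?h (P k)) + (\<Sum>j. ?h (R (j + k)))"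
      using add_left_mono[OF step2[of k]] by (simp add: add.assoc)
    also have "\<dots> \<le> ?h A + (\<Sum>j. ?h (R (j + k)))" by (intro add_right_mono step1)
    finally show ?thesis .
  qed
  moreover have "(\<lambda>k. ?h A + (\<Sum>j. ?h (R (j + k)))) \<longlonglongrightarrow> ?h A + 0"
    by (intro tendsto_add tendsto_const tail)
  ultimately show ?thesis
    by (intro LIMSEQ_le_const[of _ "?h A"]) auto
qed

text \<open>Borel sets are Caratheodory measurable for the Hausdorff outer measure, so the
  \<^const>\<open>measure_of\<close> in \<^const>\<open>hausdorff_measure\<close> is not the degenerate zero measure.\<close>

lemma measure_space_hausdorff_outer:
  "measure_space UNIV (sets borel) (hausdorff_outer d :: 'a::metric_space set \<Rightarrow> ennreal)"
proof -
  let ?h = "hausdorff_outer d :: 'a set \<Rightarrow> ennreal"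
  have oms: "outer_measure_space UNIV ?h"
    unfolding outer_measure_space_def positive_def increasing_def countably_subadditive_def
    by (simp add: hausdorff_outer_mono hausdorff_outer_UN)
  interpret sigma_algebra UNIV "UNIV :: 'a set set"
    by (metis Pow_UNIV sigma_algebra_Pow)
  let ?L = "lambda_system UNIV UNIV ?h"
  have L: "measure_space UNIV ?L ?h" by (rule caratheodory_lemma[OF oms])
  then interpret L: sigma_algebra UNIV ?L by (simp add: measure_space_def)
  have "F \<in> ?L" if "closed F" for F
  proof -
    have "?h (A \<inter> F) + ?h (A - F) = ?h A" for A
    proof (rule antisym)
      show "?h (A \<inter> F) + ?h (A - F) \<le> ?h A" by (rule hausdorff_outer_closed_split[OF that])
      show "?h A \<le> ?h (A \<inter> F) + ?h (A - F)"
        using hausdorff_outer_Un[of d "A \<inter> F" "A - F"] by (simp add: Int_Diff_Un)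
    qed
    then show ?thesis by (simp add: lambda_system_eq)
  qed
  then have "sigma_sets UNIV {F. closed F} \<subseteq> ?L"
    by (intro L.sigma_sets_subset) auto
  then have sub: "sets (borel :: 'a measure) \<subseteq> ?L"
    by (simp add: borel_eq_closed)
  have "sigma_algebra UNIV (sets (borel :: 'a measure))"
    by (metis sets.sigma_algebra_axioms space_borel)
  with L sub show ?thesis
    by (auto simp: measure_space_def positive_def countably_additive_def)
qed

lemma space_hausdorff_measure [simp]: "space (hausdorff_measure d) = UNIV"
  by (simp add: hausdorff_measure_def)

lemma sets_hausdorff_measure [simp, measurable_cong]: "sets (hausdorff_measure d) = sets borel"
  by (metis hausdorff_measure_def sets.sets_measure_of_eq space_borel)

lemma emeasure_hausdorff_measure:
  "A \<in> sets borel \<Longrightarrow> emeasure (hausdorff_measure d) A = hausdorff_outer d A"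
  using measure_space_hausdorff_outer[of d, where 'a = 'a]
  by (intro emeasure_measure_of[OF hausdorff_measure_def])
     (auto simp: measure_space_def)

section \<open>Ahlfors regular measures and the degenerate operator\<close>

definition closed_support :: "'a::metric_space measure \<Rightarrow> 'a set" where
  "closed_support \<mu> = {x. \<forall>r>0. emeasure \<mu> (ball x r) \<noteq> 0}"

definition ahlfors_regular :: "nat \<Rightarrow> 'a::metric_space set \<Rightarrow> 'a measure \<Rightarrow> bool" where
  "ahlfors_regular d E \<mu> \<longleftrightarrow>
     closed E \<and> sets \<mu> = sets borel \<and> closed_support \<mu> = E \<and>
     (\<exists>C\<ge>1. \<forall>x\<in>E. \<forall>r>0. ennreal r < ediam E \<longrightarrow>
        ennreal (r ^ d / C) \<le> emeasure \<mu> (ball x r) \<and>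
        emeasure \<mu> (ball x r) \<le> ennreal (C * r ^ d))"

definition regularized_dist ::
    "nat \<Rightarrow> real \<Rightarrow> 'a::metric_space set \<Rightarrow> 'a measure \<Rightarrow> 'a \<Rightarrow> real" where
  "regularized_dist d \<alpha> E \<mu> x =
     (LINT y:E|\<mu>. dist x y powr (- real d - \<alpha>)) powr (- 1 / \<alpha>)"

definition grad :: "('a::euclidean_space \<Rightarrow> real) \<Rightarrow> 'a \<Rightarrow> 'a" where
  "grad u x = (\<Sum>b\<in>Basis. frechet_derivative u (at x) b *\<^sub>R b)"

definition divg :: "('a::euclidean_space \<Rightarrow> 'a) \<Rightarrow> 'a \<Rightarrow> real" where
  "divg F x = (\<Sum>b\<in>Basis. frechet_derivative F (at x) b \<bullet> b)"

text \<open>The operator is taken in the pointwise sense. For an Ahlfors regular \<open>\<mu>\<close> the function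
  \<^term>\<open>regularized_dist d \<alpha> E \<mu>\<close> is positive and smooth off \<open>E\<close>, so the
  equation \<open>L D = 0\<close> there has the same meaning classically and weakly.\<close>

definition degenerate_op ::
    "nat \<Rightarrow> real \<Rightarrow> 'a::euclidean_space set \<Rightarrow> 'a measure \<Rightarrow> ('a \<Rightarrow> real) \<Rightarrow> 'a \<Rightarrow> real" where
  "degenerate_op d \<alpha> E \<mu> u x =
     - divg (\<lambda>z. regularized_dist d \<alpha> E \<mu> z powr (- real DIM('a) + real d + 1) *\<^sub>R grad u z) x"

section \<open>Bounded mean oscillation\<close>

definition locally_integrable :: "('a::euclidean_space \<Rightarrow> real) \<Rightarrow> bool" where
  "locally_integrable f \<longleftrightarrow> (\<forall>K. compact K \<longrightarrow> f absolutely_integrable_on K)"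

definition mean_on :: "'a::euclidean_space set \<Rightarrow> ('a \<Rightarrow> real) \<Rightarrow> real" where
  "mean_on B f = (LINT y:B|lebesgue. f y) / measure lebesgue B"

definition bmo_norm :: "('a::euclidean_space \<Rightarrow> real) \<Rightarrow> ennreal" where
  "bmo_norm f =
     (SUP x. SUP r\<in>{0<..}. ennreal (mean_on (ball x r) (\<lambda>y. \<bar>f y - mean_on (ball x r) f\<bar>)))"

definition ess_bounded :: "('a::euclidean_space \<Rightarrow> real) \<Rightarrow> bool" where
  "ess_bounded f \<longleftrightarrow> f \<in> borel_measurable lebesgue \<and> (\<exists>C. AE y in lebesgue. \<bar>f y\<bar> \<le> C)"

section \<open>Flat perturbations\<close>

text \<open>Densities are measurable with respect to the completion of the reference measure, so that
  arbitrary Lebesgue measurable representatives are allowed; nonnegativity is required because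
  \<^const>\<open>ennreal\<close> truncates.\<close>

definition has_density :: "'a measure \<Rightarrow> 'a measure \<Rightarrow> ('a \<Rightarrow> real) \<Rightarrow> bool" where
  "has_density \<mu> \<nu> f \<longleftrightarrow>
     f \<in> borel_measurable (completion \<nu>) \<and> (AE z in completion \<nu>. 0 \<le> f z) \<and>
     sets \<mu> = sets \<nu> \<and>
     (\<forall>A\<in>sets \<nu>. emeasure \<mu> A = (\<integral>\<^sup>+z\<in>A. ennreal (f z) \<partial>completion \<nu>))"

text \<open>The ambient space \<open>\<real>\<^sup>n\<close> is the product \<open>\<real>\<^sup>d \<times> \<real>\<^sup>k\<close> with \<open>n = d + k\<close>; the product norm
  of the library is the Euclidean one.\<close>

definition flat_plane :: "((real^'d) \<times> (real^'k)) set" where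
  "flat_plane = UNIV \<times> {0}"

definition hausdorff_on :: "nat \<Rightarrow> 'a::metric_space set \<Rightarrow> 'a measure" where
  "hausdorff_on d E = density (hausdorff_measure d) (indicator E)"

text \<open>Here \<open>\<phi> t\<close> is the perturbation of the density and \<open>\<psi>\<close> its derivative in \<open>t\<close> at \<open>0\<close>.
  Both are determined only up to null sets, so \<open>\<phi> 0 = 0\<close> and the non-constancy of \<open>\<psi>\<close> are
  understood almost everywhere.\<close>

definition nontrivial_flat_family ::
    "real \<Rightarrow> real \<Rightarrow> (real \<Rightarrow> ((real^'d) \<times> (real^'k)) measure) \<Rightarrow> bool" where
  "nontrivial_flat_family \<alpha> t\<^sub>0 \<mu> \<longleftrightarrow>
     0 < t\<^sub>0 \<and>
     (\<exists>(\<phi> :: real \<Rightarrow> real^'d \<Rightarrow> real) (\<psi> :: real^'d \<Rightarrow> real).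
        (\<forall>t\<in>{0..<t\<^sub>0}.
           ahlfors_regular CARD('d) flat_plane (\<mu> t) \<and>
           (\<forall>x\<in>- flat_plane.
              degenerate_op CARD('d) \<alpha> flat_plane (\<mu> t)
                (regularized_dist CARD('d) \<alpha> flat_plane (\<mu> t)) x = 0) \<and>
           ess_bounded (\<phi> t) \<and>
           has_density (\<mu> t) (hausdorff_on CARD('d) flat_plane) (\<lambda>z. 1 + \<phi> t (fst z))) \<and>
        (AE y in lebesgue. \<phi> 0 y = 0) \<and>
        locally_integrable \<psi> \<and>
        ((\<lambda>t. bmo_norm (\<lambda>y. \<phi> t y - t * \<psi> y) / ennreal t) \<longlongrightarrow> 0) (at_right 0) \<and>
        \<not> (\<exists>c. AE y in lebesgue. \<psi> y = c) \<and>
        (\<exists>C. \<forall>t\<in>{0..<t\<^sub>0}.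
           bmo_norm (\<phi> t) \<le> ennreal (C * t) \<and>
           \<bar>LINT y:ball 0 1|lebesgue. \<phi> t y\<bar> \<le> C * t) \<and>
        (\<lambda>t. LINT y:ball 0 1|lebesgue. \<phi> t y - t * \<psi> y) \<in> o[at_right 0](\<lambda>t. t))"

end

theory Submission
  imports Defs
begin

text \<open>Write \<open>k = n - d\<close>, \<open>s = d + \<alpha>\<close>, let \<open>z = (x, w)\<close> be a point off the plane and \<open>r = |w|\<close>. A measure with density
  \<open>f = 1 + \<phi>\<close> has the potential \<open>R(z) = \<integral>|z - y| powr -s f(y) dy\<close>, and \<open>D = R powr (-1/\<alpha>)\<close> up to the normalization
  of Hausdorff measure. The equation \<open>L D = 0\<close> says that \<open>R powr ((k-2)/\<alpha>)\<close> is harmonic. When \<open>\<alpha> \<noteq> k - 2\<close>,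
  this turns into an identity between first-order quantities (lemma \<open>pde_identity\<close>): with
  \<open>J(z) = \<integral>|z - y| powr -(s+2) f(y) dy\<close> it reads \<open>|\<nabla>R|\<^sup>2 = \<alpha> s R J\<close>, because \<open>\<Delta>|z| powr -s\<close> is a multiple of
  \<open>|z| powr -(s+2)\<close>. In terms of \<open>Q = r powr \<alpha> R\<close>, which is constant for constant \<open>f\<close>, it becomes
  \<open>\<partial>\<^sub>r (Q\<^sup>2) = (2r/\<alpha>) |\<nabla>Q|\<^sup>2\<close>.

  The gradient of \<open>Q\<close> annihilates constant densities, so a dyadic decomposition bounds it by a constant times
  \<open>1/r\<close> times the \<open>BMO\<close> norm of \<open>\<phi>\<close> (lemmas \<open>bmo_riesz\<close>, \<open>mom_bound\<close>, \<open>radial_bound\<close>). For a family with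
  \<open>BMO\<close> norm \<open>O(t)\<close> the increments of \<open>Q\<^sup>2\<close> in \<open>r\<close> are therefore \<open>O(t\<^sup>2)\<close> (lemma \<open>pot_radial_oscillation\<close>),
  while \<open>Q = c + t u + o(t)\<close> pointwise, where \<open>u\<close> is \<open>r powr \<alpha>\<close> times the potential of the derivative \<open>\<psi>\<close> of the family
  (lemma \<open>bmo_potential_bound\<close>). Hence \<open>u\<close> does not depend on \<open>r\<close>. Its tangential gradient is \<open>O(1/r)\<close>
  (lemma \<open>pot_tangential_oscillation\<close>), so for \<open>r\<close> tending to infinity \<open>u\<close> is seen to be constant. The potential of
  a suitable \<open>\<psi> - const\<close> thus vanishes identically, and \<open>\<psi>\<close> is constant almost everywhere, since
  the Riesz potential is injective (lemma \<open>riesz_potential_injective\<close>). This contradicts the non-triviality of the family.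

  That the Hausdorff measure of the definition is a positive multiple of Lebesgue measure on the plane
  (lemma \<open>hausdorff_on_plane\<close>) follows from its invariance under translations.\<close>

section \<open>Riesz kernels and the dyadic estimate\<close>

text \<open>The Riesz kernel of exponent \<open>s\<close> between a point \<open>z\<close> of the product space and the point \<open>(y, 0)\<close> of
  the plane. Throughout, \<open>\<real>\<^sup>d \<times> {0}\<close> is identified with the first factor, \<open>z = (x, w)\<close>, \<open>r = |w|\<close> is the
  distance to the plane and \<open>s = d + \<alpha>\<close>.\<close>

definition riesz :: "real \<Rightarrow> 'a::euclidean_space \<times> 'b::euclidean_space \<Rightarrow> 'a \<Rightarrow> real" where
  "riesz s z y = norm (z - (y, 0)) powr (- s)"

lemma norm_diff_plane: "norm ((x, w) - (y, 0)) = sqrt ((norm (x - y))\<^sup>2 + (norm w)\<^sup>2)"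
  by (simp add: norm_Pair)

lemma norm_snd_le_diff_plane: "norm (snd z) \<le> norm (z - (y, 0))"
  by (cases z) (simp add: norm_snd_le)

lemma norm_fst_le_diff_plane: "norm (fst z - y) \<le> norm (z - (y, 0))"
  by (cases z) (simp add: norm_fst_le)

lemma riesz_nonneg [simp]: "0 \<le> riesz s z y"
  by (simp add: riesz_def)

lemma riesz_pos: "snd z \<noteq> 0 \<Longrightarrow> 0 < riesz s z y"
  by (auto simp: riesz_def prod_eq_iff)

lemma borel_measurable_riesz: "riesz s z \<in> borel_measurable borel"
  unfolding riesz_def by (intro powr_real_measurable borel_measurable_const
     borel_measurable_continuous_onI continuous_intros)

lemma borel_measurable_riesz_lebesgue [measurable]: "riesz s z \<in> borel_measurable lebesgue"
  using borel_measurable_riesz[of s z] by (intro measurable_completion) simp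

lemma summable_dyadic:
  assumes "0 < \<alpha>"
  shows "summable (\<lambda>j. (1 + real j) * (2 powr - \<alpha>) ^ j)"
proof -
  have "(\<lambda>j. of_nat (Suc j) * (2 powr - \<alpha>) ^ j) sums (1 / (1 - 2 powr - \<alpha>)\<^sup>2)"
    using assms by (intro geometric_deriv_sums) (simp add: powr_less_one)
  then have "summable (\<lambda>j. of_nat (Suc j) * (2 powr - \<alpha>) ^ j)"
    by (rule sums_summable)
  then show ?thesis unfolding of_nat_Suc .
qed

text \<open>The constant obtained by summing the kernel over dyadic annuli when the mean oscillation over
  the \<open>j\<close>-th dilate of a ball is of size \<open>1 + j\<close>.\<close>

definition dyadic_const :: "real \<Rightarrow> real \<Rightarrow> real" where
  "dyadic_const s \<alpha> = 2 powr s * (\<Sum>j. (1 + real j) * (2 powr - \<alpha>) ^ j)"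

lemma dyadic_const_nonneg: "0 < \<alpha> \<Longrightarrow> 0 \<le> dyadic_const s \<alpha>"
  unfolding dyadic_const_def by (intro mult_nonneg_nonneg suminf_nonneg summable_dyadic) auto

text \<open>On the annulus between the \<open>(j-1)\<close>-st and the \<open>j\<close>-th dyadic dilate of the ball of radius \<open>|w|\<close> the
  kernel is at most its value at the inner radius; for \<open>j = 0\<close> the factor \<open>1/2\<close> is only a loss.\<close>

lemma riesz_le_dyadic:
  fixes w :: "'b::euclidean_space" and x y :: "'a::euclidean_space"
  assumes "w \<noteq> 0" "0 \<le> s"
  obtains j :: nat where "y \<in> ball x (2 ^ j * norm w)"
    "riesz s (x, w) y \<le> (2 ^ j * norm w / 2) powr - s"
proof -
  have r: "0 < norm w" using assms by simp
  obtain j0 where "dist x y / norm w < 2 ^ j0" using real_arch_pow[of 2] by auto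
  then have ex: "dist x y < 2 ^ j0 * norm w" using r by (simp add: field_simps)
  define j where "j = (LEAST j. dist x y < 2 ^ j * norm w)"
  have j: "dist x y < 2 ^ j * norm w" unfolding j_def using ex by (rule LeastI)
  have le: "2 ^ j * norm w / 2 \<le> norm ((x, w) - (y, 0))"
  proof (cases j)
    case 0
    have "norm w \<le> norm ((x, w) - (y, 0))" using norm_snd_le_diff_plane[of "(x,w)" y] by simp
    moreover have "0 \<le> norm ((x, w) - (y, 0))" by (rule norm_ge_zero)
    ultimately have "norm w / 2 \<le> norm ((x, w) - (y, 0))" by linarith
    then show ?thesis unfolding 0 by simp
  next
    case (Suc i)
    then have "\<not> dist x y < 2 ^ i * norm w"
      using not_less_Least[of i "\<lambda>j. dist x y < 2 ^ j * norm w"] j_def by auto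
    then show ?thesis
      using norm_fst_le_diff_plane[of "(x,w)" y] Suc by (simp only: fst_conv dist_norm) simp
  qed
  show ?thesis
  proof
    show "y \<in> ball x (2 ^ j * norm w)" using j by simp
    show "riesz s (x, w) y \<le> (2 ^ j * norm w / 2) powr - s"
      unfolding riesz_def using r assms le by (intro powr_mono2') auto
  qed
qed

text \<open>If the integrals of \<open>g\<close> over the dyadic dilates of a ball grow only logarithmically
  faster than the volume, then \<open>g\<close> is integrable against the kernel.\<close>

lemma nn_integral_riesz_dyadic:
  fixes w :: "'b::euclidean_space" and x :: "'a::euclidean_space"
  assumes w: "w \<noteq> 0" and \<alpha>: "0 < \<alpha>" and A: "0 \<le> A"
    and s: "s = real DIM('a) + \<alpha>"
    and g [measurable]: "g \<in> borel_measurable lebesgue" "\<And>y. 0 \<le> g y"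
    and bd: "\<And>j::nat. (\<integral>\<^sup>+y\<in>ball x (2 ^ j * norm w). ennreal (g y) \<partial>lebesgue)
               \<le> ennreal (A * (1 + real j) * (2 ^ j * norm w) ^ DIM('a))"
  shows "(\<integral>\<^sup>+y. riesz s (x, w) y * g y \<partial>lebesgue)
      \<le> ennreal (dyadic_const s \<alpha> * A * norm w powr - \<alpha>)"
proof -
  let ?r = "norm w" and ?d = "DIM('a)"
  let ?B = "\<lambda>j::nat. ball x (2 ^ j * ?r)"
  let ?c = "\<lambda>j::nat. (2 ^ j * ?r / 2) powr - s"
  have r: "0 < ?r" using w by simp
  have s0: "0 \<le> s" using s \<alpha> by simp
  have mB: "(\<lambda>y. ennreal (g y) * indicator (?B j) y) \<in> borel_measurable lebesgue" for j
    by (intro borel_measurable_times_ennreal borel_measurable_indicator measurable_compose[OF g(1) measurable_ennreal]) auto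
  have "ennreal (riesz s (x, w) y * g y) \<le> (\<Sum>j. ennreal (?c j) * (ennreal (g y) * indicator (?B j) y))" for y
  proof -
    obtain j where j: "y \<in> ?B j" "riesz s (x, w) y \<le> ?c j"
      using riesz_le_dyadic[OF w s0] by metis
    have "ennreal (riesz s (x, w) y * g y) \<le> ennreal (?c j) * (ennreal (g y) * indicator (?B j) y)"
    proof -
      have "ennreal (riesz s (x, w) y * g y) \<le> ennreal (?c j * g y)"
        using j g(2)[of y] by (intro ennreal_leI mult_right_mono) auto
      then show ?thesis using j g(2)[of y] by (simp add: ennreal_mult)
    qed
    also have "\<dots> \<le> (\<Sum>j. ennreal (?c j) * (ennreal (g y) * indicator (?B j) y))"
      using sum_le_suminf[of "\<lambda>j. ennreal (?c j) * (ennreal (g y) * indicator (?B j) y)" "{j}"] by simp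
    finally show ?thesis .
  qed
  then have "(\<integral>\<^sup>+y. riesz s (x, w) y * g y \<partial>lebesgue)
      \<le> (\<integral>\<^sup>+y. (\<Sum>j. ennreal (?c j) * (ennreal (g y) * indicator (?B j) y)) \<partial>lebesgue)"
    by (intro nn_integral_mono)
  also have "\<dots> = (\<Sum>j. \<integral>\<^sup>+y. ennreal (?c j) * (ennreal (g y) * indicator (?B j) y) \<partial>lebesgue)"
    by (intro nn_integral_suminf borel_measurable_times_ennreal borel_measurable_const mB)
  also have "\<dots> = (\<Sum>j. ennreal (?c j) * (\<integral>\<^sup>+y\<in>?B j. ennreal (g y) \<partial>lebesgue))"
    by (intro suminf_cong nn_integral_cmult mB)
  also have "\<dots> \<le> (\<Sum>j. ennreal (2 powr s * A * ?r powr - \<alpha> * ((1 + real j) * (2 powr - \<alpha>) ^ j)))"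
  proof (intro suminf_le)
    fix j :: nat
    have "ennreal (?c j) * (\<integral>\<^sup>+y\<in>?B j. ennreal (g y) \<partial>lebesgue)
        \<le> ennreal (?c j) * ennreal (A * (1 + real j) * (2 ^ j * ?r) ^ ?d)"
      by (intro mult_left_mono bd) auto
    also have "\<dots> = ennreal (?c j * (A * (1 + real j) * (2 ^ j * ?r) ^ ?d))"
      using A r by (subst ennreal_mult) auto
    also have "?c j * (A * (1 + real j) * (2 ^ j * ?r) ^ ?d)
        = 2 powr s * A * ?r powr - \<alpha> * ((1 + real j) * (2 powr - \<alpha>) ^ j)"
    proof -
      have "?c j * (2 ^ j * ?r) ^ ?d = 2 powr s * ((2 ^ j * ?r) powr - s * (2 ^ j * ?r) powr real ?d)"
        using r by (simp add: powr_divide powr_minus_divide powr_realpow)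
      also have "\<dots> = 2 powr s * (2 ^ j * ?r) powr - \<alpha>"
        using s by (simp add: powr_add[symmetric])
      also have "\<dots> = 2 powr s * (?r powr - \<alpha> * (2 powr - \<alpha>) ^ j)"
        using r by (simp add: powr_mult powr_power powr_realpow[symmetric] powr_powr mult_ac)
      finally have e: "?c j * (2 ^ j * ?r) ^ ?d = 2 powr s * (?r powr - \<alpha> * (2 powr - \<alpha>) ^ j)" .
      have "?c j * (A * (1 + real j) * (2 ^ j * ?r) ^ ?d) = A * (1 + real j) * (?c j * (2 ^ j * ?r) ^ ?d)"
        by (simp only: mult_ac)
      then show ?thesis unfolding e by (simp only: mult_ac)
    qed
    finally show "ennreal (?c j) * (\<integral>\<^sup>+y\<in>?B j. ennreal (g y) \<partial>lebesgue)
       \<le> ennreal (2 powr s * A * ?r powr - \<alpha> * ((1 + real j) * (2 powr - \<alpha>) ^ j))" .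
  qed auto
  also have "\<dots> = ennreal (\<Sum>j. 2 powr s * A * ?r powr - \<alpha> * ((1 + real j) * (2 powr - \<alpha>) ^ j))"
    using A by (intro suminf_ennreal2 summable_mult summable_dyadic \<alpha>) auto
  also have "(\<Sum>j. 2 powr s * A * ?r powr - \<alpha> * ((1 + real j) * (2 powr - \<alpha>) ^ j))
      = dyadic_const s \<alpha> * A * ?r powr - \<alpha>"
    using summable_dyadic[OF \<alpha>] by (subst suminf_mult) (auto simp: dyadic_const_def)
  finally show ?thesis .
qed

lemma integrable_riesz_dyadic:
  fixes w :: "'b::euclidean_space" and x :: "'a::euclidean_space"
  assumes w: "w \<noteq> 0" and \<alpha>: "0 < \<alpha>" and A: "0 \<le> A"
    and s: "s = real DIM('a) + \<alpha>"
    and g [measurable]: "g \<in> borel_measurable lebesgue"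
    and bd: "\<And>j::nat. (\<integral>\<^sup>+y\<in>ball x (2 ^ j * norm w). ennreal \<bar>g y\<bar> \<partial>lebesgue)
               \<le> ennreal (A * (1 + real j) * (2 ^ j * norm w) ^ DIM('a))"
  shows "integrable lebesgue (\<lambda>y. riesz s (x, w) y * g y)"
    and "(LINT y|lebesgue. riesz s (x, w) y * \<bar>g y\<bar>) \<le> dyadic_const s \<alpha> * A * norm w powr - \<alpha>"
proof -
  have le: "(\<integral>\<^sup>+y. riesz s (x, w) y * \<bar>g y\<bar> \<partial>lebesgue)
      \<le> ennreal (dyadic_const s \<alpha> * A * norm w powr - \<alpha>)"
    by (rule nn_integral_riesz_dyadic[OF w \<alpha> A s _ _ bd]) auto
  have i: "integrable lebesgue (\<lambda>y. riesz s (x, w) y * \<bar>g y\<bar>)"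
    using le by (intro integrableI_nonneg) (auto simp: less_top[symmetric] top_unique)
  show "integrable lebesgue (\<lambda>y. riesz s (x, w) y * g y)"
    by (rule Bochner_Integration.integrable_bound[OF i]) (auto simp: abs_mult)
  show "(LINT y|lebesgue. riesz s (x, w) y * \<bar>g y\<bar>) \<le> dyadic_const s \<alpha> * A * norm w powr - \<alpha>"
    using le dyadic_const_nonneg[OF \<alpha>, of s] A
    by (subst (asm) nn_integral_eq_integral[OF i]) auto
qed

lemma integrable_riesz_bounded:
  fixes z :: "'a::euclidean_space \<times> 'b::euclidean_space"
  assumes z: "snd z \<noteq> 0" and \<alpha>: "0 < \<alpha>"
    and s: "s = real DIM('a) + \<alpha>"
    and g [measurable]: "g \<in> borel_measurable lebesgue"
    and bd: "AE y in lebesgue. \<bar>g y\<bar> \<le> C"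
  shows "integrable lebesgue (\<lambda>y. riesz s z y * g y)"
proof -
  obtain x w where zz: "z = (x, w)" by (cases z)
  have "(\<integral>\<^sup>+y\<in>ball x (2 ^ j * norm w). ennreal \<bar>g y\<bar> \<partial>lebesgue)
    \<le> ennreal (\<bar>C\<bar> * unit_ball_vol (real DIM('a)) * (1 + real j) * (2 ^ j * norm w) ^ DIM('a))" for j :: nat
  proof -
    have "(\<integral>\<^sup>+y\<in>ball x (2 ^ j * norm w). ennreal \<bar>g y\<bar> \<partial>lebesgue)
      \<le> (\<integral>\<^sup>+y. ennreal \<bar>C\<bar> * indicator (ball x (2 ^ j * norm w)) y \<partial>lebesgue)"
      using bd by (intro nn_integral_mono_AE) (auto elim!: eventually_mono simp: indicator_def intro!: ennreal_leI)
    also have "\<dots> = ennreal (\<bar>C\<bar> * (unit_ball_vol (real DIM('a)) * (2 ^ j * norm w) ^ DIM('a)))"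
      by (simp add: nn_integral_cmult_indicator emeasure_ball ennreal_mult)
    also have "\<dots> \<le> ennreal (\<bar>C\<bar> * unit_ball_vol (real DIM('a)) * (1 + real j) * (2 ^ j * norm w) ^ DIM('a))"
    proof (rule ennreal_leI)
      have "0 \<le> \<bar>C\<bar> * (unit_ball_vol (real DIM('a)) * (2 ^ j * norm w) ^ DIM('a)) * real j" by simp
      then show "\<bar>C\<bar> * (unit_ball_vol (real DIM('a)) * (2 ^ j * norm w) ^ DIM('a))
        \<le> \<bar>C\<bar> * unit_ball_vol (real DIM('a)) * (1 + real j) * (2 ^ j * norm w) ^ DIM('a)"
        by (simp add: algebra_simps)
    qed
    finally show ?thesis .
  qed
  then show ?thesis unfolding zz
    using z zz \<alpha> by (intro integrable_riesz_dyadic(1)[OF _ \<alpha> _ s g, where A="\<bar>C\<bar> * unit_ball_vol (real DIM('a))"]) auto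
qed

section \<open>Bounded mean oscillation against the Riesz kernel\<close>

lemma locally_integrable_ball:
  "locally_integrable f \<Longrightarrow> set_integrable lebesgue (ball x r) f"
  unfolding locally_integrable_def
  by (rule set_integrable_subset[of _ "cball x r"]) auto

lemma locally_integrable_measurable:
  fixes f :: "'a::euclidean_space \<Rightarrow> real"
  assumes "locally_integrable f"
  shows "f \<in> borel_measurable lebesgue"
proof (rule borel_measurable_LIMSEQ_real)
  fix n :: nat
  show "(\<lambda>y. indicator (ball 0 (real n)) y * f y) \<in> borel_measurable lebesgue"
    using locally_integrable_ball[OF assms, of 0 "real n"]
    unfolding set_integrable_def by (auto dest: borel_measurable_integrable)
next
  fix y :: 'a
  obtain N :: nat where N: "norm y < real N" using reals_Archimedean2 by blast
  have "\<forall>\<^sub>F n in sequentially. indicator (ball 0 (real n)) y * f y = f y"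
    using eventually_ge_at_top[of N]
    by eventually_elim (use N in \<open>auto simp: indicator_def\<close>)
  then show "(\<lambda>n. indicator (ball 0 (real n)) y * f y) \<longlonglongrightarrow> f y"
    by (rule tendsto_eventually)
qed

lemma locally_integrable_diff_const:
  fixes f :: "'a::euclidean_space \<Rightarrow> real"
  shows "locally_integrable f \<Longrightarrow> locally_integrable (\<lambda>y. f y - c)"
  unfolding locally_integrable_def
  by (intro allI impI set_integral_diff(1)) (auto intro!: absolutely_integrable_on_const lmeasurable_compact)

lemma ess_bounded_locally_integrable:
  fixes f :: "'a::euclidean_space \<Rightarrow> real"
  assumes "ess_bounded f"
  shows "locally_integrable f"
  unfolding locally_integrable_def
proof (intro allI impI)
  fix K :: "'a set" assume K: "compact K"
  obtain C where C: "AE y in lebesgue. \<bar>f y\<bar> \<le> C" and [measurable]: "f \<in> borel_measurable lebesgue"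
    using assms by (auto simp: ess_bounded_def)
  have [measurable]: "K \<in> sets lebesgue" using K by (simp add: compact_imp_closed borel_closed)
  have "set_integrable lebesgue K (\<lambda>y. C)"
    using K by (intro absolutely_integrable_on_const lmeasurable_compact)
  then show "set_integrable lebesgue K f"
    unfolding set_integrable_def
    by (rule Bochner_Integration.integrable_bound)
       (use C in \<open>auto elim!: eventually_mono simp: indicator_def\<close>)
qed

lemma measure_ball_pos: "0 < r \<Longrightarrow> 0 < measure lebesgue (ball (x::'a::euclidean_space) r)"
  by (simp add: content_ball_pos)

lemma set_integral_const_ball:
  "(LINT y:ball (x::'a::euclidean_space) r|lebesgue. (c::real)) = measure lebesgue (ball x r) * c"
  using emeasure_lborel_ball_finite[of x r] by (simp add: set_integral_const)

lemma bmo_oscillation_le: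
  fixes f :: "'a::euclidean_space \<Rightarrow> real"
  assumes "bmo_norm f \<le> ennreal b" "0 \<le> b" "0 < r"
  shows "(LINT y:ball x r|lebesgue. \<bar>f y - mean_on (ball x r) f\<bar>) \<le> b * measure lebesgue (ball x r)"
proof -
  have "ennreal (mean_on (ball x r) (\<lambda>y. \<bar>f y - mean_on (ball x r) f\<bar>)) \<le> bmo_norm f"
    unfolding bmo_norm_def using assms(3) by (intro SUP_upper2[of x] SUP_upper) auto
  also note assms(1)
  finally have "mean_on (ball x r) (\<lambda>y. \<bar>f y - mean_on (ball x r) f\<bar>) \<le> b"
    using assms(2) by (simp add: ennreal_le_iff)
  then show ?thesis
    using measure_ball_pos[OF assms(3), of x] by (simp add: mean_on_def[of _ "\<lambda>y. \<bar>f y - mean_on (ball x r) f\<bar>"] pos_divide_le_eq)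
qed

text \<open>Means over nested balls differ by at most the oscillation over the larger ball, times the ratio
  of the volumes.\<close>

lemma mean_on_ball_subset_diff:
  fixes f :: "'a::euclidean_space \<Rightarrow> real"
  assumes f: "locally_integrable f" and b: "bmo_norm f \<le> ennreal b" "0 \<le> b"
    and r: "0 < r" "0 < r'" and sub: "ball x' r' \<subseteq> ball x r"
  shows "\<bar>mean_on (ball x' r') f - mean_on (ball x r) f\<bar> \<le> (r / r') ^ DIM('a) * b"
proof -
  let ?m = "mean_on (ball x r) f" and ?V = "\<lambda>x r. measure lebesgue (ball x r)"
  have i: "set_integrable lebesgue (ball u \<rho>) (\<lambda>y. f y - ?m)" for u \<rho>
    using f by (intro locally_integrable_ball locally_integrable_diff_const)
  have ia: "set_integrable lebesgue (ball u \<rho>) (\<lambda>y. \<bar>f y - ?m\<bar>)" for u \<rho>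
    using i by (rule set_integrable_abs)
  have V: "0 < ?V x' r'" using r by (intro measure_ball_pos)
  have "(LINT y:ball x' r'|lebesgue. f y - ?m) = (LINT y:ball x' r'|lebesgue. f y) - ?m * ?V x' r'"
    by (subst set_integral_diff(2)) (auto intro: locally_integrable_ball[OF f]
         simp: set_integral_const_ball absolutely_integrable_on_const)
  then have "mean_on (ball x' r') f - ?m = (LINT y:ball x' r'|lebesgue. f y - ?m) / ?V x' r'"
    using V by (simp add: mean_on_def[of "ball x' r'"] field_simps)
  moreover have "\<bar>LINT y:ball x' r'|lebesgue. f y - ?m\<bar> \<le> (LINT y:ball x' r'|lebesgue. \<bar>f y - ?m\<bar>)"
    using set_integral_norm_bound[OF i] by simp
  moreover have "\<dots> \<le> (LINT y:ball x r|lebesgue. \<bar>f y - ?m\<bar>)"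
    unfolding set_lebesgue_integral_def
    using ia[of x r] ia[of x' r'] sub unfolding set_integrable_def
    by (intro integral_mono) (auto simp: indicator_def)
  moreover have "\<dots> \<le> b * ?V x r"
    using b r by (intro bmo_oscillation_le)
  ultimately have "\<bar>mean_on (ball x' r') f - ?m\<bar> \<le> b * ?V x r / ?V x' r'"
    using V by (simp add: divide_right_mono)
  also have "\<dots> = (r / r') ^ DIM('a) * b"
    using r content_ball_pos[of 1 "0::'a"] content_ball_conv_unit_ball[of r x] content_ball_conv_unit_ball[of r' x']
    by (simp add: power_divide field_simps)
  finally show ?thesis .
qed

lemma bmo_dyadic_mean:
  fixes f :: "'a::euclidean_space \<Rightarrow> real"
  assumes f: "locally_integrable f" and b: "bmo_norm f \<le> ennreal b" "0 \<le> b"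
    and r: "0 < r"
  shows "\<bar>mean_on (ball x (2 ^ j * r)) f - mean_on (ball x r) f\<bar> \<le> real j * 2 ^ DIM('a) * b"
proof (induction j)
  case (Suc j)
  have "ball x (2 ^ j * r) \<subseteq> ball x (2 ^ Suc j * r)"
    using r by (intro subset_ball) simp
  then have "\<bar>mean_on (ball x (2 ^ j * r)) f - mean_on (ball x (2 ^ Suc j * r)) f\<bar>
      \<le> (2 ^ Suc j * r / (2 ^ j * r)) ^ DIM('a) * b"
    using f b r by (intro mean_on_ball_subset_diff) auto
  then have "\<bar>mean_on (ball x (2 ^ j * r)) f - mean_on (ball x (2 ^ Suc j * r)) f\<bar> \<le> 2 ^ DIM('a) * b"
    using r by simp
  then show ?case using Suc.IH by (simp add: algebra_simps)
qed simp

text \<open>The means over dyadic dilates drift by at most a constant per step, so that the oscillation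
  around the mean of the innermost ball grows linearly in the number of steps.\<close>

lemma bmo_dyadic_oscillation:
  fixes f :: "'a::euclidean_space \<Rightarrow> real"
  assumes f: "locally_integrable f" and b: "bmo_norm f \<le> ennreal b" "0 \<le> b"
    and r: "0 < r"
  shows "(\<integral>\<^sup>+y\<in>ball x (2 ^ j * r). ennreal \<bar>f y - mean_on (ball x r) f\<bar> \<partial>lebesgue)
    \<le> ennreal ((unit_ball_vol (real DIM('a)) * 2 ^ DIM('a) * b) * (1 + real j) * (2 ^ j * r) ^ DIM('a))"
proof -
  let ?m = "mean_on (ball x r) f" and ?B = "ball x (2 ^ j * r)"
  let ?mj = "mean_on ?B f" and ?V = "measure lebesgue (ball x (2 ^ j * r))"
  have i: "set_integrable lebesgue ?B (\<lambda>y. \<bar>f y - c\<bar>)" for c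
    using f by (intro set_integrable_abs locally_integrable_ball locally_integrable_diff_const)
  have ic: "set_integrable lebesgue ?B (\<lambda>y. c::real)" for c
    by (intro absolutely_integrable_on_const) auto
  have "(\<integral>\<^sup>+y\<in>?B. ennreal \<bar>f y - ?m\<bar> \<partial>lebesgue) = ennreal (LINT y:?B|lebesgue. \<bar>f y - ?m\<bar>)"
  proof -
    have "(\<integral>\<^sup>+y\<in>?B. ennreal \<bar>f y - ?m\<bar> \<partial>lebesgue)
        = (\<integral>\<^sup>+y. ennreal (indicator ?B y *\<^sub>R \<bar>f y - ?m\<bar>) \<partial>lebesgue)"
      by (intro nn_integral_cong) (simp add: indicator_def)
    also have "\<dots> = ennreal (LINT y:?B|lebesgue. \<bar>f y - ?m\<bar>)"
      using i[of ?m] unfolding set_lebesgue_integral_def set_integrable_def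
      by (intro nn_integral_eq_integral) auto
    finally show ?thesis .
  qed
  also have "\<dots> \<le> ennreal ((unit_ball_vol (real DIM('a)) * 2 ^ DIM('a) * b) * (1 + real j) * (2 ^ j * r) ^ DIM('a))"
  proof (rule ennreal_leI)
    have "(LINT y:?B|lebesgue. \<bar>f y - ?m\<bar>) \<le> (LINT y:?B|lebesgue. \<bar>f y - ?mj\<bar> + \<bar>?mj - ?m\<bar>)"
      by (intro set_integral_mono i set_integral_add ic) auto
    also have "\<dots> = (LINT y:?B|lebesgue. \<bar>f y - ?mj\<bar>) + \<bar>?mj - ?m\<bar> * ?V"
      by (subst set_integral_add(2)[OF i ic]) (simp add: set_integral_const_ball)
    also have "\<dots> \<le> b * ?V + (real j * 2 ^ DIM('a) * b) * ?V"
      using f b r by (intro add_mono mult_right_mono bmo_oscillation_le bmo_dyadic_mean) auto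
    also have "\<dots> \<le> (2 ^ DIM('a) * b) * ?V + (real j * 2 ^ DIM('a) * b) * ?V"
      using b by (intro add_mono mult_right_mono) (auto simp: mult_le_cancel_right1)
    also have "\<dots> = (unit_ball_vol (real DIM('a)) * 2 ^ DIM('a) * b) * (1 + real j) * (2 ^ j * r) ^ DIM('a)"
      using r by (simp add: content_ball algebra_simps)
    finally show "(LINT y:?B|lebesgue. \<bar>f y - ?m\<bar>)
      \<le> (unit_ball_vol (real DIM('a)) * 2 ^ DIM('a) * b) * (1 + real j) * (2 ^ j * r) ^ DIM('a)" .
  qed
  finally show ?thesis .
qed

text \<open>The constant in the bound of the Riesz potential of the oscillation by the \<open>BMO\<close> norm.\<close>

definition bmo_const :: "nat \<Rightarrow> real \<Rightarrow> real" where
  "bmo_const d \<alpha> = dyadic_const (real d + \<alpha>) \<alpha> * (unit_ball_vol (real d) * 2 ^ d)"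

lemma bmo_const_nonneg: "0 < \<alpha> \<Longrightarrow> 0 \<le> bmo_const d \<alpha>"
  by (simp add: bmo_const_def dyadic_const_nonneg)

text \<open>The basic estimate: after subtraction of the mean over the ball of radius \<open>r = |w|\<close> around \<open>x\<close>, the
  potential of a \<open>BMO\<close> function at \<open>(x, w)\<close> is at most a constant times \<open>r powr -\<alpha>\<close> times its norm.\<close>

lemma bmo_riesz:
  fixes f :: "'a::euclidean_space \<Rightarrow> real" and w :: "'b::euclidean_space"
  assumes f: "locally_integrable f" and b: "bmo_norm f \<le> ennreal b" "0 \<le> b"
    and w: "w \<noteq> 0" and \<alpha>: "0 < \<alpha>" and s: "s = real DIM('a) + \<alpha>"
  shows "integrable lebesgue (\<lambda>y. riesz s (x, w) y * (f y - mean_on (ball x (norm w)) f))"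
    and "(LINT y|lebesgue. riesz s (x, w) y * \<bar>f y - mean_on (ball x (norm w)) f\<bar>)
      \<le> bmo_const DIM('a) \<alpha> * b * norm w powr - \<alpha>"
proof -
  let ?m = "mean_on (ball x (norm w)) f"
  let ?A = "unit_ball_vol (real DIM('a)) * 2 ^ DIM('a) * b"
  have A: "0 \<le> ?A" using b by simp
  have m: "(\<lambda>y. f y - ?m) \<in> borel_measurable lebesgue"
    using f by (intro locally_integrable_measurable locally_integrable_diff_const)
  have r: "0 < norm w" using w by simp
  note * = integrable_riesz_dyadic[OF w \<alpha> A s m bmo_dyadic_oscillation[OF f b r]]
  show "integrable lebesgue (\<lambda>y. riesz s (x, w) y * (f y - ?m))" by (rule *(1))
  show "(LINT y|lebesgue. riesz s (x, w) y * \<bar>f y - ?m\<bar>) \<le> bmo_const DIM('a) \<alpha> * b * norm w powr - \<alpha>"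
    using *(2) s by (simp add: bmo_const_def mult_ac)
qed

section \<open>Differentiation of potentials\<close>

text \<open>Differentiation under the integral sign: if the derivatives of the integrand are dominated near
  \<open>z0\<close> by an integrable function, the mean value inequality dominates the difference quotients.\<close>

lemma has_derivative_integral_dominated:
  fixes F :: "'z::real_normed_vector \<Rightarrow> 'y \<Rightarrow> real"
  assumes e: "0 < e"
    and int: "\<And>z. z \<in> ball z0 e \<Longrightarrow> integrable M (F z)"
    and der: "\<And>z y. z \<in> ball z0 e \<Longrightarrow> ((\<lambda>z. F z y) has_derivative F' z y) (at z)"
    and bound: "\<And>z y v. z \<in> ball z0 e \<Longrightarrow> \<bar>F' z y v\<bar> \<le> h y * norm v"
    and h: "integrable M h" "\<And>y. 0 \<le> h y"
    and meas: "\<And>v. (\<lambda>y. F' z0 y v) \<in> borel_measurable M"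
  shows "((\<lambda>z. LINT y|M. F z y) has_derivative (\<lambda>v. LINT y|M. F' z0 y v)) (at z0)"
proof -
  let ?B = "ball z0 e"
  have z0: "z0 \<in> ?B" using e by simp
  have lin: "linear (F' z0 y)" for y
    using der[OF z0] by (intro bounded_linear.linear has_derivative_bounded_linear)
  have int': "integrable M (\<lambda>y. F' z0 y v)" for v
    by (rule Bochner_Integration.integrable_bound[OF integrable_mult_left[OF h(1), of "norm v"] meas])
       (use bound[OF z0] in \<open>auto intro: order_trans[OF _ abs_ge_self]\<close>)
  have lip: "\<bar>F z y - F z0 y\<bar> \<le> h y * norm (z - z0)" if "z \<in> ?B" for z y
  proof -
    have "norm (F z y - F z0 y) \<le> h y * norm (z - z0)"
    proof (rule differentiable_bound[of ?B])
      show "((\<lambda>z. F z y) has_derivative F' x y) (at x within ?B)" if "x \<in> ?B" for x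
        using der[OF that] by (rule has_derivative_at_withinI)
      show "onorm (F' x y) \<le> h y" if "x \<in> ?B" for x
        using bound[OF that] h(2) by (intro onorm_bound) auto
    qed (use that z0 in auto)
    then show ?thesis by simp
  qed
  have "((\<lambda>z. norm ((LINT y|M. F z y) - (LINT y|M. F z0 y) - (LINT y|M. F' z0 y (z - z0))) / norm (z - z0)) \<longlongrightarrow> 0)
      (at z0 within ?B)"
    unfolding tendsto_at_iff_sequentially
  proof (intro allI impI)
    fix X assume X: "\<forall>i. X i \<in> ?B - {z0}" "X \<longlonglongrightarrow> z0"
    \<comment> \<open>the normalized linearization error along the sequence, dominated by \<open>2 h\<close>\<close>
    define q where "q i y = (F (X i) y - F z0 y - F' z0 y (X i - z0)) / norm (X i - z0)" for i y
    have "(\<lambda>i. LINT y|M. q i y) \<longlonglongrightarrow> (LINT y|M. (\<lambda>_. 0) y)"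
    proof (rule integral_dominated_convergence[where w = "\<lambda>y. 2 * h y"])
      show "q i \<in> borel_measurable M" for i
        unfolding q_def using int[of "X i"] int[OF z0] X(1) int'[of "X i - z0"]
        by (intro borel_measurable_divide borel_measurable_diff borel_measurable_const)
           (auto dest: borel_measurable_integrable)
      show "integrable M (\<lambda>y. 2 * h y)" using h by simp
      show "AE y in M. norm (q i y) \<le> 2 * h y" for i
      proof (rule AE_I2)
        fix y
        have "\<bar>F (X i) y - F z0 y - F' z0 y (X i - z0)\<bar> \<le> 2 * h y * norm (X i - z0)"
          using lip[of "X i" y] bound[OF z0, of y "X i - z0"] X(1) by auto
        then show "norm (q i y) \<le> 2 * h y"
          using X(1) by (simp add: q_def abs_divide pos_divide_le_eq)
      qed
      show "AE y in M. (\<lambda>i. q i y) \<longlonglongrightarrow> 0"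
      proof (rule AE_I2)
        fix y
        have "((\<lambda>z. (F z y - F z0 y - F' z0 y (z - z0)) /\<^sub>R norm (z - z0)) \<longlongrightarrow> 0) (at z0 within ?B)"
          using has_derivative_at_withinI[OF der[OF z0], of y ?B]
          unfolding has_derivative_at_within by blast
        then have "((\<lambda>z. (F z y - F z0 y - F' z0 y (z - z0)) /\<^sub>R norm (z - z0)) \<circ> X) \<longlonglongrightarrow> 0"
          using X unfolding tendsto_at_iff_sequentially by blast
        then show "(\<lambda>i. q i y) \<longlonglongrightarrow> 0"
          by (simp add: q_def comp_def divide_inverse mult.commute)
      qed
    qed simp
    then have lim: "(\<lambda>i. norm (LINT y|M. q i y)) \<longlonglongrightarrow> 0"
      by (intro tendsto_norm_zero) simp
    have "norm ((LINT y|M. F (X i) y) - (LINT y|M. F z0 y) - (LINT y|M. F' z0 y (X i - z0))) / norm (X i - z0)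
        = norm (LINT y|M. q i y)" for i
      unfolding q_def using int[of "X i"] int[OF z0] X(1) int'[of "X i - z0"]
      by (simp add: Bochner_Integration.integral_diff)
    with lim show "((\<lambda>z. norm ((LINT y|M. F z y) - (LINT y|M. F z0 y) - (LINT y|M. F' z0 y (z - z0)))
        / norm (z - z0)) \<circ> X) \<longlonglongrightarrow> 0"
      by (simp add: comp_def)
  qed
  moreover have "bounded_linear (\<lambda>v. LINT y|M. F' z0 y v)"
  proof (rule bounded_linear_intro[where K = "LINT y|M. h y"])
    show "(LINT y|M. F' z0 y (u + v)) = (LINT y|M. F' z0 y u) + (LINT y|M. F' z0 y v)" for u v
      using int' by (simp add: linear_add[OF lin])
    show "(LINT y|M. F' z0 y (r *\<^sub>R v)) = r *\<^sub>R (LINT y|M. F' z0 y v)" for r v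
      by (simp add: linear_scale[OF lin])
    show "norm (LINT y|M. F' z0 y v) \<le> norm v * (LINT y|M. h y)" for v
    proof -
      have "norm (LINT y|M. F' z0 y v) \<le> (LINT y|M. h y * norm v)"
        using bound[OF z0] h int'
        by (intro order_trans[OF integral_norm_bound] integral_mono integrable_norm integrable_mult_left) auto
      then show ?thesis by (simp add: mult.commute)
    qed
  qed
  ultimately have "((\<lambda>z. LINT y|M. F z y) has_derivative (\<lambda>v. LINT y|M. F' z0 y v)) (at z0 within ?B)"
    unfolding has_derivative_iff_norm by blast
  then show ?thesis unfolding at_within_open[OF z0 open_ball] .
qed

lemma has_derivative_norm_powr:
  fixes u :: "'z::real_inner"
  assumes "u \<noteq> 0"
  shows "((\<lambda>u. norm u powr a) has_derivative (\<lambda>v. a * norm u powr (a - 2) * (u \<bullet> v))) (at u)"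
proof -
  have "((\<lambda>u. norm u powr a) has_derivative
      (\<lambda>v. norm u powr a * (0 * ln (norm u) + (v \<bullet> sgn u) * a / norm u))) (at u)"
    using assms by (intro has_derivative_powr has_derivative_norm has_derivative_const) auto
  moreover have "norm u powr a * (0 * ln (norm u) + (v \<bullet> sgn u) * a / norm u)
      = a * norm u powr (a - 2) * (u \<bullet> v)" for v
  proof -
    have "norm u powr (a - 2) = norm u powr a / (norm u)\<^sup>2"
      using assms by (simp add: powr_diff powr_numeral)
    then show ?thesis
      using assms by (simp add: sgn_div_norm inner_commute power2_eq_square field_simps)
  qed
  ultimately show ?thesis by simp
qed

lemma riesz_antimono:
  assumes z: "snd z \<noteq> 0" and a: "a \<le> b" "0 \<le> a"
  shows "riesz b z y \<le> norm (snd z) powr (a - b) * riesz a z y"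
proof -
  have pos: "0 < norm (z - (y, 0))" using z by (auto simp: prod_eq_iff)
  have "riesz b z y = norm (z - (y, 0)) powr (a - b) * riesz a z y"
    using pos by (simp add: riesz_def powr_add[symmetric])
  also have "norm (z - (y, 0)) powr (a - b) \<le> norm (snd z) powr (a - b)"
    using z a by (intro powr_mono2') (auto simp: norm_snd_le_diff_plane)
  finally show ?thesis by (simp add: mult_right_mono)
qed

lemma riesz_near:
  assumes z0: "snd z0 \<noteq> 0" and z: "z \<in> ball z0 (norm (snd z0) / 2)" and a: "0 \<le> a"
  shows "riesz a z y \<le> 2 powr a * riesz a z0 y"
proof -
  have "norm (z0 - (y, 0)) \<le> norm (z - (y, 0)) + dist z0 z"
    using norm_triangle_ineq[of "z - (y, 0)" "z0 - z"] by (simp add: dist_norm algebra_simps)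
  moreover have "dist z0 z \<le> norm (z0 - (y, 0)) / 2"
    using z norm_snd_le_diff_plane[of z0 y] by simp
  ultimately have "norm (z0 - (y, 0)) / 2 \<le> norm (z - (y, 0))" by simp
  moreover have "0 < norm (z0 - (y, 0))" using z0 by (auto simp: prod_eq_iff)
  ultimately have "riesz a z y \<le> (norm (z0 - (y, 0)) / 2) powr (- a)"
    unfolding riesz_def using a by (intro powr_mono2') auto
  also have "\<dots> = 2 powr a * riesz a z0 y"
    by (simp add: riesz_def powr_divide powr_minus field_simps)
  finally show ?thesis .
qed

lemma snd_nonzero_near:
  assumes "snd z0 \<noteq> 0" "z \<in> ball z0 (norm (snd z0) / 2)"
  shows "snd z \<noteq> 0"
proof
  assume "snd z = 0"
  then have "norm (snd z0) \<le> dist z0 z"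
    using dist_snd_le[of z0 z] by simp
  moreover have "0 < norm (snd z0)" using assms by simp
  ultimately show False using assms(2) zero_le_dist[of z0 z] by simp
qed

lemma norm_mult_riesz:
  assumes "snd z \<noteq> 0"
  shows "norm (z - (y, 0)) * riesz (a + 1) z y = riesz a z y"
proof -
  have pos: "0 < norm (z - (y, 0))" using assms by (auto simp: prod_eq_iff)
  then show ?thesis
    by (simp add: riesz_def powr_diff powr_minus field_simps powr_add)
qed

lemma abs_inner_riesz_le:
  assumes "snd z \<noteq> 0"
  shows "\<bar>riesz (a + 1) z y * ((z - (y, 0)) \<bullet> v)\<bar> \<le> riesz a z y * norm v"
proof -
  have "\<bar>riesz (a + 1) z y * ((z - (y, 0)) \<bullet> v)\<bar> \<le> riesz (a + 1) z y * (norm (z - (y, 0)) * norm v)"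
    by (simp add: abs_mult mult_left_mono Cauchy_Schwarz_ineq2)
  also have "\<dots> = riesz a z y * norm v"
    using norm_mult_riesz[OF assms, of y a] by (simp add: mult_ac)
  finally show ?thesis .
qed

lemma abs_inner_inner_riesz_le:
  assumes "snd z \<noteq> 0"
  shows "\<bar>riesz (a + 2) z y * ((z - (y, 0)) \<bullet> v) * ((z - (y, 0)) \<bullet> b)\<bar> \<le> riesz a z y * norm v * norm b"
proof -
  have "\<bar>riesz (a + 2) z y * ((z - (y, 0)) \<bullet> v) * ((z - (y, 0)) \<bullet> b)\<bar>
     \<le> riesz (a + 1) z y * norm v * \<bar>(z - (y, 0)) \<bullet> b\<bar>"
    using mult_right_mono[OF abs_inner_riesz_le[OF assms, of "a + 1" y v], of "\<bar>(z - (y, 0)) \<bullet> b\<bar>"]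
    by (simp add: abs_mult add.assoc)
  also have "\<dots> = norm v * \<bar>riesz (a + 1) z y * ((z - (y, 0)) \<bullet> b)\<bar>"
    by (simp add: abs_mult)
  also have "\<dots> \<le> norm v * (riesz a z y * norm b)"
    using abs_inner_riesz_le[OF assms, of a y b] by (intro mult_left_mono) auto
  finally show ?thesis by (simp add: mult_ac)
qed

lemma has_derivative_riesz:
  assumes "snd z \<noteq> 0"
  shows "((\<lambda>z. riesz a z y) has_derivative (\<lambda>v. - a * (riesz (a + 2) z y * ((z - (y, 0)) \<bullet> v)))) (at z)"
proof -
  have "((\<lambda>z. z - (y, 0)) has_derivative (\<lambda>v. v)) (at z)"
    by (auto intro!: derivative_eq_intros)
  moreover have "z - (y, 0) \<noteq> 0" using assms by (auto simp: prod_eq_iff)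
  ultimately have "((\<lambda>z. norm (z - (y, 0)) powr (- a)) has_derivative
     (\<lambda>v. - a * norm (z - (y, 0)) powr (- a - 2) * ((z - (y, 0)) \<bullet> v))) (at z)"
    using has_derivative_compose[of "\<lambda>z. z - (y, 0)" "\<lambda>v. v" z UNIV, OF _ has_derivative_norm_powr[of _ "- a"]] by auto
  moreover have "- (a + 2) = - a - 2" by simp
  ultimately show ?thesis unfolding riesz_def by (simp only: mult.assoc)
qed

lemma has_derivative_inner_riesz:
  assumes "snd z \<noteq> 0"
  shows "((\<lambda>z. riesz a z y * ((z - (y, 0)) \<bullet> b)) has_derivative
     (\<lambda>v. riesz a z y * (b \<bullet> v) - a * (riesz (a + 2) z y * ((z - (y, 0)) \<bullet> v) * ((z - (y, 0)) \<bullet> b)))) (at z)"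
proof -
  have "((\<lambda>z. (z - (y, 0)) \<bullet> b) has_derivative (\<lambda>v. v \<bullet> b)) (at z)"
    by (auto intro!: derivative_eq_intros)
  from has_derivative_mult[OF has_derivative_riesz[OF assms] this, of a y]
  show ?thesis by (rule has_derivative_eq_rhs) (auto simp: fun_eq_iff inner_commute algebra_simps)
qed

text \<open>A density \<open>f\<close> on the plane whose potential of exponent \<open>s\<close> converges off the plane. The type
  parameter \<open>T\<close> only records the complementary factor of the product.\<close>

locale riesz_potential =
  fixes f :: "'a::euclidean_space \<Rightarrow> real" and s :: real and T :: "'b::euclidean_space itself"
  assumes s_pos: "0 < s"
    and f_meas [measurable]: "f \<in> borel_measurable lebesgue"
    and f_int: "\<And>z::'a \<times> 'b. snd z \<noteq> 0 \<Longrightarrow> integrable lebesgue (\<lambda>y. riesz s z y * f y)"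
begin

text \<open>The potential \<open>pot\<close> of exponent \<open>s\<close>, the potential \<open>pot2\<close> of exponent \<open>s + 2\<close>, and the first moments
  \<open>mom v\<close>. Up to the factor \<open>-s\<close>, \<open>mom v\<close> is the derivative of \<open>pot\<close> in the direction \<open>v\<close>.\<close>

definition pot :: "'a \<times> 'b \<Rightarrow> real" where
  "pot z = (LINT y|lebesgue. riesz s z y * f y)"

definition pot2 :: "'a \<times> 'b \<Rightarrow> real" where
  "pot2 z = (LINT y|lebesgue. riesz (s + 2) z y * f y)"

definition mom :: "'a \<times> 'b \<Rightarrow> 'a \<times> 'b \<Rightarrow> real" where
  "mom v z = (LINT y|lebesgue. riesz (s + 2) z y * ((z - (y, 0)) \<bullet> v) * f y)"

lemma borel_measurable_inner_plane [measurable]: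
  "(\<lambda>y. (z - (y, 0)) \<bullet> (v::'a \<times> 'b)) \<in> borel_measurable lebesgue"
  by (intro measurable_completion borel_measurable_continuous_onI) (auto intro!: continuous_intros)

lemma int_abs: "snd (z::'a \<times> 'b) \<noteq> 0 \<Longrightarrow> integrable lebesgue (\<lambda>y. riesz s z y * \<bar>f y\<bar>)"
  using integrable_norm[OF f_int] by (simp add: abs_mult)

lemma int_dominated:
  assumes z: "snd (z::'a \<times> 'b) \<noteq> 0" and g: "g \<in> borel_measurable lebesgue"
    and le: "\<And>y. \<bar>g y\<bar> \<le> C * (riesz s z y * \<bar>f y\<bar>)"
  shows "integrable lebesgue g"
  by (rule Bochner_Integration.integrable_bound[OF integrable_mult_right[OF int_abs[OF z], of C] g])
     (use le in \<open>auto intro: order_trans[OF _ abs_ge_self]\<close>)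

lemma int_pot2:
  assumes z: "snd (z::'a \<times> 'b) \<noteq> 0"
  shows "integrable lebesgue (\<lambda>y. riesz (s + 2) z y * f y)"
proof (rule int_dominated[OF z])
  fix y
  show "\<bar>riesz (s + 2) z y * f y\<bar> \<le> norm (snd z) powr (s - (s + 2)) * (riesz s z y * \<bar>f y\<bar>)"
    using mult_right_mono[OF riesz_antimono[OF z, of s "s + 2" y], of "\<bar>f y\<bar>"] s_pos
    by (simp add: abs_mult mult_ac)
qed measurable

lemma abs_mom_integrand_le:
  assumes z: "snd (z::'a \<times> 'b) \<noteq> 0"
  shows "\<bar>riesz (s + 2) z y * ((z - (y, 0)) \<bullet> v)\<bar> \<le> norm (snd z) powr - 1 * norm v * riesz s z y"
proof -
  have "\<bar>riesz (s + 2) z y * ((z - (y, 0)) \<bullet> v)\<bar> \<le> riesz (s + 1) z y * norm v"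
    using abs_inner_riesz_le[OF z, of "s + 1" y v] by (simp add: add.assoc)
  also have "\<dots> \<le> norm (snd z) powr - 1 * riesz s z y * norm v"
    using riesz_antimono[OF z, of s "s + 1" y] s_pos by (intro mult_right_mono) auto
  finally show ?thesis by (simp add: mult_ac)
qed

lemma int_mom:
  assumes z: "snd (z::'a \<times> 'b) \<noteq> 0"
  shows "integrable lebesgue (\<lambda>y. riesz (s + 2) z y * ((z - (y, 0)) \<bullet> v) * f y)"
proof (rule int_dominated[OF z])
  fix y
  show "\<bar>riesz (s + 2) z y * ((z - (y, 0)) \<bullet> v) * f y\<bar>
      \<le> (norm (snd z) powr - 1 * norm v) * (riesz s z y * \<bar>f y\<bar>)"
    using mult_right_mono[OF abs_mom_integrand_le[OF z, of y v], of "\<bar>f y\<bar>"]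
    by (simp add: abs_mult mult_ac)
qed measurable

lemma has_derivative_pot:
  assumes z: "snd (z::'a \<times> 'b) \<noteq> 0"
  shows "(pot has_derivative (\<lambda>v. - s * mom v z)) (at z)"
proof -
  let ?F' = "\<lambda>z y v. - s * (riesz (s + 2) z y * ((z - (y, 0)) \<bullet> v)) * f y"
  let ?e = "norm (snd z) / 2"
  let ?C = "s * (norm (snd z) powr - 1 * 2 powr (s + 1))"
  have "((\<lambda>z. LINT y|lebesgue. riesz s z y * f y) has_derivative (\<lambda>v. LINT y|lebesgue. ?F' z y v)) (at z)"
  proof (rule has_derivative_integral_dominated[where e = ?e and h = "\<lambda>y. ?C * (riesz s z y * \<bar>f y\<bar>)"])
    show "0 < ?e" using z by simp
    fix z' :: "'a \<times> 'b" assume z': "z' \<in> ball z ?e"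
    then have nz: "snd z' \<noteq> 0" by (rule snd_nonzero_near[OF z])
    show "integrable lebesgue (\<lambda>y. riesz s z' y * f y)" by (rule f_int[OF nz])
    fix y
    show "((\<lambda>z. riesz s z y * f y) has_derivative ?F' z' y) (at z')"
      by (rule has_derivative_mult_left[OF has_derivative_riesz[OF nz]])
    fix v
    have "\<bar>riesz (s + 2) z' y * ((z' - (y, 0)) \<bullet> v)\<bar> \<le> riesz (s + 1) z' y * norm v"
      using abs_inner_riesz_le[OF nz, of "s + 1" y v] by (simp add: add.assoc)
    also have "\<dots> \<le> (2 powr (s + 1) * riesz (s + 1) z y) * norm v"
      using riesz_near[OF z z', of "s + 1"] s_pos by (intro mult_right_mono) auto
    also have "\<dots> \<le> (2 powr (s + 1) * (norm (snd z) powr - 1 * riesz s z y)) * norm v"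
      using riesz_antimono[OF z, of s "s + 1" y] s_pos by (intro mult_right_mono mult_left_mono) auto
    finally have "s * \<bar>riesz (s + 2) z' y * ((z' - (y, 0)) \<bullet> v)\<bar> * \<bar>f y\<bar>
      \<le> s * ((2 powr (s + 1) * (norm (snd z) powr - 1 * riesz s z y)) * norm v) * \<bar>f y\<bar>"
      using s_pos by (intro mult_right_mono mult_left_mono) auto
    then show "\<bar>?F' z' y v\<bar> \<le> ?C * (riesz s z y * \<bar>f y\<bar>) * norm v"
      using s_pos by (simp add: abs_mult mult_ac)
  next
    show "integrable lebesgue (\<lambda>y. ?C * (riesz s z y * \<bar>f y\<bar>))"
      by (intro integrable_mult_right int_abs z)
    show "0 \<le> ?C * (riesz s z y * \<bar>f y\<bar>)" for y using s_pos by simp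
    show "(\<lambda>y. ?F' z y v) \<in> borel_measurable lebesgue" for v by measurable
  qed
  moreover have "(LINT y|lebesgue. ?F' z y v) = - s * mom v z" for v
    unfolding mom_def by (subst integral_mult_right_zero[symmetric]) (simp add: mult.assoc)
  ultimately show ?thesis unfolding pot_def by simp
qed

text \<open>The derivative of \<open>mom b\<close> at \<open>z\<close> in the direction \<open>v\<close>.\<close>

definition dmom :: "'a \<times> 'b \<Rightarrow> 'a \<times> 'b \<Rightarrow> 'a \<times> 'b \<Rightarrow> real" where
  "dmom b z v = (LINT y|lebesgue. (riesz (s + 2) z y * (b \<bullet> v)
      - (s + 2) * (riesz (s + 4) z y * ((z - (y, 0)) \<bullet> v) * ((z - (y, 0)) \<bullet> b))) * f y)"

lemma has_derivative_mom:
  assumes z: "snd (z::'a \<times> 'b) \<noteq> 0"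
  shows "(mom b has_derivative dmom b z) (at z)"
proof -
  let ?F' = "\<lambda>z y v. (riesz (s + 2) z y * (b \<bullet> v)
      - (s + 2) * (riesz (s + 4) z y * ((z - (y, 0)) \<bullet> v) * ((z - (y, 0)) \<bullet> b))) * f y"
  let ?e = "norm (snd z) / 2"
  let ?C = "(s + 3) * norm b * (2 powr (s + 2) * norm (snd z) powr - 2)"
  have "((\<lambda>z. LINT y|lebesgue. riesz (s + 2) z y * ((z - (y, 0)) \<bullet> b) * f y) has_derivative
      (\<lambda>v. LINT y|lebesgue. ?F' z y v)) (at z)"
  proof (rule has_derivative_integral_dominated[where e = ?e and h = "\<lambda>y. ?C * (riesz s z y * \<bar>f y\<bar>)"])
    show "0 < ?e" using z by simp
    fix z' :: "'a \<times> 'b" assume z': "z' \<in> ball z ?e"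
    then have nz: "snd z' \<noteq> 0" by (rule snd_nonzero_near[OF z])
    show "integrable lebesgue (\<lambda>y. riesz (s + 2) z' y * ((z' - (y, 0)) \<bullet> b) * f y)" by (rule int_mom[OF nz])
    fix y
    show "((\<lambda>z. riesz (s + 2) z y * ((z - (y, 0)) \<bullet> b) * f y) has_derivative ?F' z' y) (at z')"
      using has_derivative_mult_left[OF has_derivative_inner_riesz[OF nz, of "s + 2" y b], of "f y"]
      by (simp add: add.assoc)
    fix v
    let ?R = "riesz (s + 2) z' y"
    have "\<bar>?R * (b \<bullet> v)\<bar> \<le> ?R * (norm b * norm v)"
      by (simp add: abs_mult mult_left_mono Cauchy_Schwarz_ineq2)
    moreover have "\<bar>riesz (s + 4) z' y * ((z' - (y, 0)) \<bullet> v) * ((z' - (y, 0)) \<bullet> b)\<bar> \<le> ?R * norm v * norm b"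
      using abs_inner_inner_riesz_le[OF nz, of "s + 2" y v b] by (simp add: add.assoc)
    then have "(s + 2) * \<bar>riesz (s + 4) z' y * ((z' - (y, 0)) \<bullet> v) * ((z' - (y, 0)) \<bullet> b)\<bar> \<le> (s + 2) * (?R * norm v * norm b)"
      using s_pos by (intro mult_left_mono) auto
    ultimately have "\<bar>?R * (b \<bullet> v)\<bar> + (s + 2) * \<bar>riesz (s + 4) z' y * ((z' - (y, 0)) \<bullet> v) * ((z' - (y, 0)) \<bullet> b)\<bar>
       \<le> (s + 3) * norm b * norm v * ?R"
      by (simp add: algebra_simps)
    moreover have "\<bar>p - (s + 2) * q\<bar> \<le> \<bar>p\<bar> + (s + 2) * \<bar>q\<bar>" for p q
      using abs_triangle_ineq4[of p "(s + 2) * q"] s_pos by (simp add: abs_mult)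
    ultimately have 1: "\<bar>?R * (b \<bullet> v) - (s + 2) * (riesz (s + 4) z' y * ((z' - (y, 0)) \<bullet> v) * ((z' - (y, 0)) \<bullet> b))\<bar>
       \<le> (s + 3) * norm b * norm v * ?R"
      by (rule order_trans[rotated])
    have 2: "?R \<le> 2 powr (s + 2) * (norm (snd z) powr - 2 * riesz s z y)"
    proof -
      have "?R \<le> 2 powr (s + 2) * riesz (s + 2) z y"
        using riesz_near[OF z z', of "s + 2"] s_pos by simp
      also have "\<dots> \<le> 2 powr (s + 2) * (norm (snd z) powr - 2 * riesz s z y)"
        using riesz_antimono[OF z, of s "s + 2" y] s_pos by (intro mult_left_mono) auto
      finally show ?thesis .
    qed
    have "\<bar>?F' z' y v\<bar> \<le> ((s + 3) * norm b * norm v * ?R) * \<bar>f y\<bar>"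
      unfolding abs_mult[of _ "f y"] by (rule mult_right_mono[OF 1]) simp
    also have "\<dots> \<le> ((s + 3) * norm b * norm v * (2 powr (s + 2) * (norm (snd z) powr - 2 * riesz s z y))) * \<bar>f y\<bar>"
      using 2 s_pos by (intro mult_right_mono mult_left_mono) auto
    finally show "\<bar>?F' z' y v\<bar> \<le> ?C * (riesz s z y * \<bar>f y\<bar>) * norm v"
      by (simp only: mult_ac)
  next
    show "integrable lebesgue (\<lambda>y. ?C * (riesz s z y * \<bar>f y\<bar>))"
      by (intro integrable_mult_right int_abs z)
    show "0 \<le> ?C * (riesz s z y * \<bar>f y\<bar>)" for y using s_pos by simp
    show "(\<lambda>y. ?F' z y v) \<in> borel_measurable lebesgue" for v by measurable
  qed
  then show ?thesis unfolding mom_def dmom_def by simp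
qed

lemma int_dmom_part:
  assumes z: "snd (z::'a \<times> 'b) \<noteq> 0"
  shows "integrable lebesgue (\<lambda>y. riesz (s + 4) z y * ((z - (y, 0)) \<bullet> v) * ((z - (y, 0)) \<bullet> b) * f y)"
proof (rule int_dominated[OF z])
  fix y
  have "\<bar>riesz (s + 4) z y * ((z - (y, 0)) \<bullet> v) * ((z - (y, 0)) \<bullet> b)\<bar> \<le> norm v * (riesz (s + 2) z y * norm b)"
    using abs_inner_inner_riesz_le[OF z, of "s + 2" y v b] by (simp add: add.assoc mult_ac)
  also have "\<dots> \<le> norm v * ((norm (snd z) powr (s - (s + 2)) * riesz s z y) * norm b)"
    using riesz_antimono[OF z, of s "s + 2" y] s_pos by (intro mult_left_mono mult_right_mono) auto
  finally have "\<bar>riesz (s + 4) z y * ((z - (y, 0)) \<bullet> v) * ((z - (y, 0)) \<bullet> b)\<bar> * \<bar>f y\<bar>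
     \<le> (norm v * ((norm (snd z) powr (s - (s + 2)) * riesz s z y) * norm b)) * \<bar>f y\<bar>"
    by (rule mult_right_mono) simp
  then show "\<bar>riesz (s + 4) z y * ((z - (y, 0)) \<bullet> v) * ((z - (y, 0)) \<bullet> b) * f y\<bar>
     \<le> (norm v * norm b * norm (snd z) powr (s - (s + 2))) * (riesz s z y * \<bar>f y\<bar>)"
    unfolding abs_mult[of _ "f y"] by (simp only: mult_ac)
qed measurable

text \<open>This is the identity \<open>\<Delta>|z| powr -s = s (s + 2 - n) |z| powr -(s + 2)\<close> under the integral sign.\<close>

lemma sum_dmom:
  assumes z: "snd (z::'a \<times> 'b) \<noteq> 0"
  shows "(\<Sum>b\<in>Basis. dmom b z b) = (real DIM('a \<times> 'b) - s - 2) * pot2 z"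
proof -
  have "(\<Sum>b\<in>Basis. dmom b z b) = (LINT y|lebesgue. (\<Sum>b\<in>Basis. (riesz (s + 2) z y * (b \<bullet> b)
      - (s + 2) * (riesz (s + 4) z y * ((z - (y, 0)) \<bullet> b) * ((z - (y, 0)) \<bullet> b))) * f y))"
    unfolding dmom_def
  proof (rule Bochner_Integration.integral_sum[symmetric])
    fix b :: "'a \<times> 'b"
    have "integrable lebesgue (\<lambda>y. (b \<bullet> b) * (riesz (s + 2) z y * f y)
      - (s + 2) * (riesz (s + 4) z y * ((z - (y, 0)) \<bullet> b) * ((z - (y, 0)) \<bullet> b) * f y))"
      by (intro Bochner_Integration.integrable_diff integrable_mult_right int_pot2 int_dmom_part z)
    then show "integrable lebesgue (\<lambda>y. (riesz (s + 2) z y * (b \<bullet> b)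
      - (s + 2) * (riesz (s + 4) z y * ((z - (y, 0)) \<bullet> b) * ((z - (y, 0)) \<bullet> b))) * f y)"
      by (simp add: algebra_simps)
  qed
  also have "\<dots> = (LINT y|lebesgue. (real DIM('a \<times> 'b) - s - 2) * (riesz (s + 2) z y * f y))"
  proof (rule Bochner_Integration.integral_cong[OF refl])
    fix y
    let ?u = "z - (y, 0)"
    have "(\<Sum>b\<in>Basis. (?u \<bullet> b) * (?u \<bullet> b)) = ?u \<bullet> ?u"
      by (rule euclidean_inner[symmetric])
    then have 1: "riesz (s + 4) z y * (\<Sum>b\<in>Basis. (?u \<bullet> b) * (?u \<bullet> b)) = riesz (s + 2) z y"
      using norm_mult_riesz[OF z, of y "s + 3"] norm_mult_riesz[OF z, of y "s + 2"]
      by (simp add: power2_norm_eq_inner[symmetric] power2_eq_square add.assoc mult_ac)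
    have "(\<Sum>b\<in>Basis. (riesz (s + 2) z y * (b \<bullet> b)
        - (s + 2) * (riesz (s + 4) z y * (?u \<bullet> b) * (?u \<bullet> b))) * f y)
      = ((\<Sum>b\<in>(Basis::('a \<times> 'b) set). riesz (s + 2) z y)
         - (s + 2) * (riesz (s + 4) z y * (\<Sum>b\<in>Basis. (?u \<bullet> b) * (?u \<bullet> b)))) * f y"
      by (simp only: sum_distrib_right[symmetric] sum_subtractf sum_distrib_left mult.assoc)
         (simp add: inner_same_Basis)
    also have "\<dots> = (real DIM('a \<times> 'b) - s - 2) * (riesz (s + 2) z y * f y)"
      unfolding 1 by (simp add: algebra_simps)
    finally show "(\<Sum>b\<in>Basis. (riesz (s + 2) z y * (b \<bullet> b)
        - (s + 2) * (riesz (s + 4) z y * (?u \<bullet> b) * (?u \<bullet> b))) * f y)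
        = (real DIM('a \<times> 'b) - s - 2) * (riesz (s + 2) z y * f y)" .
  qed
  also have "\<dots> = (real DIM('a \<times> 'b) - s - 2) * pot2 z"
    unfolding pot2_def by (rule integral_mult_right_zero)
  finally show ?thesis .
qed

section \<open>The equation for the regularized distance\<close>

text \<open>Let \<open>D\<close> be the regularized distance, \<open>k = n - d\<close>. Since \<open>D powr (1-k) \<nabla>D\<close> is a constant multiple of
  \<open>pot powr q \<nabla>pot\<close> with \<open>q = (k-2)/\<alpha> - 1\<close>, the equation reads \<open>q |\<nabla>pot|\<^sup>2 + pot \<Delta>pot = 0\<close>, and
  \<open>\<Delta>pot = -s \<alpha> q pot2\<close>. The exponent \<open>q\<close> vanishes exactly when \<open>\<alpha> = k - 2\<close>; otherwise it cancels.\<close>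

lemma pde_identity:
  fixes D :: "'a \<times> 'b \<Rightarrow> real"
  assumes D: "\<And>z. snd z \<noteq> 0 \<Longrightarrow> D z = (c * pot z) powr (- 1 / \<alpha>)"
    and c: "0 < c" and pos: "\<And>z. snd z \<noteq> 0 \<Longrightarrow> 0 < pot z"
    and \<alpha>: "0 < \<alpha>" and s: "s = real DIM('a) + \<alpha>"
    and ne: "\<alpha> \<noteq> real DIM('a \<times> 'b) - real DIM('a) - 2"
    and x: "snd x \<noteq> 0"
    and div0: "divg (\<lambda>z. D z powr (- real DIM('a \<times> 'b) + real DIM('a) + 1) *\<^sub>R grad D z) x = 0"
  shows "s * (\<Sum>b\<in>Basis. (mom b x)\<^sup>2) = \<alpha> * pot x * pot2 x"
proof -
  define k where "k = real DIM('a \<times> 'b) - real DIM('a)"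
  define q where "q = (k - 2) / \<alpha> - 1"
  define S where "S = {z::'a \<times> 'b. snd z \<noteq> 0}"
  define K where "K = (s * c / \<alpha>) * c powr q"
  have "S = - {z. snd z = 0}" by (auto simp: S_def)
  moreover have "closed {z::'a \<times> 'b. snd z = 0}"
    by (intro closed_Collect_eq continuous_intros)
  ultimately have S: "open S" by (simp add: open_Compl)
  have xS: "x \<in> S" using x by (simp add: S_def)
  have dD: "(D has_derivative (\<lambda>v. (s * c / \<alpha>) * (c * pot z) powr (- 1 / \<alpha> - 1) * mom v z)) (at z)" if z: "z \<in> S" for z
  proof -
    have z': "snd z \<noteq> 0" using z by (simp add: S_def)
    have cp: "0 < c * pot z" using c pos[OF z'] by simp
    have "((\<lambda>z. c * pot z) has_derivative (\<lambda>v. c * (- s * mom v z))) (at z)"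
      by (rule has_derivative_mult_right[OF has_derivative_pot[OF z']])
    then have "((\<lambda>z. (c * pot z) powr (- 1 / \<alpha>)) has_derivative (\<lambda>v. (c * pot z) powr (- 1 / \<alpha>) *
       (0 * ln (c * pot z) + (c * (- s * mom v z)) * (- 1 / \<alpha>) / (c * pot z)))) (at z)"
      using cp by (intro has_derivative_powr has_derivative_const) auto
    moreover have "(c * pot z) powr (- 1 / \<alpha>) * (0 * ln (c * pot z) + (c * (- s * mom v z)) * (- 1 / \<alpha>) / (c * pot z))
       = (s * c / \<alpha>) * (c * pot z) powr (- 1 / \<alpha> - 1) * mom v z" for v
    proof -
      have "(c * pot z) powr (- 1 / \<alpha> - 1) = (c * pot z) powr (- 1 / \<alpha>) / (c * pot z)"
        using cp by (simp only: powr_diff powr_one less_imp_le)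
      then show ?thesis using cp \<alpha> by (simp only: mult_zero_left add_0_left) (simp add: field_simps)
    qed
    ultimately have "((\<lambda>z. (c * pot z) powr (- 1 / \<alpha>)) has_derivative
        (\<lambda>v. (s * c / \<alpha>) * (c * pot z) powr (- 1 / \<alpha> - 1) * mom v z)) (at z)" by simp
    then show ?thesis
      by (rule has_derivative_transform_within_open[OF _ S z]) (auto simp: D S_def)
  qed
  have F: "D z powr (- real DIM('a \<times> 'b) + real DIM('a) + 1) *\<^sub>R grad D z
      = (\<Sum>b\<in>Basis. (K * (pot z powr q * mom b z)) *\<^sub>R b)" if z: "z \<in> S" for z
  proof -
    have cp: "0 < c * pot z" "0 < pot z" using c pos z by (auto simp: S_def)
    have fd: "frechet_derivative D (at z) = (\<lambda>v. (s * c / \<alpha>) * (c * pot z) powr (- 1 / \<alpha> - 1) * mom v z)"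
      by (rule frechet_derivative_at[OF dD[OF z], symmetric])
    have "D z powr (- real DIM('a \<times> 'b) + real DIM('a) + 1) = (c * pot z) powr ((- 1 / \<alpha>) * (1 - k))"
      using z by (simp add: D S_def powr_powr k_def)
    moreover have "(- 1 / \<alpha>) * (1 - k) + (- 1 / \<alpha> - 1) = q"
      using \<alpha> by (simp add: q_def field_simps)
    ultimately have "D z powr (- real DIM('a \<times> 'b) + real DIM('a) + 1) * (c * pot z) powr (- 1 / \<alpha> - 1) = (c * pot z) powr q"
      by (simp only: powr_add[symmetric])
    moreover have "(c * pot z) powr q = c powr q * pot z powr q"
      using c cp by (simp add: powr_mult)
    ultimately have e: "D z powr (- real DIM('a \<times> 'b) + real DIM('a) + 1) * (c * pot z) powr (- 1 / \<alpha> - 1) = c powr q * pot z powr q" by simp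
    have "D z powr (- real DIM('a \<times> 'b) + real DIM('a) + 1) * ((s * c / \<alpha>) * (c * pot z) powr (- 1 / \<alpha> - 1) * m)
        = K * (pot z powr q * m)" for m
    proof -
      have "D z powr (- real DIM('a \<times> 'b) + real DIM('a) + 1) * ((s * c / \<alpha>) * (c * pot z) powr (- 1 / \<alpha> - 1) * m)
        = (s * c / \<alpha>) * m * (D z powr (- real DIM('a \<times> 'b) + real DIM('a) + 1) * (c * pot z) powr (- 1 / \<alpha> - 1))"
        by (simp only: mult_ac)
      also have "\<dots> = K * (pot z powr q * m)" unfolding e K_def by (simp only: mult_ac)
      finally show ?thesis .
    qed
    then show ?thesis
      by (simp only: grad_def fd scaleR_sum_right scaleR_scaleR)
  qed
  define dF where "dF v = (\<Sum>b\<in>Basis. (K * (pot x powr q * dmom b x v + (- s * mom v x) * (q * pot x powr (q - 1)) * mom b x)) *\<^sub>R b)" for v :: "'a \<times> 'b"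
  have px: "0 < pot x" using pos[OF x] .
  have dq: "((\<lambda>z. pot z powr q) has_derivative (\<lambda>v. (- s * mom v x) * (q * pot x powr (q - 1)))) (at x)"
  proof -
    have "((\<lambda>z. pot z powr q) has_derivative (\<lambda>v. pot x powr q * (0 * ln (pot x) + (- s * mom v x) * q / pot x))) (at x)"
      using px by (intro has_derivative_powr has_derivative_const has_derivative_pot x) auto
    moreover have "pot x powr q * (0 * ln (pot x) + m * q / pot x) = m * (q * pot x powr (q - 1))" for m
      using px by (simp add: powr_diff field_simps)
    ultimately show ?thesis by simp
  qed
  have "((\<lambda>z. \<Sum>b\<in>Basis. (K * (pot z powr q * mom b z)) *\<^sub>R b) has_derivative dF) (at x)"
    unfolding dF_def
    by (intro has_derivative_sum has_derivative_scaleR_left has_derivative_mult_right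
         has_derivative_mult[OF dq has_derivative_mom[OF x]])
  then have "((\<lambda>z. D z powr (- real DIM('a \<times> 'b) + real DIM('a) + 1) *\<^sub>R grad D z) has_derivative dF) (at x)"
    by (rule has_derivative_transform_within_open[OF _ S xS]) (rule F[symmetric])
  from frechet_derivative_at[OF this] div0
  have "(\<Sum>b\<in>Basis. dF b \<bullet> b) = 0" by (simp add: divg_def)
  then have "(\<Sum>b\<in>Basis. K * (pot x powr q * dmom b x b + (- s * mom b x) * (q * pot x powr (q - 1)) * mom b x)) = 0"
    by (simp add: dF_def)
  then have "K * (pot x powr q * (\<Sum>b\<in>Basis. dmom b x b) - s * q * pot x powr (q - 1) * (\<Sum>b\<in>Basis. (mom b x)\<^sup>2)) = 0"
    by (simp add: sum_distrib_left sum_subtractf right_diff_distrib power2_eq_square mult_ac)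
  moreover have "K \<noteq> 0" using s_pos c \<alpha> by (simp add: K_def)
  ultimately have "pot x powr q * (\<Sum>b\<in>Basis. dmom b x b) = s * q * pot x powr (q - 1) * (\<Sum>b\<in>Basis. (mom b x)\<^sup>2)"
    by simp
  moreover have "pot x powr q = pot x powr (q - 1) * pot x"
    using px by (simp add: powr_diff)
  ultimately have "pot x powr (q - 1) * (pot x * (\<Sum>b\<in>Basis. dmom b x b) - s * q * (\<Sum>b\<in>Basis. (mom b x)\<^sup>2)) = 0"
    by (simp add: algebra_simps)
  then have 1: "pot x * (\<Sum>b\<in>Basis. dmom b x b) = s * q * (\<Sum>b\<in>Basis. (mom b x)\<^sup>2)"
    using px by simp
  have 2: "(\<Sum>b\<in>Basis. dmom b x b) = \<alpha> * q * pot2 x"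
    unfolding sum_dmom[OF x] using \<alpha> s by (simp add: q_def k_def field_simps)
  have "q \<noteq> 0" using ne \<alpha> by (simp add: q_def k_def field_simps)
  moreover have "q * (\<alpha> * pot x * pot2 x) = q * (s * (\<Sum>b\<in>Basis. (mom b x)\<^sup>2))"
    using 1 unfolding 2 by (simp add: mult_ac)
  ultimately show ?thesis by simp
qed

end

section \<open>Potentials of constants\<close>

lemma lborel_integral_affine:
  fixes g :: "'a::euclidean_space \<Rightarrow> real"
  assumes g [measurable]: "g \<in> borel_measurable borel" and c: "c \<noteq> 0"
  shows "(LINT y|lborel. g y) = \<bar>c\<bar> ^ DIM('a) * (LINT y|lborel. g (t + c *\<^sub>R y))"
proof -
  have "(LINT y|lborel. g y) = (LINT y|density (distr lborel borel (\<lambda>x. t + c *\<^sub>R x)) (\<lambda>_. \<bar>c\<bar> ^ DIM('a)). g y)"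
    using lborel_affine[OF c, of t] by simp
  also have "\<dots> = (LINT y|distr lborel borel (\<lambda>x. t + c *\<^sub>R x). \<bar>c\<bar> ^ DIM('a) *\<^sub>R g y)"
    by (subst integral_density) auto
  also have "\<dots> = (LINT y|lborel. \<bar>c\<bar> ^ DIM('a) *\<^sub>R g (t + c *\<^sub>R y))"
    by (subst integral_distr) auto
  finally show ?thesis by simp
qed

text \<open>The kernel at distance 1 from the plane, as a function on the plane.\<close>

definition unit_kernel :: "real \<Rightarrow> 'a::euclidean_space \<Rightarrow> real" where
  "unit_kernel s y = sqrt ((norm y)\<^sup>2 + 1) powr (- s)"

lemma unit_kernel_pos: "0 < unit_kernel s y"
proof -
  have "0 < (norm y)\<^sup>2 + 1" by (intro add_nonneg_pos) auto
  then show ?thesis by (simp add: unit_kernel_def)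
qed

lemma borel_measurable_unit_kernel [measurable]: "unit_kernel s \<in> borel_measurable borel"
  unfolding unit_kernel_def by (intro powr_real_measurable borel_measurable_const
     borel_measurable_continuous_onI continuous_intros)

lemma riesz_affine:
  fixes w :: "'b::euclidean_space"
  assumes w: "w \<noteq> 0"
  shows "riesz s (x, w) (x + norm w *\<^sub>R y) = norm w powr (- s) * unit_kernel s y"
proof -
  have "norm ((x, w) - (x + norm w *\<^sub>R y, 0)) = sqrt ((norm w)\<^sup>2 * ((norm y)\<^sup>2 + 1))"
    by (simp add: norm_Pair power_mult_distrib algebra_simps)
  also have "\<dots> = norm w * sqrt ((norm y)\<^sup>2 + 1)"
    by (simp add: real_sqrt_mult)
  finally show ?thesis
    by (simp add: riesz_def unit_kernel_def powr_mult)
qed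

lemma riesz_unit_kernel:
  fixes w :: "'b::euclidean_space"
  assumes "norm w = 1"
  shows "riesz s (x, w) y = unit_kernel s (y - x)"
  using riesz_affine[of w s x "y - x"] assms by fastforce

lemma integrable_unit_kernel:
  assumes "0 < \<alpha>" "s = real DIM('a::euclidean_space) + \<alpha>"
  shows "integrable lborel (unit_kernel s :: 'a \<Rightarrow> real)"
proof -
  have "integrable lebesgue (\<lambda>y::'a. riesz s (0, 1::real) y * 1)"
    by (rule integrable_riesz_bounded[OF _ assms, where C = 1]) auto
  then have "integrable lebesgue (unit_kernel s :: 'a \<Rightarrow> real)"
    by (simp add: riesz_unit_kernel)
  then show ?thesis by (simp add: integrable_completion)
qed

lemma integral_unit_kernel_pos:
  assumes "0 < \<alpha>" "s = real DIM('a::euclidean_space) + \<alpha>"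
  shows "0 < (LINT y|lborel. unit_kernel s (y::'a))"
proof -
  have nn: "0 \<le> (LINT y|lborel. unit_kernel s (y::'a))"
    by (intro integral_nonneg_AE AE_I2 less_imp_le unit_kernel_pos)
  have "(LINT y|lborel. unit_kernel s (y::'a)) \<noteq> 0"
  proof
    assume "(LINT y|lborel. unit_kernel s (y::'a)) = 0"
    then have "AE y in lborel. unit_kernel s (y::'a) = 0"
      by (subst (asm) integral_nonneg_eq_0_iff_AE[OF integrable_unit_kernel[OF assms]])
         (auto intro: less_imp_le unit_kernel_pos)
    moreover have "unit_kernel s (y::'a) \<noteq> 0" for y using unit_kernel_pos[of s y] by simp
    ultimately have "AE y in (lborel :: 'a measure). False" by simp
    then show False
      by (simp add: trivial_limit_def[symmetric] ae_filter_eq_bot_iff)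
  qed
  with nn show ?thesis by simp
qed

lemma integral_riesz_affine:
  fixes g :: "'a::euclidean_space \<Rightarrow> real" and w :: "'b::euclidean_space"
  assumes w: "w \<noteq> 0" and g [measurable]: "g \<in> borel_measurable borel"
    and s: "s = real DIM('a) + \<alpha>"
  shows "(LINT y|lborel. riesz s (x, w) y * g y)
      = norm w powr (- \<alpha>) * (LINT y|lborel. unit_kernel s y * g (x + norm w *\<^sub>R y))"
proof -
  note [measurable] = borel_measurable_riesz
  have "(LINT y|lborel. riesz s (x, w) y * g y)
     = \<bar>norm w\<bar> ^ DIM('a) * (LINT y|lborel. riesz s (x, w) (x + norm w *\<^sub>R y) * g (x + norm w *\<^sub>R y))"
    using w by (intro lborel_integral_affine) auto
  also have "\<dots> = norm w ^ DIM('a) * (norm w powr (- s) * (LINT y|lborel. unit_kernel s y * g (x + norm w *\<^sub>R y)))"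
    by (simp add: riesz_affine[OF w] mult.assoc)
  also have "\<dots> = norm w powr (- \<alpha>) * (LINT y|lborel. unit_kernel s y * g (x + norm w *\<^sub>R y))"
    using w s by (simp add: powr_realpow[symmetric] mult.assoc[symmetric] powr_add[symmetric])
  finally show ?thesis .
qed

lemma integral_riesz:
  fixes x :: "'a::euclidean_space" and w :: "'b::euclidean_space"
  assumes w: "w \<noteq> 0" and s: "s = real DIM('a) + \<alpha>"
  shows "(LINT y|lebesgue. riesz s (x, w) y) = (LINT y|lborel. unit_kernel s (y::'a)) * norm w powr (- \<alpha>)"
  using integral_riesz_affine[OF w _ s, of "\<lambda>_. 1" x] borel_measurable_riesz[of s "(x, w)"]
  by (simp add: integral_completion mult.commute)

lemma riesz_potential_one:
  assumes "0 < \<alpha>" "s = real DIM('a::euclidean_space) + \<alpha>"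
  shows "riesz_potential TYPE('b::euclidean_space) (\<lambda>_::'a. 1) s"
proof
  show "0 < s" using assms by simp
  show "integrable lebesgue (\<lambda>y. riesz s z y * 1)" if "snd z \<noteq> 0" for z :: "'a \<times> 'b"
    using that assms by (intro integrable_riesz_bounded[where C = 1]) auto
qed auto

text \<open>The tangential moments of a constant density vanish, by reflection of the plane in \<open>x\<close>.\<close>

lemma integral_mom_one:
  fixes x :: "'a::euclidean_space" and w :: "'b::euclidean_space"
  assumes w: "w \<noteq> 0"
  shows "(LINT y|lebesgue. riesz a (x, w) y * (((x, w) - (y, 0)) \<bullet> (v, 0))) = 0"
proof -
  let ?g = "\<lambda>y. riesz a (x, w) y * (((x, w) - (y, 0)) \<bullet> (v, 0))"
  have g: "?g \<in> borel_measurable borel"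
    by (intro borel_measurable_times borel_measurable_riesz)
       (auto intro!: borel_measurable_continuous_onI continuous_intros)
  have odd: "?g (2 *\<^sub>R x + (- 1) *\<^sub>R y) = - ?g y" for y
  proof -
    have e: "x - (2 *\<^sub>R x + (- 1) *\<^sub>R y) = - (x - y)" by (simp add: scaleR_2)
    have "norm ((x, w) - (2 *\<^sub>R x + (- 1) *\<^sub>R y, 0)) = norm ((x, w) - (y, 0))"
      unfolding norm_diff_plane e by (simp only: norm_minus_cancel)
    then have "riesz a (x, w) (2 *\<^sub>R x + (- 1) *\<^sub>R y) = riesz a (x, w) y"
      by (simp only: riesz_def)
    moreover have "((x, w) - (2 *\<^sub>R x + (- 1) *\<^sub>R y, 0)) \<bullet> (v, 0) = - (((x, w) - (y, 0)) \<bullet> (v, 0))"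
      unfolding diff_Pair e by (simp add: inner_Pair inner_diff_left)
    ultimately show ?thesis by simp
  qed
  have "(LINT y|lborel. ?g y) = \<bar>- 1\<bar> ^ DIM('a) * (LINT y|lborel. ?g (2 *\<^sub>R x + (- 1) *\<^sub>R y))"
    by (rule lborel_integral_affine[OF g]) simp
  also have "\<dots> = - (LINT y|lborel. ?g y)"
    unfolding odd by simp
  finally have "(LINT y|lborel. ?g y) = 0" by simp
  then show ?thesis using g by (simp add: integral_completion)
qed

text \<open>The potential of a constant density is a multiple of \<open>r powr -\<alpha>\<close>; comparison of its radial
  derivative with the one computed under the integral sign gives the following cancellation.\<close>

lemma integral_radial_one:
  fixes x :: "'a::euclidean_space" and w :: "'b::euclidean_space"
  assumes w: "w \<noteq> 0" and \<alpha>: "0 < \<alpha>" and s: "s = real DIM('a) + \<alpha>"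
  shows "\<alpha> * (LINT y|lebesgue. riesz s (x, w) y)
      = s * (norm w)\<^sup>2 * (LINT y|lebesgue. riesz (s + 2) (x, w) y)"
proof -
  interpret riesz_potential "\<lambda>_::'a. 1" s "TYPE('b)"
    by (rule riesz_potential_one[OF \<alpha> s])
  let ?z = "(x, w)" and ?c = "LINT y|lborel. unit_kernel s (y::'a)"
  have op: "open (- {z::'a \<times> 'b. snd z = 0})"
    by (intro open_Compl closed_Collect_eq continuous_intros)
  have eq: "?c * norm (snd z) powr (- \<alpha>) = pot z" if "z \<in> - {z::'a \<times> 'b. snd z = 0}" for z
    using integral_riesz[of "snd z" s \<alpha> "fst z"] that s unfolding pot_def by simp
  have "((\<lambda>z::'a \<times> 'b. ?c * norm (snd z) powr (- \<alpha>)) has_derivative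
      (\<lambda>v. ?c * (- \<alpha> * norm w powr (- \<alpha> - 2) * (w \<bullet> snd v)))) (at ?z)"
  proof (rule has_derivative_mult_right)
    have "(snd has_derivative snd) (at ?z)" by (intro derivative_intros)
    moreover have "((\<lambda>u. norm u powr - \<alpha>) has_derivative
       (\<lambda>v. - \<alpha> * norm w powr (- \<alpha> - 2) * (w \<bullet> v))) (at (snd ?z))"
      using has_derivative_norm_powr[OF w, of "- \<alpha>"] by simp
    ultimately show "((\<lambda>z::'a \<times> 'b. norm (snd z) powr - \<alpha>) has_derivative
      (\<lambda>v. - \<alpha> * norm w powr (- \<alpha> - 2) * (w \<bullet> snd v))) (at ?z)"
      by (rule has_derivative_compose)
  qed
  then have "(pot has_derivative (\<lambda>v. ?c * (- \<alpha> * norm w powr (- \<alpha> - 2) * (w \<bullet> snd v)))) (at ?z)"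
    by (rule has_derivative_transform_within_open[OF _ op _ eq]) (use w in auto)
  moreover have "(pot has_derivative (\<lambda>v. - s * mom v ?z)) (at ?z)"
    using w by (intro has_derivative_pot) simp
  ultimately have e1: "?c * (- \<alpha> * norm w powr (- \<alpha> - 2) * (w \<bullet> snd (0::'a, w))) = - s * mom (0, w) ?z"
    by (metis has_derivative_unique)
  have e2: "mom (0, w) ?z = (norm w)\<^sup>2 * (LINT y|lebesgue. riesz (s + 2) ?z y)"
    by (simp add: mom_def power2_norm_eq_inner mult.commute)
  have e3: "norm w powr (- \<alpha> - 2) * (w \<bullet> w) = norm w powr - \<alpha>"
    using w by (simp add: powr_diff powr_numeral power2_norm_eq_inner[symmetric])
  have "\<alpha> * (LINT y|lebesgue. riesz s ?z y) = ?c * (\<alpha> * (norm w powr (- \<alpha> - 2) * (w \<bullet> w)))"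
    unfolding e3 integral_riesz[OF w s, of x] by (simp only: mult_ac)
  also have "\<dots> = s * mom (0, w) ?z"
    using e1 by (simp add: mult.assoc)
  finally show ?thesis unfolding e2 by (simp only: mult.assoc)
qed

section \<open>Oscillation estimates\<close>

context riesz_potential
begin

lemma int_const:
  assumes "0 < \<alpha>" "s = real DIM('a) + \<alpha>" "snd (z::'a \<times> 'b) \<noteq> 0"
  shows "integrable lebesgue (riesz s z)"
  using riesz_potential.f_int[OF riesz_potential_one[OF assms(1,2)] assms(3)] by simp

lemma int_diff_const:
  assumes "0 < \<alpha>" "s = real DIM('a) + \<alpha>" "snd (z::'a \<times> 'b) \<noteq> 0"
  shows "integrable lebesgue (\<lambda>y. riesz s z y * \<bar>f y - m\<bar>)"
proof -
  have "integrable lebesgue (\<lambda>y. riesz s z y * f y - m * riesz s z y)"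
    by (intro Bochner_Integration.integrable_diff f_int integrable_mult_right int_const[OF assms] assms)
  then have "integrable lebesgue (\<lambda>y. \<bar>riesz s z y * f y - m * riesz s z y\<bar>)"
    by (rule integrable_abs)
  moreover have "\<bar>riesz s z y * f y - m * riesz s z y\<bar> = riesz s z y * \<bar>f y - m\<bar>" for y
    by (metis abs_mult abs_of_nonneg mult.commute riesz_nonneg right_diff_distrib')
  ultimately show ?thesis by simp
qed

text \<open>A kernel that annihilates constants sees only the oscillation of the density.\<close>

lemma cancellation_bound:
  assumes \<alpha>: "0 < \<alpha>" and s: "s = real DIM('a) + \<alpha>" and z: "snd (z::'a \<times> 'b) \<noteq> 0"
    and k [measurable]: "k \<in> borel_measurable lebesgue"
    and le: "\<And>y. \<bar>k y\<bar> \<le> B * riesz s z y" and k0: "(LINT y|lebesgue. k y) = 0"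
    and B: "0 \<le> B" and A: "(LINT y|lebesgue. riesz s z y * \<bar>f y - m\<bar>) \<le> A"
  shows "\<bar>LINT y|lebesgue. k y * f y\<bar> \<le> B * A"
proof -
  have ik: "integrable lebesgue k"
    by (rule Bochner_Integration.integrable_bound[OF integrable_mult_right[OF int_const[OF \<alpha> s z], of B]])
       (use le in \<open>auto intro: order_trans[OF _ abs_ge_self]\<close>)
  have le2: "\<bar>k y * g\<bar> \<le> B * (riesz s z y * \<bar>g\<bar>)" for y g
    using mult_right_mono[OF le[of y], of "\<bar>g\<bar>"] by (simp add: abs_mult mult.assoc)
  have ikf: "integrable lebesgue (\<lambda>y. k y * f y)"
    by (rule int_dominated[OF z _ le2]) measurable
  have "(LINT y|lebesgue. k y * f y) = (LINT y|lebesgue. k y * f y) - (LINT y|lebesgue. m * k y)"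
    using k0 by simp
  also have "\<dots> = (LINT y|lebesgue. k y * (f y - m))"
    using ik ikf by (subst Bochner_Integration.integral_diff[symmetric]) (auto simp: algebra_simps)
  also have "\<bar>\<dots>\<bar> \<le> (LINT y|lebesgue. B * (riesz s z y * \<bar>f y - m\<bar>))"
  proof -
    have "integrable lebesgue (\<lambda>y. k y * f y - m * k y)" using ik ikf by auto
    then have i: "integrable lebesgue (\<lambda>y. k y * (f y - m))" by (simp add: algebra_simps)
    have "\<bar>LINT y|lebesgue. k y * (f y - m)\<bar> \<le> (LINT y|lebesgue. \<bar>k y * (f y - m)\<bar>)"
      by (rule integral_abs_bound)
    also have "\<dots> \<le> (LINT y|lebesgue. B * (riesz s z y * \<bar>f y - m\<bar>))"
      by (intro integral_mono integrable_abs i integrable_mult_right int_diff_const[OF \<alpha> s z] le2)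
    finally show ?thesis .
  qed
  also have "\<dots> \<le> B * A"
    using A B by (simp add: mult_left_mono)
  finally show ?thesis .
qed

lemma mom_bound:
  assumes \<alpha>: "0 < \<alpha>" and s: "s = real DIM('a) + \<alpha>" and w: "w \<noteq> (0::'b)"
    and A: "(LINT y|lebesgue. riesz s (x, w) y * \<bar>f y - m\<bar>) \<le> A"
  shows "\<bar>mom (v, 0) (x, w)\<bar> \<le> norm w powr - 1 * norm v * A"
  unfolding mom_def
proof (rule cancellation_bound[OF \<alpha> s _ _ _ _ _ A])
  show "snd (x, w) \<noteq> 0" using w by simp
  then show "\<bar>riesz (s + 2) (x, w) y * (((x, w) - (y, 0)) \<bullet> (v, 0))\<bar>
      \<le> norm w powr - 1 * norm v * riesz s (x, w) y" for y
    using abs_mom_integrand_le[of "(x, w)" y "(v, 0)"] by (simp add: norm_Pair)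
  show "(LINT y|lebesgue. riesz (s + 2) (x, w) y * (((x, w) - (y, 0)) \<bullet> (v, 0))) = 0"
    by (rule integral_mom_one[OF w])
  show "(\<lambda>y. riesz (s + 2) (x, w) y * (((x, w) - (y, 0)) \<bullet> (v, 0))) \<in> borel_measurable lebesgue"
    by (intro borel_measurable_times borel_measurable_riesz_lebesgue borel_measurable_inner_plane)
qed auto

text \<open>The left-hand side is \<open>r powr (1-\<alpha>)\<close> times the radial derivative of \<open>r powr \<alpha> * pot\<close>.\<close>

lemma radial_bound:
  assumes \<alpha>: "0 < \<alpha>" and s: "s = real DIM('a) + \<alpha>" and w: "w \<noteq> (0::'b)"
    and A: "(LINT y|lebesgue. riesz s (x, w) y * \<bar>f y - m\<bar>) \<le> A"
  shows "\<bar>\<alpha> * pot (x, w) - s * (norm w)\<^sup>2 * pot2 (x, w)\<bar> \<le> (\<alpha> + s) * A"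
proof -
  let ?z = "(x, w)"
  let ?k = "\<lambda>y. \<alpha> * riesz s ?z y - s * (norm w)\<^sup>2 * riesz (s + 2) ?z y"
  have z: "snd ?z \<noteq> 0" using w by simp
  interpret one: riesz_potential "\<lambda>_::'a. 1" s "TYPE('b)"
    by (rule riesz_potential_one[OF \<alpha> s])
  have "\<bar>LINT y|lebesgue. ?k y * f y\<bar> \<le> (\<alpha> + s) * A"
  proof (rule cancellation_bound[OF \<alpha> s z _ _ _ _ A])
    fix y
    have "(norm w)\<^sup>2 * riesz (s + 2) ?z y \<le> (norm w)\<^sup>2 * (norm w powr - 2 * riesz s ?z y)"
      using riesz_antimono[OF z, of s "s + 2" y] s_pos by (intro mult_left_mono) auto
    also have "\<dots> = riesz s ?z y"
      using w by (simp add: powr_minus powr_numeral)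
    finally have "s * ((norm w)\<^sup>2 * riesz (s + 2) ?z y) \<le> s * riesz s ?z y"
      using s_pos by (intro mult_left_mono) auto
    moreover have "0 \<le> s * ((norm w)\<^sup>2 * riesz (s + 2) ?z y)" "0 \<le> \<alpha> * riesz s ?z y"
      using s_pos \<alpha> by auto
    moreover have "\<bar>p - q\<bar> \<le> p + u" if "0 \<le> p" "0 \<le> q" "q \<le> u" for p q u :: real using that by auto
    ultimately have "\<bar>\<alpha> * riesz s ?z y - s * ((norm w)\<^sup>2 * riesz (s + 2) ?z y)\<bar> \<le> \<alpha> * riesz s ?z y + s * riesz s ?z y"
      by blast
    then show "\<bar>?k y\<bar> \<le> (\<alpha> + s) * riesz s ?z y" by (simp add: algebra_simps)
  next
    have "(LINT y|lebesgue. ?k y) = \<alpha> * (LINT y|lebesgue. riesz s ?z y)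
       - s * (norm w)\<^sup>2 * (LINT y|lebesgue. riesz (s + 2) ?z y)"
      using one.int_pot2[OF z] int_const[OF \<alpha> s z]
      by (subst Bochner_Integration.integral_diff) (auto intro: integrable_mult_right)
    then show "(LINT y|lebesgue. ?k y) = 0"
      using integral_radial_one[OF w \<alpha> s, of x] by simp
    show "?k \<in> borel_measurable lebesgue" by measurable
  qed (use \<alpha> s_pos in auto)
  moreover have "(LINT y|lebesgue. ?k y * f y) = \<alpha> * pot ?z - s * (norm w)\<^sup>2 * pot2 ?z"
  proof -
    have "(LINT y|lebesgue. ?k y * f y) = (LINT y|lebesgue. \<alpha> * (riesz s ?z y * f y)
        - s * (norm w)\<^sup>2 * (riesz (s + 2) ?z y * f y))"
      by (simp add: algebra_simps)
    also have "\<dots> = (LINT y|lebesgue. \<alpha> * (riesz s ?z y * f y))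
       - (LINT y|lebesgue. s * (norm w)\<^sup>2 * (riesz (s + 2) ?z y * f y))"
      by (intro Bochner_Integration.integral_diff integrable_mult_right f_int int_pot2 z)
    finally show ?thesis by (simp only: integral_mult_right_zero pot_def pot2_def)
  qed
  ultimately show ?thesis by simp
qed

lemma mom_normal: "mom (0, v) (x, w) = (w \<bullet> v) * pot2 (x, w)"
proof -
  have "mom (0, v) (x, w) = (LINT y|lebesgue. (w \<bullet> v) * (riesz (s + 2) (x, w) y * f y))"
    unfolding mom_def by (intro Bochner_Integration.integral_cong) (auto simp: inner_Pair mult_ac)
  then show ?thesis by (simp only: integral_mult_right_zero pot2_def)
qed

lemma sum_mom_sq:
  "(\<Sum>b\<in>Basis. (mom b (x, w))\<^sup>2) = (\<Sum>b\<in>Basis. (mom (b, 0) (x, w))\<^sup>2) + (norm w)\<^sup>2 * (pot2 (x, w))\<^sup>2"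
proof -
  have "(\<Sum>b\<in>Basis. (mom b (x, w))\<^sup>2)
     = (\<Sum>b\<in>Basis. (mom (b, 0) (x, w))\<^sup>2) + (\<Sum>b\<in>Basis. (mom (0, b) (x, w))\<^sup>2)"
    unfolding Basis_prod_def
    by (subst sum.union_disjoint) (auto simp: sum.reindex inj_on_def)
  also have "(\<Sum>b\<in>Basis. (mom (0, b) (x, w))\<^sup>2) = (\<Sum>b\<in>Basis. (w \<bullet> b)\<^sup>2) * (pot2 (x, w))\<^sup>2"
    by (simp add: mom_normal power_mult_distrib sum_distrib_right)
  also have "(\<Sum>b\<in>Basis. (w \<bullet> b)\<^sup>2) = (norm w)\<^sup>2"
    using euclidean_inner[of w w] by (simp only: power2_norm_eq_inner) (simp only: power2_eq_square)
  finally show ?thesis .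
qed

text \<open>Here the equation enters. With \<open>X\<close> the squared length of the tangential moments and
  \<open>Y = \<alpha> pot - s r\<^sup>2 pot2\<close>, the equation becomes \<open>s X = pot2 Y\<close>, hence
  \<open>\<alpha> pot Y = Y\<^sup>2 + s\<^sup>2 r\<^sup>2 X\<close>: the radial derivative of \<open>(r powr \<alpha> * pot)\<^sup>2\<close>, which is a multiple
  of \<open>pot Y\<close>, is quadratic in the oscillation of the density.\<close>

lemma pot_radial_bound:
  assumes \<alpha>: "0 < \<alpha>" and s: "s = real DIM('a) + \<alpha>" and w: "w \<noteq> (0::'b)"
    and A: "(LINT y|lebesgue. riesz s (x, w) y * \<bar>f y - m\<bar>) \<le> A"
    and eq: "s * (\<Sum>b\<in>Basis. (mom b (x, w))\<^sup>2) = \<alpha> * pot (x, w) * pot2 (x, w)"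
  shows "\<bar>pot (x, w) * (\<alpha> * pot (x, w) - s * (norm w)\<^sup>2 * pot2 (x, w))\<bar>
    \<le> ((\<alpha> + s)\<^sup>2 + s\<^sup>2 * real DIM('a)) / \<alpha> * A\<^sup>2"
proof -
  let ?P = "pot (x, w)" and ?J = "pot2 (x, w)" and ?r = "norm w"
  let ?X = "\<Sum>b\<in>Basis. (mom (b, 0) (x, w))\<^sup>2"
  let ?Y = "\<alpha> * ?P - s * ?r\<^sup>2 * ?J"
  have r: "0 < ?r" using w by simp
  have "s * ?X = ?J * ?Y"
    using eq unfolding sum_mom_sq by (simp add: algebra_simps power2_eq_square)
  then have "?Y\<^sup>2 + s\<^sup>2 * ?r\<^sup>2 * ?X = ?Y\<^sup>2 + s * ?r\<^sup>2 * (?J * ?Y)"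
    by (simp add: power2_eq_square mult_ac)
  also have "\<dots> = \<alpha> * (?P * ?Y)" by (simp add: algebra_simps power2_eq_square)
  finally have id: "\<alpha> * (?P * ?Y) = ?Y\<^sup>2 + s\<^sup>2 * ?r\<^sup>2 * ?X" by simp
  have X0: "0 \<le> ?X" by (intro sum_nonneg) auto
  have Y: "?Y\<^sup>2 \<le> (\<alpha> + s)\<^sup>2 * A\<^sup>2"
    using power_mono[OF radial_bound[OF \<alpha> s w A], of 2] by (simp add: power_mult_distrib)
  have X: "?r\<^sup>2 * ?X \<le> real DIM('a) * A\<^sup>2"
  proof -
    have "?X \<le> (\<Sum>b\<in>(Basis::'a set). (?r powr - 1 * A)\<^sup>2)"
    proof (rule sum_mono)
      fix b :: 'a assume "b \<in> Basis"
      then have "\<bar>mom (b, 0) (x, w)\<bar> \<le> ?r powr - 1 * A"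
        using mom_bound[OF \<alpha> s w A, of b] by simp
      then have "\<bar>mom (b, 0) (x, w)\<bar>\<^sup>2 \<le> (?r powr - 1 * A)\<^sup>2" by (intro power_mono) auto
      then show "(mom (b, 0) (x, w))\<^sup>2 \<le> (?r powr - 1 * A)\<^sup>2" by simp
    qed
    then have "?r\<^sup>2 * ?X \<le> ?r\<^sup>2 * (real DIM('a) * (?r powr - 1 * A)\<^sup>2)"
      by (intro mult_left_mono) auto
    also have "\<dots> = real DIM('a) * A\<^sup>2"
      using r by (simp add: powr_minus power_mult_distrib field_simps)
    finally show ?thesis .
  qed
  have "0 \<le> \<alpha> * (?P * ?Y)" unfolding id using X0 by simp
  moreover have "\<alpha> * (?P * ?Y) \<le> (\<alpha> + s)\<^sup>2 * A\<^sup>2 + s\<^sup>2 * (real DIM('a) * A\<^sup>2)"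
    unfolding id using Y mult_left_mono[OF X, of "s\<^sup>2"] by (simp add: mult.assoc)
  ultimately have "\<alpha> * \<bar>?P * ?Y\<bar> \<le> ((\<alpha> + s)\<^sup>2 + s\<^sup>2 * real DIM('a)) * A\<^sup>2"
    using \<alpha> by (simp add: zero_le_mult_iff algebra_simps)
  then show ?thesis using \<alpha> by (simp add: field_simps)
qed

lemma pot_radial_oscillation:
  assumes \<alpha>: "0 < \<alpha>" and s: "s = real DIM('a) + \<alpha>" and e: "norm (e::'b) = 1"
    and r: "0 < r1" "r1 \<le> r2" and B: "0 \<le> B"
    and A: "\<And>r. 0 < r \<Longrightarrow> \<exists>m. (LINT y|lebesgue. riesz s (x, r *\<^sub>R e) y * \<bar>f y - m\<bar>) \<le> B * r powr - \<alpha>"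
    and eq: "\<And>w. w \<noteq> 0 \<Longrightarrow> s * (\<Sum>b\<in>Basis. (mom b (x, w))\<^sup>2) = \<alpha> * pot (x, w) * pot2 (x, w)"
  shows "\<bar>(r2 powr \<alpha> * pot (x, r2 *\<^sub>R e))\<^sup>2 - (r1 powr \<alpha> * pot (x, r1 *\<^sub>R e))\<^sup>2\<bar>
    \<le> 2 * ((\<alpha> + s)\<^sup>2 + s\<^sup>2 * real DIM('a)) / \<alpha> * B\<^sup>2 / r1 * (r2 - r1)"
proof -
  let ?M = "((\<alpha> + s)\<^sup>2 + s\<^sup>2 * real DIM('a)) / \<alpha>"
  let ?P = "\<lambda>r. pot (x, r *\<^sub>R e)" and ?J = "\<lambda>r. pot2 (x, r *\<^sub>R e)"
  have ee: "e \<bullet> e = 1" using e by (simp add: norm_eq_1)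
  have e0: "e \<noteq> 0" using e by auto
  have dP: "(?P has_real_derivative (- s * (r * ?J r))) (at r)" if "0 < r" for r
  proof -
    have "((\<lambda>r. (x, r *\<^sub>R e)) has_derivative (\<lambda>h. (0, h *\<^sub>R e))) (at r)"
      by (auto intro!: derivative_eq_intros)
    moreover have "(pot has_derivative (\<lambda>v. - s * mom v (x, r *\<^sub>R e))) (at (x, r *\<^sub>R e))"
      using that e0 by (intro has_derivative_pot) auto
    ultimately have "(?P has_derivative (\<lambda>h. - s * mom (0, h *\<^sub>R e) (x, r *\<^sub>R e))) (at r)"
      by (rule has_derivative_compose)
    moreover have "(\<lambda>h. - s * mom (0, h *\<^sub>R e) (x, r *\<^sub>R e)) = (*) (- s * (r * ?J r))"
      by (simp add: fun_eq_iff mom_normal ee)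
    ultimately show ?thesis by (simp only: has_field_derivative_def)
  qed
  let ?D = "\<lambda>r. 2 * r powr (2 * \<alpha> - 1) * (?P r * (\<alpha> * ?P r - s * (norm (r *\<^sub>R e))\<^sup>2 * ?J r))"
  have dE: "((\<lambda>r. (r powr \<alpha> * ?P r)\<^sup>2) has_real_derivative ?D r) (at r)" if "0 < r" for r
  proof -
    have "((\<lambda>r. r powr \<alpha>) has_real_derivative \<alpha> * r powr (\<alpha> - 1)) (at r)"
      by (rule has_real_derivative_powr[OF that])
    from DERIV_power[OF DERIV_mult[OF this dP[OF that]], of 2]
    have "((\<lambda>r. (r powr \<alpha> * ?P r)\<^sup>2) has_real_derivative
      2 * ((\<alpha> * r powr (\<alpha> - 1) * ?P r + - s * (r * ?J r) * r powr \<alpha>) * (r powr \<alpha> * ?P r))) (at r)"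
      by (simp add: power2_eq_square)
    moreover have "2 * ((\<alpha> * r powr (\<alpha> - 1) * ?P r + - s * (r * ?J r) * r powr \<alpha>) * (r powr \<alpha> * ?P r)) = ?D r"
    proof -
      have 1: "r powr (\<alpha> - 1) * r powr \<alpha> = r powr (2 * \<alpha> - 1)" by (simp add: powr_add[symmetric])
      have 2: "r powr \<alpha> = r powr (\<alpha> - 1) * r" using that by (simp add: powr_diff)
      have "2 * ((\<alpha> * r powr (\<alpha> - 1) * ?P r + - s * (r * ?J r) * r powr \<alpha>) * (r powr \<alpha> * ?P r))
         = 2 * ((\<alpha> * r powr (\<alpha> - 1) * ?P r + - s * (r * ?J r) * (r powr (\<alpha> - 1) * r)) * (r powr \<alpha> * ?P r))"
        using 2 by simp
      also have "\<dots> = 2 * (r powr (\<alpha> - 1) * r powr \<alpha>) * (?P r * (\<alpha> * ?P r - s * r\<^sup>2 * ?J r))"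
        by (simp only: power2_eq_square) (simp add: algebra_simps)
      also have "\<dots> = ?D r" unfolding 1 using e that by simp
      finally show ?thesis .
    qed
    ultimately show ?thesis by (rule DERIV_cong)
  qed
  have bD: "\<bar>?D r\<bar> \<le> 2 * ?M * B\<^sup>2 / r1" if r': "r \<in> {r1..r2}" for r
  proof -
    have r0: "0 < r" using r r' by simp
    obtain m where m: "(LINT y|lebesgue. riesz s (x, r *\<^sub>R e) y * \<bar>f y - m\<bar>) \<le> B * r powr - \<alpha>"
      using A[OF r0] by blast
    have w: "r *\<^sub>R e \<noteq> 0" using r0 e0 by simp
    have "\<bar>?D r\<bar> = 2 * r powr (2 * \<alpha> - 1) * \<bar>?P r * (\<alpha> * ?P r - s * (norm (r *\<^sub>R e))\<^sup>2 * ?J r)\<bar>"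
      by (simp add: abs_mult)
    also have "\<dots> \<le> 2 * r powr (2 * \<alpha> - 1) * (?M * (B * r powr - \<alpha>)\<^sup>2)"
      using pot_radial_bound[OF \<alpha> s w m eq[OF w]] by (intro mult_left_mono) auto
    also have "\<dots> = 2 * ?M * B\<^sup>2 * (r powr (2 * \<alpha> - 1) * (r powr - \<alpha> * r powr - \<alpha>))"
      by (simp only: power_mult_distrib power2_eq_square mult_ac)
    also have "r powr (2 * \<alpha> - 1) * (r powr - \<alpha> * r powr - \<alpha>) = 1 / r"
      using r0 by (simp only: powr_add[symmetric]) (simp add: powr_minus_divide)
    also have "2 * ?M * B\<^sup>2 * (1 / r) \<le> 2 * ?M * B\<^sup>2 * (1 / r1)"
      using r r' \<alpha> by (intro mult_left_mono divide_left_mono) auto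
    finally show ?thesis by simp
  qed
  have "norm ((r2 powr \<alpha> * ?P r2)\<^sup>2 - (r1 powr \<alpha> * ?P r1)\<^sup>2) \<le> (2 * ?M * B\<^sup>2 / r1) * norm (r2 - r1)"
  proof (rule field_differentiable_bound[of "{r1..r2}" "\<lambda>r. (r powr \<alpha> * ?P r)\<^sup>2" ?D])
    fix r assume r': "r \<in> {r1..r2}"
    then have "0 < r" using r by simp
    from dE[OF this] show "((\<lambda>r. (r powr \<alpha> * ?P r)\<^sup>2) has_real_derivative ?D r) (at r within {r1..r2})"
      by (rule has_field_derivative_at_within)
    show "norm (?D r) \<le> 2 * ?M * B\<^sup>2 / r1" unfolding real_norm_def by (rule bD[OF r'])
  qed (use r in auto)
  then show ?thesis using r by simp
qed

lemma pot_tangential_oscillation: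
  assumes \<alpha>: "0 < \<alpha>" and s: "s = real DIM('a) + \<alpha>" and w: "w \<noteq> (0::'b)"
    and A: "\<And>x. \<exists>m. (LINT y|lebesgue. riesz s (x, w) y * \<bar>f y - m\<bar>) \<le> B"
  shows "\<bar>pot (x, w) - pot (x', w)\<bar> \<le> s * norm w powr - 1 * B * norm (x - x')"
proof -
  have "norm (pot (x, w) - pot (x', w)) \<le> (s * norm w powr - 1 * B) * norm (x - x')"
  proof (rule differentiable_bound[of UNIV "\<lambda>x. pot (x, w)"])
    fix u :: 'a
    have "((\<lambda>x. (x, w)) has_derivative (\<lambda>v. (v, 0))) (at u)"
      by (auto intro!: derivative_eq_intros)
    moreover have "(pot has_derivative (\<lambda>v. - s * mom v (u, w))) (at (u, w))"
      using w by (intro has_derivative_pot) auto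
    ultimately show "((\<lambda>x. pot (x, w)) has_derivative (\<lambda>v. - s * mom (v, 0) (u, w))) (at u)"
      by (rule has_derivative_compose)
    obtain m where m: "(LINT y|lebesgue. riesz s (u, w) y * \<bar>f y - m\<bar>) \<le> B"
      using A by blast
    have "0 \<le> (LINT y|lebesgue. riesz s (u, w) y * \<bar>f y - m\<bar>)"
      by (intro integral_nonneg_AE) auto
    from order_trans[OF this m] have B: "0 \<le> B" .
    show "onorm (\<lambda>v. - s * mom (v, 0) (u, w)) \<le> s * norm w powr - 1 * B"
    proof (rule onorm_bound)
      show "0 \<le> s * norm w powr - 1 * B" using B s_pos by simp
      show "norm (- s * mom (v, 0) (u, w)) \<le> s * norm w powr - 1 * B * norm v" for v
        using mult_left_mono[OF mom_bound[OF \<alpha> s w m, of v], of s] s_pos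
        by (simp add: abs_mult mult_ac)
    qed
  qed auto
  then show ?thesis by simp
qed

end

text \<open>Pointwise control of the potential itself, not only of its oscillation, also needs one mean;
  the mean over the unit ball is used, and compared through a large ball with the mean around \<open>x\<close>.\<close>

lemma bmo_potential_bound:
  fixes z :: "'a::euclidean_space \<times> 'b::euclidean_space"
  assumes z: "snd z \<noteq> 0" and \<alpha>: "0 < \<alpha>" and s: "s = real DIM('a) + \<alpha>"
  obtains C where "0 \<le> C"
    "\<And>f b. locally_integrable f \<Longrightarrow> bmo_norm f \<le> ennreal b \<Longrightarrow> 0 \<le> b \<Longrightarrow>
       integrable lebesgue (\<lambda>y. riesz s z y * f y) \<and>
       \<bar>LINT y|lebesgue. riesz s z y * f y\<bar> \<le> C * (b + \<bar>LINT y:ball 0 1|lebesgue. f y\<bar>)"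
proof -
  obtain x w where zz: "z = (x, w)" by (cases z)
  have w: "w \<noteq> 0" using z zz by simp
  define r where "r = norm w"
  \<comment> \<open>the ball of this radius contains both the unit ball and the ball around \<open>x\<close>\<close>
  define \<rho> where "\<rho> = norm x + r + 1"
  define c where "c = (LINT y|lebesgue. riesz s (x, w) y)"
  define V where "V = measure lebesgue (ball (0::'a) 1)"
  define C1 where "C1 = bmo_const DIM('a) \<alpha> * r powr - \<alpha>"
  define C2 where "C2 = (\<rho> / r) ^ DIM('a) + (\<rho> / 1) ^ DIM('a)"
  define C where "C = C1 + c * (C2 + 1 / V)"
  have r: "0 < r" and \<rho>: "0 < \<rho>" using w by (auto simp: r_def \<rho>_def intro: add_nonneg_pos)
  have V: "0 < V" unfolding V_def by (rule measure_ball_pos) simp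
  have c: "0 \<le> c" unfolding c_def by (intro integral_nonneg_AE) auto
  have C1: "0 \<le> C1" using bmo_const_nonneg[OF \<alpha>] by (simp add: C1_def)
  have C2: "0 \<le> C2" using r \<rho> by (simp add: C2_def)
  have ic: "integrable lebesgue (riesz s (x, w) :: 'a \<Rightarrow> real)"
    using riesz_potential.f_int[OF riesz_potential_one[OF \<alpha> s], of "(x, w)"] w by simp
  show ?thesis
  proof (rule that)
    show "0 \<le> C" using C1 C2 c V by (simp add: C_def)
    fix f :: "'a \<Rightarrow> real" and b :: real
    assume f: "locally_integrable f" and b: "bmo_norm f \<le> ennreal b" "0 \<le> b"
    let ?m = "mean_on (ball x r) f" and ?I = "LINT y:ball 0 1|lebesgue. f y"
    note bm = bmo_riesz[OF f b w \<alpha> s, of x]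
    have "integrable lebesgue (\<lambda>y. riesz s (x, w) y * (f y - ?m) + ?m * riesz s (x, w) y)"
      using bm(1) ic unfolding r_def by (intro Bochner_Integration.integrable_add integrable_mult_right) auto
    then have int: "integrable lebesgue (\<lambda>y. riesz s z y * f y)"
      by (simp add: zz algebra_simps)
    have "(LINT y|lebesgue. riesz s z y * f y)
        = (LINT y|lebesgue. riesz s (x, w) y * (f y - ?m) + ?m * riesz s (x, w) y)"
      by (simp add: zz algebra_simps)
    also have "\<dots> = (LINT y|lebesgue. riesz s (x, w) y * (f y - ?m)) + ?m * c"
      using bm(1) ic unfolding r_def c_def
      by (subst Bochner_Integration.integral_add) (auto intro: integrable_mult_right)
    finally have "\<bar>LINT y|lebesgue. riesz s z y * f y\<bar>
       \<le> \<bar>LINT y|lebesgue. riesz s (x, w) y * (f y - ?m)\<bar> + \<bar>?m\<bar> * c"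
      using c abs_triangle_ineq[of "LINT y|lebesgue. riesz s (x, w) y * (f y - ?m)" "?m * c"]
      by (simp add: abs_mult)
    moreover have "\<bar>LINT y|lebesgue. riesz s (x, w) y * (f y - ?m)\<bar> \<le> C1 * b"
    proof -
      have "\<bar>LINT y|lebesgue. riesz s (x, w) y * (f y - ?m)\<bar> \<le> (LINT y|lebesgue. \<bar>riesz s (x, w) y * (f y - ?m)\<bar>)"
        by (rule integral_abs_bound)
      also have "\<dots> = (LINT y|lebesgue. riesz s (x, w) y * \<bar>f y - ?m\<bar>)"
        by (simp add: abs_mult)
      also have "\<dots> \<le> C1 * b" using bm(2) by (simp add: C1_def r_def mult_ac)
      finally show ?thesis .
    qed
    moreover have "\<bar>?m\<bar> \<le> C2 * b + \<bar>?I\<bar> / V"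
    proof -
      have "ball x r \<subseteq> ball 0 \<rho>"
      proof
        fix y assume "y \<in> ball x r"
        then show "y \<in> ball 0 \<rho>"
          using dist_triangle[of 0 y x] by (simp add: \<rho>_def dist_norm)
      qed
      then have "\<bar>?m - mean_on (ball 0 \<rho>) f\<bar> \<le> (\<rho> / r) ^ DIM('a) * b"
        using f b \<rho> r by (intro mean_on_ball_subset_diff)
      moreover have "ball 0 1 \<subseteq> ball (0::'a) \<rho>"
        using r by (intro subset_ball) (simp add: \<rho>_def)
      then have "\<bar>mean_on (ball 0 1) f - mean_on (ball 0 \<rho>) f\<bar> \<le> (\<rho> / 1) ^ DIM('a) * b"
        using f b \<rho> by (intro mean_on_ball_subset_diff) auto
      moreover have "\<bar>mean_on (ball 0 1) f\<bar> = \<bar>?I\<bar> / V"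
        using V by (simp add: mean_on_def V_def abs_divide)
      ultimately show ?thesis by (simp add: C2_def algebra_simps)
    qed
    then have "\<bar>?m\<bar> * c \<le> (C2 * b + \<bar>?I\<bar> / V) * c" using c by (rule mult_right_mono)
    ultimately have "\<bar>LINT y|lebesgue. riesz s z y * f y\<bar> \<le> C1 * b + (C2 * b + \<bar>?I\<bar> / V) * c"
      by linarith
    also have "\<dots> \<le> C * (b + \<bar>?I\<bar>)"
    proof -
      have "0 \<le> C1 * \<bar>?I\<bar> + c * C2 * \<bar>?I\<bar> + c / V * b" using C1 C2 c V b by simp
      then show ?thesis by (simp add: C_def algebra_simps)
    qed
    finally show "integrable lebesgue (\<lambda>y. riesz s z y * f y) \<and>
       \<bar>LINT y|lebesgue. riesz s z y * f y\<bar> \<le> C * (b + \<bar>?I\<bar>)"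
      using int by simp
  qed
qed

section \<open>Injectivity of the Riesz potential\<close>

lemma riesz_commute: "riesz s (x, w) y = riesz s (y, w) x"
  unfolding riesz_def norm_diff_plane norm_minus_commute[of x y] ..

lemma riesz_shift_le:
  fixes w :: "'b::euclidean_space"
  assumes w: "w \<noteq> 0" and x: "norm x \<le> \<rho>" and s: "0 \<le> s"
  shows "riesz s (x, w) y \<le> (1 + \<rho> / norm w) powr s * riesz s (0, w) y"
proof -
  have r: "0 < norm w" using w by simp
  have \<rho>: "0 \<le> \<rho>" using x norm_ge_zero order_trans by blast
  let ?N = "norm ((x, w) - (y, 0))" and ?M = "norm ((0, w) - (y, 0))"
  have N: "norm w \<le> ?N" using norm_snd_le_diff_plane[of "(x, w)" y] by simp
  then have N0: "0 < ?N" using r by linarith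
  have "norm w \<le> ?M" using norm_snd_le_diff_plane[of "(0::'a, w)" y] by simp
  then have M: "0 < ?M" using r by linarith
  have "(0, w) - (y, 0) = ((x, w) - (y, 0)) - (x, 0)" by simp
  then have "?M \<le> ?N + norm (x, 0::'b)" by (metis norm_triangle_ineq4)
  also have "norm (x, 0::'b) \<le> \<rho>" using x by (simp add: norm_Pair)
  also have "\<rho> \<le> \<rho> / norm w * ?N"
    using mult_left_mono[OF N, of "\<rho> / norm w"] \<rho> r by simp
  finally have "?M \<le> (1 + \<rho> / norm w) * ?N" by (simp add: algebra_simps)
  then have le: "?M / (1 + \<rho> / norm w) \<le> ?N"
    using \<rho> r by (subst pos_divide_le_eq) (auto simp: mult.commute intro: add_pos_nonneg)
  have p: "0 < 1 + \<rho> / norm w" using \<rho> r by (intro add_pos_nonneg) auto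
  have "riesz s (x, w) y \<le> (?M / (1 + \<rho> / norm w)) powr - s"
    unfolding riesz_def using le s M p by (intro powr_mono2') auto
  also have "\<dots> = (1 + \<rho> / norm w) powr s * riesz s (0, w) y"
    using p by (simp only: riesz_def powr_divide powr_minus) (simp add: field_simps)
  finally show ?thesis .
qed

text \<open>The normalized potential of the indicator of \<open>A\<close> is an approximate identity applied
  to that indicator.\<close>

definition smooth_ind :: "real \<Rightarrow> 'a::euclidean_space set \<Rightarrow> real \<Rightarrow> 'a \<Rightarrow> real" where
  "smooth_ind s A r y = (LINT x|lborel. unit_kernel s x * indicator A (y + r *\<^sub>R x))"

lemma smooth_ind_eq:
  fixes A :: "'a::euclidean_space set" and e :: "'b::euclidean_space"
  assumes r: "0 < r" and e: "norm e = 1" and A: "A \<in> sets borel" and s: "s = real DIM('a) + \<alpha>"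
  shows "(LINT x|lborel. riesz s (y, r *\<^sub>R e) x * indicator A x) = r powr - \<alpha> * smooth_ind s A r y"
proof -
  have w: "r *\<^sub>R e \<noteq> 0" using r e by auto
  have "(indicator A :: 'a \<Rightarrow> real) \<in> borel_measurable borel" using A by simp
  from integral_riesz_affine[OF w this s, of y] show ?thesis
    using r e by (simp add: smooth_ind_def)
qed

lemma borel_measurable_smooth_ind:
  assumes A [measurable]: "A \<in> sets borel"
  shows "smooth_ind s A r \<in> borel_measurable borel"
  unfolding smooth_ind_def by measurable

lemma smooth_ind_bounds:
  fixes A :: "'a::euclidean_space set"
  assumes \<alpha>: "0 < \<alpha>" and s: "s = real DIM('a) + \<alpha>" and A [measurable]: "A \<in> sets borel"
  shows "0 \<le> smooth_ind s A r y" "smooth_ind s A r y \<le> (LINT x|lborel. unit_kernel s (x::'a))"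
proof -
  have nn: "0 \<le> unit_kernel s (x::'a)" for x by (rule less_imp_le[OF unit_kernel_pos])
  show "0 \<le> smooth_ind s A r y"
    unfolding smooth_ind_def by (intro integral_nonneg_AE AE_I2 mult_nonneg_nonneg nn) auto
  have i: "integrable lborel (unit_kernel s :: 'a \<Rightarrow> real)" by (rule integrable_unit_kernel[OF \<alpha> s])
  have "integrable lborel (\<lambda>x::'a. unit_kernel s x * indicator A (y + r *\<^sub>R x))"
    by (rule Bochner_Integration.integrable_bound[OF i]) (use nn in \<open>auto simp: indicator_def\<close>)
  then show "smooth_ind s A r y \<le> (LINT x|lborel. unit_kernel s (x::'a))"
    unfolding smooth_ind_def by (intro integral_mono i) (use nn in \<open>auto simp: indicator_def\<close>)
qed

lemma integrable_riesz_indicator: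
  fixes z :: "'a::euclidean_space \<times> 'b::euclidean_space"
  assumes z: "snd z \<noteq> 0" and \<alpha>: "0 < \<alpha>" and s: "s = real DIM('a) + \<alpha>"
    and A [measurable]: "A \<in> sets borel"
  shows "integrable lborel (\<lambda>x. riesz s z x * indicator A x)"
proof -
  note [measurable] = borel_measurable_riesz
  have "integrable lebesgue (\<lambda>x. riesz s z x * 1)"
    by (rule integrable_riesz_bounded[OF z \<alpha> s, where C = 1]) auto
  then have "integrable lborel (riesz s z)"
    using borel_measurable_riesz[of s z] by (simp add: integrable_completion)
  then show ?thesis
    by (rule Bochner_Integration.integrable_bound) (auto simp: indicator_def)
qed

text \<open>For bounded \<open>A\<close> the smoothed indicator decays like the kernel, uniformly in \<open>r \<le> 1\<close>: it is bounded
  near \<open>A\<close>, and away from \<open>A\<close> the kernel is comparable with its value at the origin.\<close>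

lemma smooth_ind_decay:
  fixes A :: "'a::euclidean_space set"
  assumes \<alpha>: "0 < \<alpha>" and s: "s = real DIM('a) + \<alpha>" and A [measurable]: "A \<in> sets borel"
    and \<rho>: "1 \<le> \<rho>" "A \<subseteq> cball 0 \<rho>"
  obtains C where "\<And>r y. 0 < r \<Longrightarrow> r \<le> 1 \<Longrightarrow> smooth_ind s A r y \<le> C * unit_kernel s y"
proof -
  define c where "c = (LINT x|lborel. unit_kernel s (x::'a))"
  define V where "V = measure lborel (cball (0::'a) \<rho>)"
  define C1 where "C1 = c * sqrt ((2 * \<rho>)\<^sup>2 + 1) powr s"
  define C2 where "C2 = V * 4 powr s"
  have s0: "0 < s" using s \<alpha> by simp
  have c: "0 \<le> c" unfolding c_def using integral_unit_kernel_pos[OF \<alpha> s] by simp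
  have V: "0 \<le> V" by (simp add: V_def)
  have kp: "0 < unit_kernel s (y::'a)" for y by (rule unit_kernel_pos)
  have "smooth_ind s A r y \<le> (C1 + C2) * unit_kernel s y" if r: "0 < r" "r \<le> 1" for r y
  proof (cases "norm y \<le> 2 * \<rho>")
    case True
    have sq: "0 < sqrt ((norm y)\<^sup>2 + 1)" by (simp add: add_nonneg_pos)
    have "sqrt ((2 * \<rho>)\<^sup>2 + 1) powr - s \<le> unit_kernel s y"
      unfolding unit_kernel_def using power_mono[OF True, of 2] s0 sq
      by (intro powr_mono2') (auto simp del: power_mult_distrib)
    then have "sqrt ((2 * \<rho>)\<^sup>2 + 1) powr s * sqrt ((2 * \<rho>)\<^sup>2 + 1) powr - s
        \<le> sqrt ((2 * \<rho>)\<^sup>2 + 1) powr s * unit_kernel s y"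
      by (intro mult_left_mono) auto
    moreover have "sqrt ((2 * \<rho>)\<^sup>2 + 1) \<noteq> 0"
      by (metis add_nonneg_pos less_irrefl real_sqrt_eq_zero_cancel_iff zero_le_power2 zero_less_one)
    ultimately have "1 \<le> sqrt ((2 * \<rho>)\<^sup>2 + 1) powr s * unit_kernel s y"
      by (simp add: powr_add[symmetric])
    from mult_left_mono[OF this c] have "c \<le> C1 * unit_kernel s y" by (simp add: C1_def mult.assoc)
    moreover have "smooth_ind s A r y \<le> c"
      unfolding c_def by (rule smooth_ind_bounds[OF \<alpha> s A])
    moreover have "0 \<le> C2 * unit_kernel s y" using V kp[of y] by (simp add: C2_def)
    ultimately show ?thesis by (simp add: distrib_right)
  next
    case False
    let ?e = "r *\<^sub>R (1::real)"
    have w: "?e \<noteq> 0" using r by simp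
    have y1: "1 \<le> norm y" using False \<rho> by simp
    have "riesz s (y, ?e) x * indicator A x \<le> 4 powr s * unit_kernel s y * indicator (cball 0 \<rho>) x" for x
    proof (cases "x \<in> A")
      case True
      then have x: "norm x \<le> \<rho>" "x \<in> cball 0 \<rho>" using \<rho> by auto
      have "sqrt ((norm y)\<^sup>2 + 1) \<le> 2 * norm y"
      proof (rule real_le_lsqrt)
        have "1 \<le> (norm y)\<^sup>2" using y1 by simp
        then show "(norm y)\<^sup>2 + 1 \<le> (2 * norm y)\<^sup>2" by (simp add: power_mult_distrib)
      qed auto
      moreover have "norm y \<le> 2 * norm (y - x)"
        using norm_triangle_ineq2[of y x] x False by simp
      moreover have "norm (y - x) \<le> norm ((y, ?e) - (x, 0))"
        using norm_fst_le_diff_plane[of "(y, ?e)" x] by (simp only: fst_conv)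
      ultimately have "sqrt ((norm y)\<^sup>2 + 1) / 4 \<le> norm ((y, ?e) - (x, 0))" by linarith
      moreover have sq: "0 < sqrt ((norm y)\<^sup>2 + 1)" by (simp add: add_nonneg_pos)
      ultimately have "riesz s (y, ?e) x \<le> (sqrt ((norm y)\<^sup>2 + 1) / 4) powr - s"
        unfolding riesz_def using s0 by (intro powr_mono2') auto
      also have "\<dots> = 4 powr s * unit_kernel s y"
        using sq by (simp only: unit_kernel_def powr_divide powr_minus) (simp add: field_simps)
      finally show ?thesis using x True by simp
    qed (use kp in \<open>simp add: less_imp_le\<close>)
    moreover have "integrable lborel (\<lambda>x. 4 powr s * unit_kernel s y * indicator (cball (0::'a) \<rho>) x)"
      by (intro integrable_mult_right) (auto intro!: integrable_real_indicator emeasure_lborel_cball_finite)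
    moreover have "integrable lborel (\<lambda>x. riesz s (y, ?e) x * indicator A x)"
      using w by (intro integrable_riesz_indicator[OF _ \<alpha> s A]) simp
    ultimately have "(LINT x|lborel. riesz s (y, ?e) x * indicator A x)
        \<le> (LINT x|lborel. 4 powr s * unit_kernel s y * indicator (cball (0::'a) \<rho>) x)"
      by (intro integral_mono) auto
    then have "r powr - \<alpha> * smooth_ind s A r y \<le> C2 * unit_kernel s y"
      using smooth_ind_eq[OF r(1) _ A s, of "1::real" y] by (simp add: C2_def V_def mult_ac)
    then have "r powr \<alpha> * (r powr - \<alpha> * smooth_ind s A r y) \<le> r powr \<alpha> * (C2 * unit_kernel s y)"
      by (intro mult_left_mono) auto
    moreover have "r powr \<alpha> * (r powr - \<alpha> * smooth_ind s A r y) = smooth_ind s A r y"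
      using r by (simp add: mult.assoc[symmetric] powr_add[symmetric])
    moreover have "r powr \<alpha> * (C2 * unit_kernel s y) \<le> 1 * (C2 * unit_kernel s y)"
      using r \<alpha> V kp[of y] by (intro mult_right_mono) (auto simp: C2_def powr_le1)
    moreover have "0 \<le> C1 * unit_kernel s y" using c kp[of y] by (simp add: C1_def)
    ultimately show ?thesis by (simp add: distrib_right)
  qed
  then show ?thesis by (rule that)
qed

lemma smooth_ind_tendsto:
  fixes A :: "'a::euclidean_space set"
  assumes \<alpha>: "0 < \<alpha>" and s: "s = real DIM('a) + \<alpha>" and A [measurable]: "A \<in> sets borel"
    and y: "y \<notin> frontier A"
  shows "(\<lambda>n. smooth_ind s A (1 / real (Suc n)) y) \<longlonglongrightarrow> (LINT x|lborel. unit_kernel s (x::'a)) * indicator A y"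
proof -
  have "(\<lambda>n. smooth_ind s A (1 / real (Suc n)) y) \<longlonglongrightarrow> (LINT x|lborel. unit_kernel s (x::'a) * indicator A y)"
    unfolding smooth_ind_def
  proof (rule integral_dominated_convergence[where w = "unit_kernel s"])
    show "integrable lborel (unit_kernel s :: 'a \<Rightarrow> real)" by (rule integrable_unit_kernel[OF \<alpha> s])
    show "AE x in lborel. norm (unit_kernel s x * indicator A (y + (1 / real (Suc n)) *\<^sub>R x)) \<le> unit_kernel s x" for n
      using less_imp_le[OF unit_kernel_pos[of s]] by (auto simp: indicator_def)
    show "AE x in lborel. (\<lambda>n. unit_kernel s x * indicator A (y + (1 / real (Suc n)) *\<^sub>R x))
        \<longlonglongrightarrow> unit_kernel s x * indicator A y"
    proof (rule AE_I2)
      fix x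
      have "(\<lambda>n. y + (1 / real (Suc n)) *\<^sub>R x) \<longlonglongrightarrow> y + 0 *\<^sub>R x"
        by (intro tendsto_add tendsto_const tendsto_scaleR LIMSEQ_Suc lim_1_over_n)
      then have lim: "(\<lambda>n. y + (1 / real (Suc n)) *\<^sub>R x) \<longlonglongrightarrow> y" by simp
      have "y \<in> interior A \<or> y \<in> - closure A" using y by (auto simp: frontier_def)
      then have "\<forall>\<^sub>F n in sequentially. (indicator A (y + (1 / real (Suc n)) *\<^sub>R x) :: real) = indicator A y"
      proof
        assume i: "y \<in> interior A"
        with topological_tendstoD[OF lim open_interior i] show ?thesis
          using interior_subset[of A] by (auto elim!: eventually_mono simp: indicator_def)
      next
        assume i: "y \<in> - closure A"
        from topological_tendstoD[OF lim open_Compl[OF closed_closure] i] show ?thesis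
          using i closure_subset[of A] by (auto elim!: eventually_mono simp: indicator_def)
      qed
      then show "(\<lambda>n. unit_kernel s x * indicator A (y + (1 / real (Suc n)) *\<^sub>R x))
        \<longlonglongrightarrow> unit_kernel s x * indicator A y"
        by (intro tendsto_mult tendsto_const tendsto_eventually)
    qed
  qed measurable
  then show ?thesis by simp
qed

text \<open>By Lebesgue differentiation along cubes.\<close>

lemma AE_zero_if_box_integrals_zero:
  fixes h :: "'a::euclidean_space \<Rightarrow> real"
  assumes int: "\<And>a b. set_integrable lborel (cbox a b) h"
    and zero: "\<And>a b. (LINT y:cbox a b|lborel. h y) = 0"
  shows "AE y in lebesgue. h y = 0"
proof -
  have I: "integral (cbox a b) h = 0" for a b
    using set_borel_integral_eq_integral(2)[OF int[of a b]] zero[of a b] by simp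
  obtain N where N: "negligible N" and lim: "\<And>x e. \<lbrakk>x \<notin> N; 0 < e\<rbrakk> \<Longrightarrow>
      \<exists>d>0. \<forall>k. 0 < k \<and> k < d \<longrightarrow> norm (integral (cbox x (x + k *\<^sub>R One)) h /\<^sub>R k ^ DIM('a) - h x) < e"
    using integrable_ccontinuous_explicit[of h] set_borel_integral_eq_integral(1)[OF int] by blast
  have "h x = 0" if "x \<notin> N" for x
  proof (rule ccontr)
    assume "h x \<noteq> 0"
    then have "0 < \<bar>h x\<bar>" by simp
    from lim[OF that this] obtain d where d: "0 < d"
      "\<forall>k. 0 < k \<and> k < d \<longrightarrow> norm (integral (cbox x (x + k *\<^sub>R One)) h /\<^sub>R k ^ DIM('a) - h x) < \<bar>h x\<bar>"
      by blast
    from d(2)[rule_format, of "d / 2"] d(1) show False by (simp add: I)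
  qed
  moreover have "AE x in lebesgue. x \<notin> N"
    using N by (simp add: negligible_iff_null_sets AE_not_in)
  ultimately show ?thesis by (auto elim!: eventually_mono)
qed

text \<open>Integration of the vanishing potential of \<open>h\<close> over a box at height \<open>r\<close> gives, by Fubini, the integral
  of \<open>h\<close> against the smoothed indicator of the box, which tends to a multiple of the integral of \<open>h\<close>
  over the box as \<open>r\<close> tends to 0.\<close>

lemma riesz_potential_injective_borel:
  fixes h :: "'a::euclidean_space \<Rightarrow> real"
  assumes \<alpha>: "0 < \<alpha>" and s: "s = real DIM('a) + \<alpha>"
    and h [measurable]: "h \<in> borel_measurable borel"
    and loc: "\<And>a b. set_integrable lborel (cbox a b) h"
    and int: "\<And>z::'a \<times> 'b::euclidean_space. snd z \<noteq> 0 \<Longrightarrow> integrable lborel (\<lambda>y. riesz s z y * h y)"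
    and zero: "\<And>z::'a \<times> 'b. snd z \<noteq> 0 \<Longrightarrow> (LINT y|lborel. riesz s z y * h y) = 0"
  shows "AE y in lebesgue. h y = 0"
proof (rule AE_zero_if_box_integrals_zero[OF loc])
  fix a b :: 'a
  let ?A = "cbox a b"
  define c where "c = (LINT x|lborel. unit_kernel s (x::'a))"
  have s0: "0 < s" using s \<alpha> by simp
  obtain e :: 'b where e: "norm e = 1" using vector_choose_size[of 1] by auto
  then have e0: "e \<noteq> 0" by auto
  obtain \<rho>' where "?A \<subseteq> cball 0 \<rho>'"
    using bounded_cbox[of a b] unfolding bounded_iff by (auto simp: subset_iff)
  then obtain \<rho> where \<rho>: "1 \<le> \<rho>" "?A \<subseteq> cball 0 \<rho>"
    by (meson max.cobounded1 max.cobounded2 order_trans subset_cball)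
  have A: "?A \<in> sets borel" by simp
  note [measurable] = borel_measurable_smooth_ind[OF A, of s]
  have vanish: "(LINT y|lborel. smooth_ind s ?A r y * h y) = 0" if r: "0 < r" for r
  proof -
    let ?w = "r *\<^sub>R e"
    have w: "?w \<noteq> 0" using r e by auto
    let ?F = "\<lambda>y x. riesz s (y, ?w) x * indicator ?A x * h y"
    have Rm: "(\<lambda>p. riesz s (fst p, ?w) (snd p)) \<in> borel_measurable (lborel \<Otimes>\<^sub>M (lborel :: 'a measure))"
    proof -
      have "(\<lambda>p::'a \<times> 'a. norm ((fst p, ?w) - (snd p, 0))) \<in> borel_measurable borel"
        by (intro borel_measurable_continuous_onI continuous_intros)
      then have "(\<lambda>p::'a \<times> 'a. riesz s (fst p, ?w) (snd p)) \<in> borel_measurable borel"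
        unfolding riesz_def by measurable
      then show ?thesis
        by (simp add: measurable_lborel1 cong: measurable_cong_sets) (metis borel_prod lborel_prod measurable_lborel1)
    qed
    have Fm: "(\<lambda>(y, x). ?F y x) \<in> borel_measurable (lborel \<Otimes>\<^sub>M lborel)"
      using Rm unfolding case_prod_beta by measurable
    have iR: "integrable lborel (\<lambda>x. riesz s (y, ?w) x * indicator ?A x)" for y :: 'a
      using w by (intro integrable_riesz_indicator[OF _ \<alpha> s A]) simp
    have F: "integrable (lborel \<Otimes>\<^sub>M lborel) (\<lambda>(y, x). ?F y x)"
    proof (rule lborel_pair.Fubini_integrable[OF Fm])
      show "AE y in lborel. integrable lborel (\<lambda>x. (\<lambda>(y, x). ?F y x) (y, x))"
        using iR by simp
      let ?K = "(1 + \<rho> / norm ?w) powr s"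
      have "(LINT x|lborel. norm (?F y x)) \<le> (?K * measure lborel ?A) * \<bar>riesz s (0, ?w) y * h y\<bar>" for y
      proof -
        have "(LINT x|lborel. norm (?F y x)) \<le> (LINT x|lborel. ?K * \<bar>riesz s (0, ?w) y * h y\<bar> * indicator ?A x)"
        proof (rule integral_mono)
          show "integrable lborel (\<lambda>x. norm (?F y x))" using iR[of y] by simp
          show "integrable lborel (\<lambda>x. ?K * \<bar>riesz s (0, ?w) y * h y\<bar> * indicator ?A x)"
            by (intro integrable_mult_right) (auto intro!: integrable_real_indicator emeasure_lborel_cbox_finite)
          fix x
          show "norm (?F y x) \<le> ?K * \<bar>riesz s (0, ?w) y * h y\<bar> * indicator ?A x"
          proof (cases "x \<in> ?A")
            case True
            then have "norm x \<le> \<rho>" using \<rho>(2) by (simp add: subset_iff)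
            then have "riesz s (y, ?w) x \<le> ?K * riesz s (0, ?w) y"
              using riesz_shift_le[OF w _ less_imp_le[OF s0], of x \<rho> y] by (simp add: riesz_commute)
            from mult_right_mono[OF this, of "\<bar>h y\<bar>"] show ?thesis
              using True by (simp add: abs_mult mult.assoc)
          qed simp
        qed
        also have "\<dots> = (?K * measure lborel ?A) * \<bar>riesz s (0, ?w) y * h y\<bar>"
          by simp
        finally show ?thesis .
      qed
      note le = this
      show "integrable lborel (\<lambda>y. LINT x|lborel. norm ((\<lambda>(y, x). ?F y x) (y, x)))"
      proof (rule Bochner_Integration.integrable_bound)
        show "integrable lborel (\<lambda>y. (?K * measure lborel ?A) * \<bar>riesz s (0, ?w) y * h y\<bar>)"
          using int[of "(0, ?w)"] w by (intro integrable_mult_right integrable_abs) auto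
        show "(\<lambda>y. LINT x|lborel. norm ((\<lambda>(y, x). ?F y x) (y, x))) \<in> borel_measurable lborel"
          using Fm by measurable
        show "AE y in lborel. norm (LINT x|lborel. norm ((\<lambda>(y, x). ?F y x) (y, x)))
           \<le> norm ((?K * measure lborel ?A) * \<bar>riesz s (0, ?w) y * h y\<bar>)"
        proof (rule AE_I2)
          fix y
          have "0 \<le> (LINT x|lborel. norm (?F y x))" by (intro integral_nonneg_AE) auto
          then have "norm (LINT x|lborel. norm (?F y x)) = (LINT x|lborel. norm (?F y x))" by simp
          also note le[of y]
          also have "(?K * measure lborel ?A) * \<bar>riesz s (0, ?w) y * h y\<bar>
             \<le> norm ((?K * measure lborel ?A) * \<bar>riesz s (0, ?w) y * h y\<bar>)"
            unfolding real_norm_def by (rule abs_ge_self)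
          finally show "norm (LINT x|lborel. norm ((\<lambda>(y, x). ?F y x) (y, x)))
           \<le> norm ((?K * measure lborel ?A) * \<bar>riesz s (0, ?w) y * h y\<bar>)" unfolding prod.case .
        qed
      qed
    qed
    have "(LINT y|lborel. LINT x|lborel. ?F y x) = (LINT x|lborel. LINT y|lborel. ?F y x)"
      by (rule lborel_pair.Fubini_integral[OF F, symmetric])
    also have "\<dots> = (LINT x|lborel. indicator ?A x * (LINT y|lborel. riesz s (x, ?w) y * h y))"
      by (intro Bochner_Integration.integral_cong refl)
         (simp add: riesz_commute[of s _ ?w] mult_ac flip: integral_mult_right_zero)
    also have "\<dots> = 0" using zero[of "(_, ?w)"] w by simp
    finally have "(LINT y|lborel. LINT x|lborel. ?F y x) = 0" .
    moreover have "(LINT x|lborel. ?F y x) = r powr - \<alpha> * (smooth_ind s ?A r y * h y)" for y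
      unfolding integral_mult_left_zero smooth_ind_eq[OF r e A s, of y] by (simp only: mult.assoc)
    ultimately have "(LINT y|lborel. r powr - \<alpha> * (smooth_ind s ?A r y * h y)) = 0" by (simp only:)
    then show ?thesis using r by simp
  qed
  obtain C where C: "\<And>r y. 0 < r \<Longrightarrow> r \<le> 1 \<Longrightarrow> smooth_ind s ?A r y \<le> C * unit_kernel s y"
    using smooth_ind_decay[OF \<alpha> s A \<rho>] by blast
  have "(\<lambda>n. LINT y|lborel. smooth_ind s ?A (1 / real (Suc n)) y * h y)
      \<longlonglongrightarrow> (LINT y|lborel. (c * indicator ?A y) * h y)"
  proof (rule integral_dominated_convergence[where w = "\<lambda>y. C * \<bar>unit_kernel s y * h y\<bar>"])
    have "unit_kernel s = (riesz s (0, e) :: 'a \<Rightarrow> real)"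
      using riesz_unit_kernel[OF e, of s "0::'a"] by (simp add: fun_eq_iff)
    then show "integrable lborel (\<lambda>y. C * \<bar>unit_kernel s y * h y\<bar>)"
      using int[of "(0, e)"] e0 by (intro integrable_mult_right integrable_abs) auto
    show "AE y in lborel. norm (smooth_ind s ?A (1 / real (Suc n)) y * h y) \<le> C * \<bar>unit_kernel s y * h y\<bar>" for n
    proof (rule AE_I2)
      fix y
      have "smooth_ind s ?A (1 / real (Suc n)) y \<le> C * unit_kernel s y" by (rule C) auto
      from mult_right_mono[OF this, of "\<bar>h y\<bar>"]
      show "norm (smooth_ind s ?A (1 / real (Suc n)) y * h y) \<le> C * \<bar>unit_kernel s y * h y\<bar>"
        using smooth_ind_bounds(1)[OF \<alpha> s A] less_imp_le[OF unit_kernel_pos[of s y]]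
        by (simp add: abs_mult mult.assoc)
    qed
    have "AE y in lebesgue. y \<notin> frontier ?A"
      by (intro AE_not_in) (simp add: frontier_cbox negligible_iff_null_sets[symmetric] negligible_frontier_interval)
    then have "AE y in lborel. y \<notin> frontier ?A" by (simp add: AE_completion_iff)
    then show "AE y in lborel. (\<lambda>n. smooth_ind s ?A (1 / real (Suc n)) y * h y) \<longlonglongrightarrow> (c * indicator ?A y) * h y"
      unfolding c_def
      by (rule eventually_mono) (intro tendsto_mult tendsto_const smooth_ind_tendsto[OF \<alpha> s A])
  qed measurable
  then have "(LINT y|lborel. (c * indicator ?A y) * h y) = 0"
    using vanish[of "1 / real (Suc _)"] by (simp add: LIMSEQ_const_iff)
  then have "c * (LINT y|lborel. indicator ?A y * h y) = 0" by (simp add: mult.assoc)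
  moreover have "c \<noteq> 0" using integral_unit_kernel_pos[OF \<alpha> s] by (simp add: c_def)
  ultimately show "(LINT y:?A|lborel. h y) = 0" by (simp add: set_lebesgue_integral_def)
qed

lemma riesz_potential_injective:
  fixes h :: "'a::euclidean_space \<Rightarrow> real"
  assumes \<alpha>: "0 < \<alpha>" and s: "s = real DIM('a) + \<alpha>"
    and h: "locally_integrable h"
    and int: "\<And>z::'a \<times> 'b::euclidean_space. snd z \<noteq> 0 \<Longrightarrow> integrable lebesgue (\<lambda>y. riesz s z y * h y)"
    and zero: "\<And>z::'a \<times> 'b. snd z \<noteq> 0 \<Longrightarrow> (LINT y|lebesgue. riesz s z y * h y) = 0"
  shows "AE y in lebesgue. h y = 0"
proof -
  have hm [measurable]: "h \<in> borel_measurable lebesgue" by (rule locally_integrable_measurable[OF h])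
  obtain g where g [measurable]: "g \<in> borel_measurable lborel" and "AE y in lborel. h y = g y"
    using completion_ex_borel_measurable_real[OF hm] by blast
  then have eq: "AE y in lebesgue. h y = g y" by (simp add: AE_completion)
  have gl [measurable]: "g \<in> borel_measurable lebesgue" using g by (simp add: measurable_completion)
  note [measurable] = borel_measurable_riesz
  have "AE y in lebesgue. g y = 0"
  proof (rule riesz_potential_injective_borel[OF \<alpha> s, where 'b = 'b])
    show "g \<in> borel_measurable borel" using g by simp
    show "set_integrable lborel (cbox a b) g" for a b
    proof -
      have "set_integrable lebesgue (cbox a b) h" using h by (simp add: locally_integrable_def)
      moreover have "(\<lambda>y. indicator (cbox a b) y *\<^sub>R g y) \<in> borel_measurable lebesgue"
        by (intro borel_measurable_scaleR borel_measurable_indicator gl) simp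
      ultimately have "integrable lebesgue (\<lambda>y. indicator (cbox a b) y *\<^sub>R g y)"
        unfolding set_integrable_def
        by (subst integrable_cong_AE[where g = "\<lambda>y. indicator (cbox a b) y *\<^sub>R h y"])
           (use eq in \<open>auto elim!: eventually_mono\<close>)
      then show ?thesis unfolding set_integrable_def by (subst (asm) integrable_completion) auto
    qed
    fix z :: "'a \<times> 'b" assume z: "snd z \<noteq> 0"
    have m: "(\<lambda>y. riesz s z y * g y) \<in> borel_measurable lborel" by measurable
    have ae: "AE y in lebesgue. riesz s z y * h y = riesz s z y * g y"
      using eq by eventually_elim simp
    have "integrable lebesgue (\<lambda>y. riesz s z y * g y)"
      using int[OF z] by (subst integrable_cong_AE[symmetric, OF _ _ ae]) auto
    then show "integrable lborel (\<lambda>y. riesz s z y * g y)" using m by (simp add: integrable_completion)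
    have "(LINT y|lebesgue. riesz s z y * g y) = (LINT y|lebesgue. riesz s z y * h y)"
      by (rule integral_cong_AE[symmetric, OF _ _ ae]) auto
    then show "(LINT y|lborel. riesz s z y * g y) = 0"
      using zero[OF z] m by (simp add: integral_completion)
  qed
  with eq show ?thesis by eventually_elim simp
qed

section \<open>Hausdorff measure on a coordinate plane\<close>

lemma ediam_translation: "ediam ((+) v ` U) = ediam (U :: 'a::real_normed_vector set)"
  by (simp add: ediam_def image_image)

lemma hausdorff_weight_translation:
  "hausdorff_weight d ((+) v ` U) = hausdorff_weight d (U :: 'a::real_normed_vector set)"
  by (simp add: hausdorff_weight_def ediam_translation)

lemma hausdorff_outer_translation_le:
  fixes A :: "'a::real_normed_vector set"
  shows "hausdorff_outer d ((+) v ` A) \<le> hausdorff_outer d A"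
  unfolding hausdorff_outer_def
proof (rule SUP_mono)
  fix \<delta> :: real assume \<delta>: "\<delta> \<in> {0<..}"
  have "hausdorff_content d \<delta> ((+) v ` A) \<le> hausdorff_content d \<delta> A"
    unfolding hausdorff_content_def[of d \<delta> A]
  proof (rule INF_greatest)
    fix U :: "nat \<Rightarrow> 'a set" assume "U \<in> {U. A \<subseteq> (\<Union>i. U i) \<and> (\<forall>i. ediam (U i) \<le> ennreal \<delta>)}"
    then have U: "A \<subseteq> (\<Union>i. U i)" "\<And>i. ediam (U i) \<le> ennreal \<delta>" by auto
    have "(+) v ` A \<subseteq> (\<Union>i. (+) v ` U i)" using U(1) by blast
    then have "hausdorff_content d \<delta> ((+) v ` A) \<le> (\<Sum>i. hausdorff_weight d ((+) v ` U i))"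
      unfolding hausdorff_content_def using U(2) by (intro INF_lower) (auto simp: ediam_translation)
    then show "hausdorff_content d \<delta> ((+) v ` A) \<le> (\<Sum>i. hausdorff_weight d (U i))"
      by (simp add: hausdorff_weight_translation)
  qed
  with \<delta> show "\<exists>m\<in>{0<..}. hausdorff_content d \<delta> ((+) v ` A) \<le> hausdorff_content d m A" by blast
qed

lemma hausdorff_outer_translation:
  fixes A :: "'a::real_normed_vector set"
  shows "hausdorff_outer d ((+) v ` A) = hausdorff_outer d A"
proof (rule antisym[OF hausdorff_outer_translation_le])
  have "(+) (- v) ` (+) v ` A = A" by (simp add: image_image)
  then show "hausdorff_outer d A \<le> hausdorff_outer d ((+) v ` A)"
    using hausdorff_outer_translation_le[of d "- v" "(+) v ` A"] by simp
qed

text \<open>A cube is covered by \<open>N ^ d\<close> cubes of side \<open>2 K / N\<close>, whose diameter is at most \<open>d\<close> times their side.\<close>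

lemma hausdorff_outer_cube_finite:
  fixes K :: real
  assumes K: "0 < K"
  shows "hausdorff_outer DIM('a) ({x::'a::euclidean_space. \<forall>b\<in>Basis. - K \<le> x \<bullet> b \<and> x \<bullet> b < K} \<times> {0::'b::euclidean_space})
    \<le> ennreal (unit_ball_vol (real DIM('a)) * (real DIM('a) * K) ^ DIM('a))"
    (is "hausdorff_outer ?d ?S \<le> ennreal ?B")
  unfolding hausdorff_outer_def
proof (rule SUP_least)
  fix \<delta> :: real assume "\<delta> \<in> {0<..}"
  then have \<delta>: "0 < \<delta>" by simp
  obtain N :: nat where N: "real ?d * (2 * K) / \<delta> < real N" using reals_Archimedean2 by blast
  have dK: "0 < real ?d * (2 * K)" using K by simp
  then have "0 < real ?d * (2 * K) / \<delta>" using \<delta> by (intro divide_pos_pos)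
  then have N0: "0 < real N" using N by linarith
  define h where "h = 2 * K / real N"
  have h: "0 < h" using K N0 by (simp add: h_def)
  have h\<delta>: "real ?d * h \<le> \<delta>" using N \<delta> N0 by (simp add: h_def field_simps)
  define I where "I = (PiE (Basis::'a set) (\<lambda>_. {..<N}))"
  have finI: "finite I" unfolding I_def by (intro finite_PiE) auto
  have cardI: "card I = N ^ ?d" unfolding I_def by (simp add: card_PiE)
  define Q where "Q v = {x::'a. \<forall>b\<in>Basis. - K + h * real (v b) \<le> x \<bullet> b \<and> x \<bullet> b \<le> - K + h * (real (v b) + 1)} \<times> {0::'b}" for v
  have diamQ: "ediam (Q v) \<le> ennreal (real ?d * h)" for v
    unfolding ediam_def
  proof (intro SUP_least ennreal_leI)
    fix p q assume pq: "p \<in> Q v" "q \<in> Q v"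
    then obtain x y where p: "p = (x, 0)" and q: "q = (y, 0)" by (auto simp: Q_def)
    have "dist p q = norm (x - y)" by (simp add: p q dist_norm norm_Pair)
    also have "\<dots> \<le> (\<Sum>b\<in>Basis. \<bar>(x - y) \<bullet> b\<bar>)" by (rule norm_le_l1)
    also have "\<dots> \<le> (\<Sum>b\<in>(Basis::'a set). h)"
    proof (rule sum_mono)
      fix b :: 'a assume b: "b \<in> Basis"
      have "- K + h * real (v b) \<le> x \<bullet> b" "x \<bullet> b \<le> - K + h * (real (v b) + 1)"
        "- K + h * real (v b) \<le> y \<bullet> b" "y \<bullet> b \<le> - K + h * (real (v b) + 1)"
        using pq b by (auto simp: Q_def p q)
      then show "\<bar>(x - y) \<bullet> b\<bar> \<le> h" by (simp add: inner_diff_left abs_le_iff algebra_simps)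
    qed
    finally show "dist p q \<le> real ?d * h" by simp
  qed
  obtain g where g: "bij_betw g {0..<card I} I" using ex_bij_betw_nat_finite[OF finI] by blast
  define U where "U j = (if j < card I then Q (g j) else {})" for j
  have "?S \<subseteq> (\<Union>j. U j)"
  proof
    fix p assume "p \<in> ?S"
    then obtain x where p: "p = (x, 0)" and x: "\<And>b. b \<in> Basis \<Longrightarrow> - K \<le> x \<bullet> b" "\<And>b. b \<in> Basis \<Longrightarrow> x \<bullet> b < K"
      by auto
    define v where "v = (\<lambda>b\<in>Basis. nat \<lfloor>(x \<bullet> b + K) / h\<rfloor>)"
    have vb: "v b < N" "- K + h * real (v b) \<le> x \<bullet> b" "x \<bullet> b \<le> - K + h * (real (v b) + 1)" if b: "b \<in> Basis" for b
    proof -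
      have nn: "0 \<le> (x \<bullet> b + K) / h" using x(1)[OF b] h by simp
      have rv: "real (v b) = of_int \<lfloor>(x \<bullet> b + K) / h\<rfloor>" using b nn by (simp add: v_def)
      have 1: "real (v b) \<le> (x \<bullet> b + K) / h" unfolding rv by (rule of_int_floor_le)
      have 2: "(x \<bullet> b + K) / h < real (v b) + 1" unfolding rv by (rule floor_correct[THEN conjunct2, simplified])
      have "(x \<bullet> b + K) / h < real N"
        using x(2)[OF b] h N0 by (simp add: h_def field_simps)
      then show "v b < N" using 1 by linarith
      show "- K + h * real (v b) \<le> x \<bullet> b" using 1 h by (simp add: field_simps)
      show "x \<bullet> b \<le> - K + h * (real (v b) + 1)" using 2 h by (simp add: field_simps)
    qed
    have "v \<in> I" unfolding I_def using vb(1) by (auto simp: v_def)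
    then have "v \<in> g ` {0..<card I}" using g by (simp add: bij_betw_def)
    then obtain j where "j < card I" "g j = v" by auto
    then have "p \<in> U j" using vb by (auto simp: U_def Q_def p)
    then show "p \<in> (\<Union>j. U j)" by blast
  qed
  moreover have "ediam (U j) \<le> ennreal \<delta>" for j
    using order_trans[OF diamQ ennreal_leI[OF h\<delta>]] by (simp add: U_def)
  ultimately have "hausdorff_content ?d \<delta> ?S \<le> (\<Sum>j. hausdorff_weight ?d (U j))"
    unfolding hausdorff_content_def by (intro INF_lower) auto
  also have "\<dots> = (\<Sum>j\<in>{..<card I}. hausdorff_weight ?d (U j))"
    by (rule suminf_finite) (auto simp: U_def hausdorff_weight_def)
  also have "\<dots> \<le> (\<Sum>j\<in>{..<card I}. ennreal (unit_ball_vol (real ?d) * (real ?d * h / 2) ^ ?d))"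
  proof (rule sum_mono)
    fix j assume j: "j \<in> {..<card I}"
    have "hausdorff_weight ?d (U j) \<le> ennreal (unit_ball_vol (real ?d)) * (ediam (U j) / 2) ^ ?d"
      by (simp add: hausdorff_weight_def)
    also have "\<dots> \<le> ennreal (unit_ball_vol (real ?d)) * (ennreal (real ?d * h) / 2) ^ ?d"
      using diamQ j by (intro mult_left_mono power_mono divide_right_mono_ennreal) (auto simp: U_def)
    also have "ennreal (real ?d * h) / 2 = ennreal (real ?d * h / 2)"
      using h by (simp add: divide_ennreal flip: ennreal_numeral)
    also have "ennreal (unit_ball_vol (real ?d)) * ennreal (real ?d * h / 2) ^ ?d
        = ennreal (unit_ball_vol (real ?d) * (real ?d * h / 2) ^ ?d)"
      using h by (simp add: ennreal_power ennreal_mult)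
    finally show "hausdorff_weight ?d (U j) \<le> ennreal (unit_ball_vol (real ?d) * (real ?d * h / 2) ^ ?d)" .
  qed
  also have "\<dots> = ennreal (real (card I) * (unit_ball_vol (real ?d) * (real ?d * h / 2) ^ ?d))"
    by (simp add: ennreal_mult' ennreal_of_nat_eq_real_of_nat)
  also have "real (card I) * (unit_ball_vol (real ?d) * (real ?d * h / 2) ^ ?d) = ?B"
  proof -
    have "real N * (real ?d * h / 2) = real ?d * K" using N0 by (simp add: h_def)
    then have "real N ^ ?d * (real ?d * h / 2) ^ ?d = (real ?d * K) ^ ?d"
      by (metis power_mult_distrib)
    then show ?thesis unfolding cardI by (simp only: of_nat_power mult_ac)
  qed
  finally show "hausdorff_content ?d \<delta> ?S \<le> ennreal ?B" .
qed

text \<open>Uniqueness of Haar measure in the special case needed: for the unit cube \<open>B\<close>, Fubini and the two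
  invariances turn the integral of \<open>1\<^sub>A (x + y) 1\<^sub>B y\<close> into \<open>m A\<close> on the one hand and \<open>m (- B)\<close> times the Lebesgue
  measure of \<open>A\<close> on the other.\<close>

lemma translation_invariant_measure:
  fixes m :: "'a::euclidean_space measure"
  assumes sets [measurable_cong]: "sets m = sets borel"
    and inv: "\<And>t. distr m borel ((+) t) = m"
    and fin: "\<And>K. 0 < K \<Longrightarrow> emeasure m {x. \<forall>b\<in>Basis. - K \<le> x \<bullet> b \<and> x \<bullet> b < K} < \<infinity>"
  obtains c where "0 \<le> c" "m = density lborel (\<lambda>_. ennreal c)"
proof -
  have sp: "space m = UNIV" using sets_eq_imp_space_eq[OF sets] by simp
  let ?C = "\<lambda>K::real. {x::'a. \<forall>b\<in>Basis. - K \<le> x \<bullet> b \<and> x \<bullet> b < K}"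
  have C [measurable]: "?C K \<in> sets borel" for K by measurable
  have Cabs: "x \<in> ?C K" if "norm x < K" for x K
  proof -
    have "- K \<le> x \<bullet> b \<and> x \<bullet> b < K" if "b \<in> Basis" for b
      using Basis_le_norm[OF that, of x] \<open>norm x < K\<close> by linarith
    then show ?thesis by blast
  qed
  interpret m: sigma_finite_measure m
  proof
    show "\<exists>A. countable A \<and> A \<subseteq> sets m \<and> \<Union> A = space m \<and> (\<forall>a\<in>A. emeasure m a \<noteq> \<infinity>)"
    proof (intro exI conjI ballI)
      let ?A = "range (\<lambda>n::nat. ?C (real (Suc n)))"
      show "countable ?A" by simp
      show "?A \<subseteq> sets m" unfolding sets using C by blast
      have "x \<in> \<Union> ?A" for x
      proof -
        obtain n :: nat where "norm x < real n" using reals_Archimedean2 by blast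
        then have "x \<in> ?C (real (Suc n))" by (intro Cabs) simp
        then show ?thesis by blast
      qed
      then show "\<Union> ?A = space m" unfolding sp by blast
      fix a assume "a \<in> ?A"
      then obtain n :: nat where "a = ?C (real (Suc n))" by blast
      then show "emeasure m a \<noteq> \<infinity>" using fin[of "real (Suc n)"] by simp
    qed
  qed
  interpret P: pair_sigma_finite lborel m ..
  have tr: "(\<integral>\<^sup>+x. f (t + x) \<partial>m) = (\<integral>\<^sup>+x. f x \<partial>m)" if [measurable]: "f \<in> borel_measurable borel" for f t
  proof -
    have "(\<integral>\<^sup>+x. f x \<partial>m) = (\<integral>\<^sup>+x. f x \<partial>distr m borel ((+) t))" by (simp add: inv)
    also have "\<dots> = (\<integral>\<^sup>+x. f (t + x) \<partial>m)" by (rule nn_integral_distr) measurable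
    finally show ?thesis by simp
  qed
  have trl: "(\<integral>\<^sup>+x. f (t + x) \<partial>lborel) = (\<integral>\<^sup>+x. f x \<partial>lborel)" if [measurable]: "f \<in> borel_measurable borel" for f and t :: 'a
  proof -
    have "(\<integral>\<^sup>+x. f x \<partial>lborel) = (\<integral>\<^sup>+x. f x \<partial>distr lborel borel ((+) t))" by (simp add: lborel_distr_plus)
    also have "\<dots> = (\<integral>\<^sup>+x. f (t + x) \<partial>lborel)" by (rule nn_integral_distr) measurable
    finally show ?thesis by simp
  qed
  let ?B = "cbox (0::'a) One"
  \<comment> \<open>the measure of the reflected unit cube\<close>
  define q where "q = (\<integral>\<^sup>+x. indicator ?B (- x) \<partial>m)"
  have key: "emeasure m A = q * emeasure lborel A" if A [measurable]: "A \<in> sets borel" for A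
  proof -
    have "emeasure m A = (\<integral>\<^sup>+y. indicator ?B y * emeasure m A \<partial>lborel)"
      by (subst nn_integral_multc) (auto simp: emeasure_lborel_cbox_eq)
    also have "\<dots> = (\<integral>\<^sup>+y. indicator ?B y * (\<integral>\<^sup>+x. indicator A (y + x) \<partial>m) \<partial>lborel)"
      using A sets by (subst tr[of "indicator A"]) auto
    also have "\<dots> = (\<integral>\<^sup>+y. (\<integral>\<^sup>+x. indicator ?B y * indicator A (y + x) \<partial>m) \<partial>lborel)"
      by (intro nn_integral_cong nn_integral_cmult[symmetric]) measurable
    also have "\<dots> = (\<integral>\<^sup>+x. (\<integral>\<^sup>+y. indicator ?B y * indicator A (y + x) \<partial>lborel) \<partial>m)"
      by (rule P.Fubini'[symmetric]) measurable
    also have "\<dots> = (\<integral>\<^sup>+x. (\<integral>\<^sup>+y. indicator ?B (y - x) * indicator A y \<partial>lborel) \<partial>m)"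
    proof (rule nn_integral_cong)
      fix x
      have "(\<integral>\<^sup>+y. indicator ?B (x + y - x) * indicator A (x + y) \<partial>lborel)
         = (\<integral>\<^sup>+y. indicator ?B (y - x) * indicator A y \<partial>lborel)"
        by (rule trl) measurable
      then show "(\<integral>\<^sup>+y. indicator ?B y * indicator A (y + x) \<partial>lborel)
         = (\<integral>\<^sup>+y. indicator ?B (y - x) * indicator A y \<partial>lborel)"
        by (simp add: add.commute)
    qed
    also have "\<dots> = (\<integral>\<^sup>+y. (\<integral>\<^sup>+x. indicator ?B (y - x) * indicator A y \<partial>m) \<partial>lborel)"
      by (rule P.Fubini') measurable
    also have "\<dots> = (\<integral>\<^sup>+y. (\<integral>\<^sup>+x. indicator ?B (y - x) \<partial>m) * indicator A y \<partial>lborel)"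
      by (intro nn_integral_cong nn_integral_multc) measurable
    also have "\<dots> = (\<integral>\<^sup>+y. q * indicator A y \<partial>lborel)"
    proof (rule nn_integral_cong)
      fix y
      have "(\<integral>\<^sup>+x. indicator ?B (y - (y + x)) \<partial>m) = (\<integral>\<^sup>+x. indicator ?B (y - x) \<partial>m)"
        by (rule tr) measurable
      then show "(\<integral>\<^sup>+x. indicator ?B (y - x) \<partial>m) * indicator A y = q * indicator A y"
        by (simp add: q_def)
    qed
    also have "\<dots> = q * emeasure lborel A" by (rule nn_integral_cmult_indicator) simp
    finally show ?thesis .
  qed
  have "q < top"
  proof -
    have "q = emeasure m ?B" using key[of ?B] by (simp add: emeasure_lborel_cbox_eq)
    also have "\<dots> \<le> emeasure m (?C 2)"
    proof (rule emeasure_mono)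
      show "?B \<subseteq> ?C 2" by (fastforce simp: mem_box)
    qed (use C sets in auto)
    also have "\<dots> < top" using fin[of 2] by simp
    finally show ?thesis .
  qed
  then obtain c where c: "0 \<le> c" "q = ennreal c" by (cases q) auto
  have "m = density lborel (\<lambda>_. ennreal c)"
  proof (rule measure_eqI)
    show "sets m = sets (density lborel (\<lambda>_. ennreal c))" using sets by simp
    fix A assume "A \<in> sets m"
    then have A: "A \<in> sets borel" using sets by simp
    then show "emeasure m A = emeasure (density lborel (\<lambda>_. ennreal c)) A"
      using key[OF A] c by (simp add: emeasure_density nn_integral_cmult_indicator)
  qed
  with c that show ?thesis by blast
qed

lemma emeasure_hausdorff_on:
  assumes "closed E" "A \<in> sets borel"
  shows "emeasure (hausdorff_on d E) A = hausdorff_outer d (E \<inter> A)"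
proof -
  have E: "E \<in> sets borel" using assms(1) by (rule borel_closed)
  have "emeasure (hausdorff_on d E) A = (\<integral>\<^sup>+x\<in>A. indicator E x \<partial>hausdorff_measure d)"
    unfolding hausdorff_on_def using E assms(2)
    by (intro emeasure_density) (auto intro!: borel_measurable_indicator)
  also have "\<dots> = (\<integral>\<^sup>+x. indicator (E \<inter> A) x \<partial>hausdorff_measure d)"
    by (intro nn_integral_cong) (simp split: split_indicator)
  also have "\<dots> = emeasure (hausdorff_measure d) (E \<inter> A)"
    using E assms(2) by (intro nn_integral_indicator) auto
  also have "\<dots> = hausdorff_outer d (E \<inter> A)"
    using E assms(2) by (intro emeasure_hausdorff_measure) auto
  finally show ?thesis .
qed

lemma sets_hausdorff_on [simp]: "sets (hausdorff_on d E) = sets borel"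
  by (simp add: hausdorff_on_def)

lemma closed_plane: "closed (UNIV \<times> {0::'b::euclidean_space} :: ('a::euclidean_space \<times> 'b) set)"
  by (intro closed_Times) auto

lemma measurable_plane_embedding [measurable]:
  "(\<lambda>y::'a::euclidean_space. (y, 0::'b::euclidean_space)) \<in> borel \<rightarrow>\<^sub>M borel"
  by (intro borel_measurable_continuous_onI continuous_intros)

text \<open>Hausdorff measure on the plane is a multiple of Lebesgue measure. The value of the constant
  is irrelevant below, since it rescales the potential and leaves the equation invariant; so no
  isodiametric inequality is needed, and positivity follows from the measure being nonzero.\<close>

lemma hausdorff_on_plane:
  assumes nz: "emeasure (hausdorff_on DIM('a) (UNIV \<times> {0} :: ('a::euclidean_space \<times> 'b::euclidean_space) set)) UNIV \<noteq> 0"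
  obtains c where "0 < c"
    "hausdorff_on DIM('a) (UNIV \<times> {0} :: ('a \<times> 'b) set)
       = distr (density lborel (\<lambda>_. ennreal c)) borel (\<lambda>y. (y, 0))"
proof -
  let ?E = "UNIV \<times> {0} :: ('a \<times> 'b) set"
  let ?H = "hausdorff_on DIM('a) ?E"
  have fstm [measurable]: "fst \<in> ?H \<rightarrow>\<^sub>M (borel :: 'a measure)"
    by (subst measurable_cong_sets[OF sets_hausdorff_on refl])
       (intro borel_measurable_continuous_onI continuous_intros)
  define m where "m = distr ?H borel (fst :: 'a \<times> 'b \<Rightarrow> 'a)"
  have spH: "space ?H = UNIV" by (simp add: hausdorff_on_def)
  have m: "emeasure m A = hausdorff_outer DIM('a) (A \<times> {0::'b})" if A: "A \<in> sets borel" for A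
  proof -
    have "fst -` A \<in> sets (borel :: ('a \<times> 'b) measure)"
      using measurable_sets[OF fstm A] by (simp add: spH)
    moreover have "?E \<inter> fst -` A = A \<times> {0}" by auto
    ultimately show ?thesis
      using A by (simp add: m_def emeasure_distr spH emeasure_hausdorff_on[OF closed_plane])
  qed
  have sm: "sets m = sets borel" by (simp add: m_def)
  have spm: "space m = UNIV" by (simp add: m_def)
  obtain c where c: "0 \<le> c" "m = density lborel (\<lambda>_. ennreal c)"
  proof (rule translation_invariant_measure[OF sm])
    fix t :: 'a
    show "distr m borel ((+) t) = m"
    proof (rule measure_eqI)
      show "sets (distr m borel ((+) t)) = sets m" by (simp add: sm)
      fix A assume "A \<in> sets (distr m borel ((+) t))"
      then have A: "A \<in> sets borel" by simp
      have tm: "(+) t \<in> m \<rightarrow>\<^sub>M borel"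
        by (subst measurable_cong_sets[OF sm refl]) (intro borel_measurable_continuous_onI continuous_intros)
      have pre: "(+) t -` A \<in> sets borel" using measurable_sets[OF tm A] by (simp add: spm sm)
      have "emeasure (distr m borel ((+) t)) A = hausdorff_outer DIM('a) (((+) t -` A) \<times> {0::'b})"
        using emeasure_distr[OF tm A] m[OF pre] by (simp add: spm)
      also have "\<dots> = hausdorff_outer DIM('a) ((+) (t, 0) ` (((+) t -` A) \<times> {0::'b}))"
        by (rule hausdorff_outer_translation[symmetric])
      also have "(+) (t, 0) ` (((+) t -` A) \<times> {0::'b}) = A \<times> {0}"
      proof (intro set_eqI iffI)
        fix p assume "p \<in> A \<times> {0::'b}"
        then have "p = (t, 0) + (fst p - t, 0)" "fst p - t \<in> (+) t -` A" by (auto simp: prod_eq_iff)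
        then show "p \<in> (+) (t, 0) ` (((+) t -` A) \<times> {0::'b})" by blast
      qed auto
      also have "hausdorff_outer DIM('a) (A \<times> {0::'b}) = emeasure m A" by (rule m[OF A, symmetric])
      finally show "emeasure (distr m borel ((+) t)) A = emeasure m A" .
    qed
  next
    fix K :: real assume K: "0 < K"
    have "{x::'a. \<forall>b\<in>Basis. - K \<le> x \<bullet> b \<and> x \<bullet> b < K} \<in> sets borel" by measurable
    from m[OF this] hausdorff_outer_cube_finite[OF K, where 'a = 'a and 'b = 'b]
    show "emeasure m {x. \<forall>b\<in>Basis. - K \<le> x \<bullet> b \<and> x \<bullet> b < K} < \<infinity>"
      by (simp add: order_le_less_trans[OF _ ennreal_less_top])
  qed
  have H: "?H = distr m borel (\<lambda>y. (y, 0))"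
  proof (rule measure_eqI)
    show "sets ?H = sets (distr m borel (\<lambda>y. (y, 0::'b)))" by simp
    fix A assume "A \<in> sets ?H"
    then have A: "A \<in> sets borel" by simp
    have em: "(\<lambda>y::'a. (y, 0::'b)) \<in> m \<rightarrow>\<^sub>M borel"
      by (subst measurable_cong_sets[OF sm refl]) (rule measurable_plane_embedding)
    have pre: "(\<lambda>y::'a. (y, 0::'b)) -` A \<in> sets borel" using measurable_sets[OF em A] by (simp add: spm sm)
    have "((\<lambda>y::'a. (y, 0::'b)) -` A) \<times> {0} = ?E \<inter> A" by auto
    then show "emeasure ?H A = emeasure (distr m borel (\<lambda>y. (y, 0::'b))) A"
      using emeasure_distr[OF em A] m[OF pre] emeasure_hausdorff_on[OF closed_plane A] by (simp add: spm)
  qed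
  have "c \<noteq> 0"
  proof
    assume "c = 0"
    then have "emeasure m UNIV = 0" unfolding c(2) by (subst emeasure_density) auto
    moreover have "emeasure ?H UNIV = emeasure m UNIV"
      unfolding m_def by (subst emeasure_distr[OF fstm]) (auto simp: spH)
    ultimately show False using nz by simp
  qed
  with c H that show ?thesis by (metis order_le_less)
qed

text \<open>Integrals against a measure with a density on the plane, as Lebesgue integrals. As the density is
  only measurable for the completion, a Borel representative is used in the proof.\<close>

lemma integral_has_density_plane:
  fixes \<mu> :: "('a::euclidean_space \<times> 'b::euclidean_space) measure" and \<phi> :: "'a \<Rightarrow> real"
  assumes dens: "has_density \<mu> (hausdorff_on DIM('a) (UNIV \<times> {0})) (\<lambda>z. 1 + \<phi> (fst z))"
    and H: "hausdorff_on DIM('a) (UNIV \<times> {0} :: ('a \<times> 'b) set)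
       = distr (density lborel (\<lambda>_. ennreal c)) borel (\<lambda>y. (y, 0))"
    and c: "0 < c" and \<phi>: "\<phi> \<in> borel_measurable lebesgue"
  shows "AE y in lebesgue. 0 \<le> 1 + \<phi> y"
    and "\<And>g. g \<in> borel_measurable borel \<Longrightarrow>
       (LINT z:UNIV \<times> {0}|\<mu>. g z) = c * (LINT y|lebesgue. g (y, 0) * (1 + \<phi> y))"
    and "AE y in lebesgue. 1 + \<phi> y = 0 \<Longrightarrow> emeasure \<mu> UNIV = 0"
proof -
  let ?\<nu> = "distr (density lborel (\<lambda>_. ennreal c)) borel (\<lambda>y::'a. (y, 0::'b))"
  let ?D = "density lborel (\<lambda>_::'a. ennreal c)"
  have em [measurable]: "(\<lambda>y::'a. (y, 0::'b)) \<in> ?D \<rightarrow>\<^sub>M borel"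
    by (subst measurable_cong_sets[OF sets_density refl])
       (simp add: measurable_plane_embedding cong: measurable_cong_sets)
  have dens': "AE z in completion ?\<nu>. 0 \<le> 1 + \<phi> (fst z)" "sets \<mu> = sets borel"
    "\<And>A. A \<in> sets borel \<Longrightarrow> emeasure \<mu> A = (\<integral>\<^sup>+z\<in>A. ennreal (1 + \<phi> (fst z)) \<partial>completion ?\<nu>)"
    using dens unfolding has_density_def H by auto
  obtain \<phi>' where \<phi>' [measurable]: "\<phi>' \<in> borel_measurable lborel" and ae: "AE y in lborel. \<phi> y = \<phi>' y"
    using completion_ex_borel_measurable_real[OF \<phi>] by blast
  have fb [measurable]: "fst \<in> borel_measurable (borel :: ('a \<times> 'b) measure)"
    by (intro borel_measurable_continuous_onI continuous_intros)
  have \<phi>b [measurable]: "\<phi>' \<in> borel_measurable borel" using \<phi>' by simp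
  have pb [measurable]: "(\<lambda>z::'a \<times> 'b. \<phi>' (fst z)) \<in> borel_measurable borel"
    by (rule measurable_compose[OF fb \<phi>b])
  have transfer: "AE z in ?\<nu>. Q (fst z)" if Q: "AE y in lborel. Q y" for Q
  proof -
    obtain N where N: "{y. \<not> Q y} \<subseteq> N" "N \<in> null_sets lborel"
      using Q by (auto simp: eventually_ae_filter)
    then have Nb [measurable]: "N \<in> sets borel" by (auto simp: null_sets_def)
    have "AE y in lborel. y \<notin> N" using N(2) by (rule AE_not_in)
    then have "AE y in ?D. y \<notin> N" by (subst AE_density) auto
    then have "AE z in ?\<nu>. fst z \<notin> N"
      by (subst AE_distr_iff[OF em]) (auto simp: measurable_sets_borel[OF fb])
    then show ?thesis using N(1) by (auto elim!: eventually_mono)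
  qed
  have eq\<nu>: "AE z in completion ?\<nu>. \<phi> (fst z) = \<phi>' (fst z)"
    by (rule AE_completion[OF transfer[OF ae]])
  have pos: "AE z in ?\<nu>. 0 \<le> 1 + \<phi>' (fst z)"
  proof -
    have "AE z in completion ?\<nu>. 0 \<le> 1 + \<phi>' (fst z)"
      using dens'(1) eq\<nu> by eventually_elim simp
    then show ?thesis by (simp add: AE_completion_iff)
  qed
  have pos': "AE y in lborel. 0 \<le> 1 + \<phi>' y"
  proof -
    have "AE y in ?D. 0 \<le> 1 + \<phi>' (fst (y, 0::'b))"
      using pos by (subst (asm) AE_distr_iff[OF em]) auto
    then show ?thesis using c by (subst (asm) AE_density) auto
  qed
  have \<mu>: "\<mu> = density ?\<nu> (\<lambda>z. ennreal (1 + \<phi>' (fst z)))"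
  proof (rule measure_eqI)
    show "sets \<mu> = sets (density ?\<nu> (\<lambda>z. ennreal (1 + \<phi>' (fst z))))" using dens'(2) by simp
    fix A assume "A \<in> sets \<mu>"
    then have A: "A \<in> sets borel" using dens'(2) by simp
    have "emeasure \<mu> A = (\<integral>\<^sup>+z\<in>A. ennreal (1 + \<phi>' (fst z)) \<partial>completion ?\<nu>)"
      unfolding dens'(3)[OF A] by (intro nn_integral_cong_AE) (use eq\<nu> in \<open>auto elim!: eventually_mono\<close>)
    also have "\<dots> = (\<integral>\<^sup>+z\<in>A. ennreal (1 + \<phi>' (fst z)) \<partial>?\<nu>)"
      by (rule nn_integral_completion)
    also have "\<dots> = emeasure (density ?\<nu> (\<lambda>z. ennreal (1 + \<phi>' (fst z)))) A"
      using A by (subst emeasure_density) auto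
    finally show "emeasure \<mu> A = emeasure (density ?\<nu> (\<lambda>z. ennreal (1 + \<phi>' (fst z)))) A" .
  qed
  have aeL: "AE y in lebesgue. \<phi> y = \<phi>' y" by (rule AE_completion[OF ae])
  show "AE y in lebesgue. 0 \<le> 1 + \<phi> y"
    using aeL AE_completion[OF pos'] by eventually_elim simp
  show "(LINT z:UNIV \<times> {0}|\<mu>. g z) = c * (LINT y|lebesgue. g (y, 0) * (1 + \<phi> y))"
    if g [measurable]: "g \<in> borel_measurable borel" for g
  proof -
    have E: "UNIV \<times> {0} \<in> sets (borel :: ('a \<times> 'b) measure)" by (rule borel_closed[OF closed_plane])
    have g1 [measurable]: "(\<lambda>z. indicator (UNIV \<times> {0}) z *\<^sub>R g z) \<in> borel_measurable borel"
      by (intro borel_measurable_scaleR borel_measurable_indicator E g)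
    have g2 [measurable]: "(\<lambda>y. g (y, 0)) \<in> borel_measurable borel"
      by (rule measurable_compose[OF measurable_plane_embedding g])
    have "(LINT z:UNIV \<times> {0}|\<mu>. g z)
        = (LINT z|?\<nu>. (1 + \<phi>' (fst z)) *\<^sub>R (indicator (UNIV \<times> {0}) z *\<^sub>R g z))"
      unfolding set_lebesgue_integral_def \<mu> by (rule integral_density) (use pos g1 pb in simp_all)
    also have "\<dots> = (LINT y|?D. (1 + \<phi>' (fst (y, 0::'b))) *\<^sub>R (indicator (UNIV \<times> {0}) (y, 0::'b) *\<^sub>R g (y, 0)))"
      by (rule integral_distr[OF em]) measurable
    also have "\<dots> = (LINT y|?D. g (y, 0) * (1 + \<phi>' y))"
      by (intro Bochner_Integration.integral_cong refl) simp
    also have "\<dots> = (LINT y|lborel. c *\<^sub>R (g (y, 0) * (1 + \<phi>' y)))"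
      using c by (intro integral_density) auto
    also have "\<dots> = c * (LINT y|lborel. g (y, 0) * (1 + \<phi>' y))" by simp
    also have "(LINT y|lborel. g (y, 0) * (1 + \<phi>' y)) = (LINT y|lebesgue. g (y, 0) * (1 + \<phi>' y))"
      by (rule integral_completion[symmetric]) measurable
    also have "\<dots> = (LINT y|lebesgue. g (y, 0) * (1 + \<phi> y))"
    proof (rule integral_cong_AE)
      have g2l: "(\<lambda>y. g (y, 0)) \<in> borel_measurable lebesgue" using g2 by (simp add: measurable_completion)
      have "\<phi>' \<in> borel_measurable lebesgue" using \<phi>' by (simp add: measurable_completion)
      with g2l show "(\<lambda>y. g (y, 0) * (1 + \<phi>' y)) \<in> borel_measurable lebesgue" by simp
      show "(\<lambda>y. g (y, 0) * (1 + \<phi> y)) \<in> borel_measurable lebesgue" using g2l \<phi> by simp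
      show "AE y in lebesgue. g (y, 0) * (1 + \<phi>' y) = g (y, 0) * (1 + \<phi> y)"
        using aeL by eventually_elim simp
    qed
    finally show ?thesis .
  qed
  show "emeasure \<mu> UNIV = 0" if "AE y in lebesgue. 1 + \<phi> y = 0"
  proof -
    have "AE y in lebesgue. 1 + \<phi>' y = 0" using that aeL by eventually_elim simp
    then have "AE y in lborel. 1 + \<phi>' y = 0" by (simp add: AE_completion_iff)
    then have "AE z in ?\<nu>. 1 + \<phi>' (fst z) = 0" by (rule transfer)
    then have "(\<integral>\<^sup>+z. ennreal (1 + \<phi>' (fst z)) * indicator UNIV z \<partial>?\<nu>) = 0"
      by (subst nn_integral_0_iff_AE) (auto elim!: eventually_mono)
    then show ?thesis unfolding \<mu> by (subst emeasure_density) auto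
  qed
qed

section \<open>Linearization at the flat solution\<close>

lemma riesz_norm_snd: "norm w = norm w' \<Longrightarrow> riesz s (x, w) y = riesz s (x, w') y"
  unfolding riesz_def norm_diff_plane by simp

lemma riesz_potential_bounded_density:
  assumes \<alpha>: "0 < \<alpha>" and s: "s = real DIM('a::euclidean_space) + \<alpha>" and \<phi>: "ess_bounded \<phi>"
  shows "riesz_potential TYPE('b::euclidean_space) (\<lambda>y::'a. 1 + \<phi> y) s"
    and "\<And>z::'a \<times> 'b. snd z \<noteq> 0 \<Longrightarrow> integrable lebesgue (\<lambda>y. riesz s z y * \<phi> y)"
proof -
  obtain C where C: "AE y in lebesgue. \<bar>\<phi> y\<bar> \<le> C" and m [measurable]: "\<phi> \<in> borel_measurable lebesgue"
    using \<phi> by (auto simp: ess_bounded_def)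
  show i: "integrable lebesgue (\<lambda>y. riesz s z y * \<phi> y)" if "snd z \<noteq> 0" for z :: "'a \<times> 'b"
    by (rule integrable_riesz_bounded[OF that \<alpha> s m C])
  have "AE y in lebesgue. \<bar>1 + \<phi> y\<bar> \<le> 1 + C"
    using C by eventually_elim simp
  then show "riesz_potential TYPE('b) (\<lambda>y::'a. 1 + \<phi> y) s"
  proof unfold_locales
    show "0 < s" using \<alpha> s by simp
    show "(\<lambda>y. 1 + \<phi> y) \<in> borel_measurable lebesgue" by measurable
    then show "integrable lebesgue (\<lambda>y. riesz s z y * (1 + \<phi> y))" if "snd z \<noteq> 0" for z :: "'a \<times> 'b"
      by (rule integrable_riesz_bounded[OF that \<alpha> s]) fact
  qed
qed

text \<open>The analytic core: if the potentials of \<open>1 + \<phi> t\<close> satisfy the equation and \<open>\<phi> t\<close> is differentiable at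
  \<open>0\<close> in the given sense, the derivative \<open>\<psi>\<close> is constant. Below, \<open>P t\<close> and \<open>U\<close> are the potentials of \<open>\<phi> t\<close> and \<open>\<psi>\<close>.\<close>

lemma linearized_density_constant:
  fixes \<phi> :: "real \<Rightarrow> 'a::euclidean_space \<Rightarrow> real" and \<psi> :: "'a \<Rightarrow> real" and T :: "'b::euclidean_space itself"
  assumes \<alpha>: "0 < \<alpha>" and s: "s = real DIM('a) + \<alpha>" and t\<^sub>0: "0 < t\<^sub>0"
    and bounded: "\<And>t. t \<in> {0..<t\<^sub>0} \<Longrightarrow> ess_bounded (\<phi> t)"
    and eq: "\<And>t z::'a \<times> 'b. t \<in> {0..<t\<^sub>0} \<Longrightarrow> snd z \<noteq> 0 \<Longrightarrow>
      s * (\<Sum>b\<in>Basis. (riesz_potential.mom (\<lambda>y. 1 + \<phi> t y) s b z)\<^sup>2)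
      = \<alpha> * riesz_potential.pot (\<lambda>y. 1 + \<phi> t y) s z * riesz_potential.pot2 (\<lambda>y. 1 + \<phi> t y) s z"
    and \<psi>: "locally_integrable \<psi>"
    and lim: "((\<lambda>t. bmo_norm (\<lambda>y. \<phi> t y - t * \<psi> y) / ennreal t) \<longlongrightarrow> 0) (at_right 0)"
    and bmo: "\<And>t. t \<in> {0..<t\<^sub>0} \<Longrightarrow> bmo_norm (\<phi> t) \<le> ennreal (C * t)"
    and mean: "(\<lambda>t. LINT y:ball 0 1|lebesgue. \<phi> t y - t * \<psi> y) \<in> o[at_right 0](\<lambda>t. t)"
  shows "\<exists>c. AE y in lebesgue. \<psi> y = c"
proof -
  define c where "c = (LINT x|lborel. unit_kernel s (x::'a))"
  have c: "0 < c" unfolding c_def by (rule integral_unit_kernel_pos[OF \<alpha> s])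
  \<comment> \<open>The absolute value is taken because \<open>C\<close> may be negative when the seminorms vanish.\<close>
  define K where "K = bmo_const DIM('a) \<alpha> * \<bar>C\<bar>"
  have K: "0 \<le> K" using bmo_const_nonneg[OF \<alpha>] by (simp add: K_def)
  define P where "P t z = (LINT y|lebesgue. riesz s z y * \<phi> t y)" for t and z :: "'a \<times> 'b"
  define U where "U z = (LINT y|lebesgue. riesz s z y * \<psi> y)" for z :: "'a \<times> 'b"
  let ?pot = "\<lambda>t z::'a \<times> 'b. riesz_potential.pot (\<lambda>y. 1 + \<phi> t y) s z"
  have near_0: "\<forall>\<^sub>F t in at_right (0::real). t \<in> {0<..<t\<^sub>0}"
    using t\<^sub>0 by (rule eventually_at_right_real)
  have rp: "riesz_potential TYPE('b) (\<lambda>y. 1 + \<phi> t y) s" if "t \<in> {0..<t\<^sub>0}" for t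
    using riesz_potential_bounded_density(1)[OF \<alpha> s bounded[OF that]] .
  have i\<phi>: "integrable lebesgue (\<lambda>y. riesz s z y * \<phi> t y)" if "t \<in> {0..<t\<^sub>0}" "snd z \<noteq> 0" for t and z :: "'a \<times> 'b"
    using riesz_potential_bounded_density(2)[OF \<alpha> s bounded[OF that(1)] that(2)] .
  have i1: "integrable lebesgue (riesz s z :: 'a \<Rightarrow> real)" if "snd z \<noteq> 0" for z :: "'a \<times> 'b"
    using riesz_potential.f_int[OF riesz_potential_one[OF \<alpha> s] that] by simp
  have pot: "?pot t (x, w) = c * norm w powr - \<alpha> + P t (x, w)" if t: "t \<in> {0..<t\<^sub>0}" and w: "w \<noteq> 0" for t x and w :: 'b
  proof -
    have "?pot t (x, w) = (LINT y|lebesgue. riesz s (x, w) y + riesz s (x, w) y * \<phi> t y)"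
      unfolding riesz_potential.pot_def[OF rp[OF t]] by (simp add: distrib_left)
    also have "\<dots> = (LINT y|lebesgue. riesz s (x, w) y) + P t (x, w)"
      unfolding P_def using i\<phi>[OF t] i1 w by (intro Bochner_Integration.integral_add) auto
    finally show ?thesis unfolding c_def integral_riesz[OF w s] .
  qed
  have osc: "\<exists>m. (LINT y|lebesgue. riesz s (x, w) y * \<bar>(1 + \<phi> t y) - m\<bar>) \<le> (K * t) * norm w powr - \<alpha>"
    if t: "t \<in> {0..<t\<^sub>0}" and w: "w \<noteq> 0" for t x and w :: 'b
  proof -
    have "bmo_norm (\<phi> t) \<le> ennreal (C * t)" by (rule bmo[OF t])
    also have "\<dots> \<le> ennreal (\<bar>C\<bar> * t)" using t by (intro ennreal_leI mult_right_mono) auto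
    finally have b: "bmo_norm (\<phi> t) \<le> ennreal (\<bar>C\<bar> * t)" .
    have "0 \<le> \<bar>C\<bar> * t" using t by simp
    from bmo_riesz(2)[OF ess_bounded_locally_integrable[OF bounded[OF t]] b this w \<alpha> s, of x]
    have "(LINT y|lebesgue. riesz s (x, w) y * \<bar>(1 + \<phi> t y) - (1 + mean_on (ball x (norm w)) (\<phi> t))\<bar>)
       \<le> (K * t) * norm w powr - \<alpha>" by (simp add: K_def mult.assoc)
    then show ?thesis by blast
  qed

  \<comment> \<open>The difference quotients of the potentials converge pointwise.\<close>
  have small: "\<forall>\<^sub>F t in at_right 0. bmo_norm (\<lambda>y. \<phi> t y - t * \<psi> y) \<le> ennreal (\<epsilon> * t)" if "0 < \<epsilon>" for \<epsilon>
  proof -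
    have "\<forall>\<^sub>F t in at_right 0. bmo_norm (\<lambda>y. \<phi> t y - t * \<psi> y) / ennreal t < ennreal \<epsilon>"
      using order_tendstoD(2)[OF lim, of "ennreal \<epsilon>"] that by simp
    with near_0 show ?thesis
    proof eventually_elim
      case (elim t)
      then have t: "0 < t" by simp
      have "bmo_norm (\<lambda>y. \<phi> t y - t * \<psi> y) = bmo_norm (\<lambda>y. \<phi> t y - t * \<psi> y) / ennreal t * ennreal t"
        using t by (simp add: ennreal_divide_times ennreal_times_divide[symmetric] ennreal_mult_divide_eq)
      also have "\<dots> \<le> ennreal \<epsilon> * ennreal t"
        using elim(2) by (intro mult_right_mono) auto
      finally show ?case using t that by (simp add: ennreal_mult)
    qed
  qed
  have loc: "locally_integrable (\<lambda>y. \<phi> t y - t * \<psi> y)" if "t \<in> {0..<t\<^sub>0}" for t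
    using ess_bounded_locally_integrable[OF bounded[OF that]] \<psi>
    unfolding locally_integrable_def
    by (intro allI impI set_integral_diff(1) set_integrable_mult_right) auto
  have i\<psi>: "integrable lebesgue (\<lambda>y. riesz s z y * \<psi> y)" if z: "snd z \<noteq> 0" for z :: "'a \<times> 'b"
  proof -
    obtain t where t: "t \<in> {0<..<t\<^sub>0}" "bmo_norm (\<lambda>y. \<phi> t y - t * \<psi> y) \<le> ennreal (1 * t)"
      using eventually_happens[OF eventually_conj[OF near_0 small[of 1]]] by auto
    then have t': "t \<in> {0..<t\<^sub>0}" "0 \<le> 1 * t" "0 < t" by auto
    obtain C' where "0 \<le> C'" and C': "\<And>f b. locally_integrable f \<Longrightarrow> bmo_norm f \<le> ennreal b \<Longrightarrow> 0 \<le> b \<Longrightarrow>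
       integrable lebesgue (\<lambda>y. riesz s z y * f y) \<and>
       \<bar>LINT y|lebesgue. riesz s z y * f y\<bar> \<le> C' * (b + \<bar>LINT y:ball 0 1|lebesgue. f y\<bar>)"
      by (rule bmo_potential_bound[OF z \<alpha> s]) blast
    from C'[OF loc[OF t'(1)] t(2) t'(2)]
    have "integrable lebesgue (\<lambda>y. riesz s z y * (\<phi> t y - t * \<psi> y))" by blast
    from Bochner_Integration.integrable_diff[OF i\<phi>[OF t'(1) z] this]
    have "integrable lebesgue (\<lambda>y. t * (riesz s z y * \<psi> y))" by (simp add: algebra_simps)
    then show ?thesis using t' by simp
  qed
  have conv: "((\<lambda>t. P t z / t) \<longlongrightarrow> U z) (at_right 0)" if z: "snd z \<noteq> 0" for z :: "'a \<times> 'b"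
  proof (rule tendstoI)
    fix e :: real assume e: "0 < e"
    obtain C' where C': "0 \<le> C'" "\<And>f b. locally_integrable f \<Longrightarrow> bmo_norm f \<le> ennreal b \<Longrightarrow> 0 \<le> b \<Longrightarrow>
       integrable lebesgue (\<lambda>y. riesz s z y * f y) \<and>
       \<bar>LINT y|lebesgue. riesz s z y * f y\<bar> \<le> C' * (b + \<bar>LINT y:ball 0 1|lebesgue. f y\<bar>)"
      by (rule bmo_potential_bound[OF z \<alpha> s]) blast
    define \<epsilon> where "\<epsilon> = e / (2 * (C' + 1))"
    have \<epsilon>: "0 < \<epsilon>" using e C' by (simp add: \<epsilon>_def)
    have "\<forall>\<^sub>F t in at_right 0. norm (LINT y:ball 0 1|lebesgue. \<phi> t y - t * \<psi> y) \<le> \<epsilon> * norm t"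
      using landau_o.smallD[OF mean \<epsilon>] .
    with near_0 small[OF \<epsilon>] show "\<forall>\<^sub>F t in at_right 0. dist (P t z / t) (U z) < e"
    proof eventually_elim
      case (elim t)
      then have t: "t \<in> {0..<t\<^sub>0}" "0 < t" by auto
      have "P t z - t * U z = (LINT y|lebesgue. riesz s z y * \<phi> t y - t * (riesz s z y * \<psi> y))"
        unfolding P_def U_def integral_mult_right_zero[symmetric]
        by (intro Bochner_Integration.integral_diff[symmetric] i\<phi>[OF t(1) z] integrable_mult_right i\<psi>[OF z])
      also have "\<dots> = (LINT y|lebesgue. riesz s z y * (\<phi> t y - t * \<psi> y))"
        by (simp add: algebra_simps)
      finally have "\<bar>P t z - t * U z\<bar> = \<bar>LINT y|lebesgue. riesz s z y * (\<phi> t y - t * \<psi> y)\<bar>" by simp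
      also have "\<dots> \<le> C' * (\<epsilon> * t + \<bar>LINT y:ball 0 1|lebesgue. \<phi> t y - t * \<psi> y\<bar>)"
        using C'(2)[OF loc[OF t(1)] elim(2)] mult_nonneg_nonneg[OF less_imp_le[OF \<epsilon>] less_imp_le[OF t(2)]] by blast
      also have "\<dots> \<le> C' * (\<epsilon> * t + \<epsilon> * t)"
        using elim(3) t C'(1) by (intro mult_left_mono add_left_mono) auto
      also have "\<dots> < (2 * (C' + 1)) * \<epsilon> * t"
        using \<epsilon> t by (simp add: algebra_simps)
      also have "\<dots> = e * t" using C'(1) by (simp add: \<epsilon>_def)
      finally have "\<bar>P t z - t * U z\<bar> < e * t" .
      moreover have "P t z / t - U z = (P t z - t * U z) / t" using t by (simp add: field_simps)
      ultimately show ?case using t by (simp add: dist_real_def abs_divide pos_divide_less_eq)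
    qed
  qed

  obtain e :: 'b where e: "norm e = 1" using vector_choose_size[of 1] by auto
  then have e0: "e \<noteq> 0" by auto
  \<comment> \<open>The limit is independent of the distance to the plane.\<close>
  have radial: "r2 powr \<alpha> * U (x, r2 *\<^sub>R e) = r1 powr \<alpha> * U (x, r1 *\<^sub>R e)" if r: "0 < r1" "r1 \<le> r2" for x r1 r2
  proof -
    \<comment> \<open>With \<open>q r t\<close> below, \<open>(r powr \<alpha> * pot)\<^sup>2 = (c + t q)\<^sup>2\<close>, so the linear term of its increment in \<open>r\<close>
      is \<open>2 c t\<close> times the increment of \<open>q\<close>, whereas the whole increment is \<open>O(t\<^sup>2)\<close>.\<close>
    define q where "q r t = r powr \<alpha> * (P t (x, r *\<^sub>R e) / t)" for r t
    define M where "M = 2 * ((\<alpha> + s)\<^sup>2 + s\<^sup>2 * real DIM('a)) / \<alpha> * K\<^sup>2 / r1 * (r2 - r1)"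
    have q: "(q r \<longlongrightarrow> r powr \<alpha> * U (x, r *\<^sub>R e)) (at_right 0)" if "0 < r" for r
      unfolding q_def using that e0 by (intro tendsto_mult tendsto_const conv) auto
    have id0: "((\<lambda>t::real. t) \<longlongrightarrow> 0) (at_right 0)" by (rule tendsto_ident_at)
    have r2: "0 < r2" using r by simp
    have "((\<lambda>t. 2 * c * (q r2 t - q r1 t) + t * ((q r2 t)\<^sup>2 - (q r1 t)\<^sup>2)) \<longlongrightarrow>
        2 * c * (r2 powr \<alpha> * U (x, r2 *\<^sub>R e) - r1 powr \<alpha> * U (x, r1 *\<^sub>R e))
        + 0 * ((r2 powr \<alpha> * U (x, r2 *\<^sub>R e))\<^sup>2 - (r1 powr \<alpha> * U (x, r1 *\<^sub>R e))\<^sup>2)) (at_right 0)"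
      by (intro tendsto_intros q r r2 id0)
    moreover have "((\<lambda>t. 2 * c * (q r2 t - q r1 t) + t * ((q r2 t)\<^sup>2 - (q r1 t)\<^sup>2)) \<longlongrightarrow> 0) (at_right 0)"
    proof (rule Lim_null_comparison)
      show "((\<lambda>t. M * t) \<longlongrightarrow> 0) (at_right 0)"
        using tendsto_mult_right_zero[OF id0] .
      show "\<forall>\<^sub>F t in at_right 0. norm (2 * c * (q r2 t - q r1 t) + t * ((q r2 t)\<^sup>2 - (q r1 t)\<^sup>2)) \<le> M * t"
        using near_0
      proof eventually_elim
        case (elim t)
        then have t: "t \<in> {0..<t\<^sub>0}" "0 < t" by auto
        have E: "r powr \<alpha> * ?pot t (x, r *\<^sub>R e) = c + t * q r t" if "0 < r" for r
        proof -
          have "r *\<^sub>R e \<noteq> 0" using that e0 by simp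
          from pot[OF t(1) this, of x] show ?thesis
            using that t e by (simp add: q_def distrib_left powr_minus field_simps)
        qed
        have "\<bar>(r2 powr \<alpha> * ?pot t (x, r2 *\<^sub>R e))\<^sup>2 - (r1 powr \<alpha> * ?pot t (x, r1 *\<^sub>R e))\<^sup>2\<bar>
          \<le> 2 * ((\<alpha> + s)\<^sup>2 + s\<^sup>2 * real DIM('a)) / \<alpha> * (K * t)\<^sup>2 / r1 * (r2 - r1)"
        proof (rule riesz_potential.pot_radial_oscillation[OF rp[OF t(1)] \<alpha> s e r])
          show "0 \<le> K * t" using K t by simp
          show "\<exists>m. (LINT y|lebesgue. riesz s (x, r *\<^sub>R e) y * \<bar>1 + \<phi> t y - m\<bar>) \<le> K * t * r powr - \<alpha>"
            if "0 < r" for r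
            using osc[OF t(1), of "r *\<^sub>R e" x] that e e0 by simp
        qed (use eq[OF t(1)] in auto)
        also have "\<dots> = M * t\<^sup>2" by (simp add: M_def power_mult_distrib)
        finally have "\<bar>(c + t * q r2 t)\<^sup>2 - (c + t * q r1 t)\<^sup>2\<bar> \<le> M * t\<^sup>2"
          unfolding E[OF r(1)] E[OF r2] .
        moreover have "(c + t * q r2 t)\<^sup>2 - (c + t * q r1 t)\<^sup>2
           = t * (2 * c * (q r2 t - q r1 t) + t * ((q r2 t)\<^sup>2 - (q r1 t)\<^sup>2))"
          by (simp add: power2_eq_square algebra_simps)
        ultimately have "t * norm (2 * c * (q r2 t - q r1 t) + t * ((q r2 t)\<^sup>2 - (q r1 t)\<^sup>2)) \<le> t * (M * t)"
          using t by (simp add: abs_mult power2_eq_square mult_ac)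
        then show ?case using t by simp
      qed
    qed
    ultimately have "2 * c * (r2 powr \<alpha> * U (x, r2 *\<^sub>R e) - r1 powr \<alpha> * U (x, r1 *\<^sub>R e))
        + 0 * ((r2 powr \<alpha> * U (x, r2 *\<^sub>R e))\<^sup>2 - (r1 powr \<alpha> * U (x, r1 *\<^sub>R e))\<^sup>2) = 0"
      by (intro tendsto_unique[OF trivial_limit_at_right_real])
    then show ?thesis using c by simp
  qed
  \<comment> \<open>Far from the plane the potential no longer sees tangential differences.\<close>
  have tangential: "\<bar>r powr \<alpha> * U (x, r *\<^sub>R e) - r powr \<alpha> * U (x', r *\<^sub>R e)\<bar> \<le> s * K * norm (x - x') / r" if r: "0 < r" for r x x'
  proof -
    let ?w = "r *\<^sub>R e"
    have w: "?w \<noteq> 0" and nw: "norm ?w = r" using r e e0 by auto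
    have "((\<lambda>t. \<bar>P t (x, ?w) / t - P t (x', ?w) / t\<bar>) \<longlongrightarrow> \<bar>U (x, ?w) - U (x', ?w)\<bar>) (at_right 0)"
      using w by (intro tendsto_intros conv) auto
    then have "\<bar>U (x, ?w) - U (x', ?w)\<bar> \<le> s * r powr - 1 * (K * r powr - \<alpha>) * norm (x - x')"
    proof (rule tendsto_upperbound)
      show "\<forall>\<^sub>F t in at_right 0. \<bar>P t (x, ?w) / t - P t (x', ?w) / t\<bar> \<le> s * r powr - 1 * (K * r powr - \<alpha>) * norm (x - x')"
        using near_0
      proof eventually_elim
        case (elim t)
        then have t: "t \<in> {0..<t\<^sub>0}" "0 < t" by auto
        have "\<bar>?pot t (x, ?w) - ?pot t (x', ?w)\<bar> \<le> s * norm ?w powr - 1 * (K * t * norm ?w powr - \<alpha>) * norm (x - x')"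
          by (rule riesz_potential.pot_tangential_oscillation[OF rp[OF t(1)] \<alpha> s w osc[OF t(1) w]])
        then have "\<bar>P t (x, ?w) - P t (x', ?w)\<bar> \<le> (s * r powr - 1 * (K * r powr - \<alpha>) * norm (x - x')) * t"
          unfolding pot[OF t(1) w] nw by (simp add: mult_ac)
        then show ?case
          using t by (simp only: diff_divide_distrib[symmetric] abs_divide abs_of_pos pos_divide_le_eq)
      qed
    qed simp
    then have "r powr \<alpha> * \<bar>U (x, ?w) - U (x', ?w)\<bar> \<le> r powr \<alpha> * (s * r powr - 1 * (K * r powr - \<alpha>) * norm (x - x'))"
      by (intro mult_left_mono) auto
    also have "\<dots> = s * K * norm (x - x') / r"
      using r by (simp add: powr_minus field_simps)
    finally show ?thesis by (simp add: right_diff_distrib[symmetric] abs_mult)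
  qed
  define u where "u x = U (x, e)" for x
  have Uu: "r powr \<alpha> * U (x, r *\<^sub>R e) = u x" if "0 < r" for r x
  proof (cases "r \<le> 1")
    case True
    then show ?thesis using radial[OF that True, of x] by (simp add: u_def)
  next
    case False
    then show ?thesis using radial[of 1 r x] by (simp add: u_def)
  qed
  have u_const: "u x = u 0" for x
  proof -
    have "((\<lambda>r. s * K * norm (x - 0) / r) \<longlongrightarrow> 0) at_top"
      by (intro tendsto_divide_0[OF tendsto_const] filterlim_at_top_imp_at_infinity filterlim_ident)
    then have "\<bar>u x - u 0\<bar> \<le> 0"
    proof (rule tendsto_lowerbound)
      show "\<forall>\<^sub>F r in at_top. \<bar>u x - u 0\<bar> \<le> s * K * norm (x - 0) / r"
        using eventually_gt_at_top[of 0]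
        by eventually_elim (use tangential Uu in \<open>metis\<close>)
    qed simp
    then show ?thesis by simp
  qed
  have "AE y in lebesgue. \<psi> y - u 0 / c = 0"
  proof (rule riesz_potential_injective[OF \<alpha> s locally_integrable_diff_const[OF \<psi>], where 'b = 'b])
    fix z :: "'a \<times> 'b" assume z: "snd z \<noteq> 0"
    obtain x w where zz: "z = (x, w)" by (cases z)
    have w: "w \<noteq> 0" using z zz by simp
    have split: "riesz s z y * (\<psi> y - u 0 / c) = riesz s z y * \<psi> y - (u 0 / c) * riesz s z y" for y
      by (simp add: right_diff_distrib)
    show "integrable lebesgue (\<lambda>y. riesz s z y * (\<psi> y - u 0 / c))"
      unfolding split by (intro Bochner_Integration.integrable_diff i\<psi> integrable_mult_right i1 z)
    have "(LINT y|lebesgue. riesz s z y * (\<psi> y - u 0 / c))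
        = U z - (LINT y|lebesgue. (u 0 / c) * riesz s z y)"
      unfolding split U_def by (intro Bochner_Integration.integral_diff i\<psi> integrable_mult_right i1 z)
    also have "(LINT y|lebesgue. (u 0 / c) * riesz s z y) = u 0 * norm w powr - \<alpha>"
      using integral_riesz[OF w s, of x] c by (simp add: zz c_def)
    also have "U z = u 0 * norm w powr - \<alpha>"
    proof -
      have "riesz s (x, w) y = riesz s (x, norm w *\<^sub>R e) y" for y :: 'a
        using e by (intro riesz_norm_snd) simp
      then have "U z = U (x, norm w *\<^sub>R e)" by (simp add: U_def zz)
      moreover have "norm w powr \<alpha> * U (x, norm w *\<^sub>R e) = u 0"
        using Uu[of "norm w" x] u_const[of x] w by simp
      ultimately show ?thesis using w by (simp add: powr_minus field_simps)
    qed
    finally show "(LINT y|lebesgue. riesz s z y * (\<psi> y - u 0 / c)) = 0" by simp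
  qed
  then have "AE y in lebesgue. \<psi> y = u 0 / c" by eventually_elim simp
  then show ?thesis by blast
qed

section \<open>Absence of flat perturbations\<close>

text \<open>The regularized distance is a power of a constant multiple of the potential of its density,
  so that the differential identity applies to it.\<close>

lemma flat_solution_identity:
  fixes \<mu> :: "((real^'d) \<times> (real^'k)) measure"
  assumes \<alpha>: "0 < \<alpha>" and ne: "\<alpha> \<noteq> real CARD('k) - 2" and s: "s = real CARD('d) + \<alpha>"
    and reg: "ahlfors_regular CARD('d) flat_plane \<mu>"
    and sol: "\<And>x. x \<in> - flat_plane \<Longrightarrow>
      degenerate_op CARD('d) \<alpha> flat_plane \<mu> (regularized_dist CARD('d) \<alpha> flat_plane \<mu>) x = 0"
    and \<phi>: "ess_bounded \<phi>"
    and dens: "has_density \<mu> (hausdorff_on CARD('d) flat_plane) (\<lambda>z. 1 + \<phi> (fst z))"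
    and z: "snd z \<noteq> 0"
  shows "s * (\<Sum>b\<in>Basis. (riesz_potential.mom (\<lambda>y. 1 + \<phi> y) s b z)\<^sup>2)
      = \<alpha> * riesz_potential.pot (\<lambda>y. 1 + \<phi> y) s z * riesz_potential.pot2 (\<lambda>y. 1 + \<phi> y) s (z :: (real^'d) \<times> (real^'k))"
proof -
  let ?E = "UNIV \<times> {0} :: ((real^'d) \<times> (real^'k)) set"
  let ?D = "regularized_dist CARD('d) \<alpha> flat_plane \<mu>"
  have s': "s = real DIM(real^'d) + \<alpha>" using s by simp
  have \<mu>UNIV: "emeasure \<mu> UNIV \<noteq> 0"
  proof
    assume "emeasure \<mu> UNIV = 0"
    moreover have "emeasure \<mu> (ball 0 1) \<le> emeasure \<mu> UNIV"
      using reg sets_eq_imp_space_eq[of \<mu> borel] by (intro emeasure_mono) (auto simp: ahlfors_regular_def)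
    moreover have "(0 :: (real^'d) \<times> (real^'k)) \<in> closed_support \<mu>"
      using reg by (simp add: ahlfors_regular_def flat_plane_def zero_prod_def)
    ultimately show False by (auto simp: closed_support_def)
  qed
  have dens': "has_density \<mu> (hausdorff_on DIM(real^'d) ?E) (\<lambda>z. 1 + \<phi> (fst z))"
    using dens by (simp add: flat_plane_def)
  have "emeasure (hausdorff_on DIM(real^'d) ?E) UNIV \<noteq> 0"
  proof
    let ?\<nu> = "hausdorff_on DIM(real^'d) ?E"
    assume 0: "emeasure ?\<nu> UNIV = 0"
    have "emeasure \<mu> UNIV = (\<integral>\<^sup>+z\<in>UNIV. ennreal (1 + \<phi> (fst z)) \<partial>completion ?\<nu>)"
      using dens' by (simp add: has_density_def)
    also have "\<dots> = (\<integral>\<^sup>+z\<in>UNIV. ennreal (1 + \<phi> (fst z)) \<partial>?\<nu>)"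
      by (rule nn_integral_completion)
    also have "\<dots> = (\<integral>\<^sup>+z. 0 \<partial>?\<nu>)"
      by (intro nn_integral_cong_AE AE_I'[of UNIV]) (use 0 in \<open>auto simp: null_sets_def\<close>)
    finally show False using \<mu>UNIV by simp
  qed
  then obtain c where c: "0 < c" and H: "hausdorff_on DIM(real^'d) ?E = distr (density lborel (\<lambda>_. ennreal c)) borel (\<lambda>y. (y, 0))"
    by (rule hausdorff_on_plane)
  have \<phi>m: "\<phi> \<in> borel_measurable lebesgue" using \<phi> by (simp add: ess_bounded_def)
  note dp = integral_has_density_plane[OF dens' H c \<phi>m]
  interpret riesz_potential "\<lambda>y. 1 + \<phi> y" s "TYPE(real^'k)"
    by (rule riesz_potential_bounded_density(1)[OF \<alpha> s' \<phi>])
  have D: "?D z = (c * pot z) powr (- 1 / \<alpha>)" for z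
  proof -
    have g: "(\<lambda>y. dist z y powr (- real CARD('d) - \<alpha>)) \<in> borel_measurable borel"
      by (intro powr_real_measurable borel_measurable_const borel_measurable_continuous_onI continuous_intros)
    have "- real CARD('d) - \<alpha> = - s" using s by simp
    then show ?thesis
      unfolding regularized_dist_def flat_plane_def dp(2)[OF g]
      by (simp add: pot_def riesz_def dist_norm)
  qed
  have pos: "0 < pot z" if z: "snd z \<noteq> 0" for z
  proof -
    have nn: "AE y in lebesgue. 0 \<le> riesz s z y * (1 + \<phi> y)"
      using dp(1) by eventually_elim simp
    have "pot z \<noteq> 0"
    proof
      assume "pot z = 0"
      then have "AE y in lebesgue. riesz s z y * (1 + \<phi> y) = 0"
        using integral_nonneg_eq_0_iff_AE[OF f_int[OF z] nn] by (simp add: pot_def)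
      then have "AE y in lebesgue. 1 + \<phi> y = 0"
        by eventually_elim (use riesz_pos[OF z] in \<open>metis less_irrefl mult_eq_0_iff\<close>)
      then show False using dp(3) \<mu>UNIV by simp
    qed
    moreover have "0 \<le> pot z" unfolding pot_def by (rule integral_nonneg_AE[OF nn])
    ultimately show ?thesis by simp
  qed
  have "z \<in> - flat_plane" using z by (simp add: flat_plane_def mem_Times_iff)
  from sol[OF this] have "divg (\<lambda>z. ?D z powr (- real DIM((real^'d) \<times> (real^'k)) + real DIM(real^'d) + 1) *\<^sub>R grad ?D z) z = 0"
    by (simp add: degenerate_op_def)
  then show ?thesis
    by (intro pde_identity[OF D c pos \<alpha> s' _ z]) (use ne in auto)
qed

theorem theorem1:
  fixes n d :: nat and \<alpha> :: real
  assumes "d = DIM(real^'d)"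
    and "n = DIM((real^'d) \<times> (real^'k))"
    and "1 \<le> d" and "d + 2 < n"
    and "0 < \<alpha>" and "\<alpha> \<noteq> real n - real d - 2"
  shows "\<not> (\<exists>t\<^sub>0 (\<mu> :: real \<Rightarrow> ((real^'d) \<times> (real^'k)) measure). nontrivial_flat_family \<alpha> t\<^sub>0 \<mu>)"
proof
  assume "\<exists>t\<^sub>0 (\<mu> :: real \<Rightarrow> ((real^'d) \<times> (real^'k)) measure). nontrivial_flat_family \<alpha> t\<^sub>0 \<mu>"
  then obtain t\<^sub>0 and \<mu> :: "real \<Rightarrow> ((real^'d) \<times> (real^'k)) measure"
    where "nontrivial_flat_family \<alpha> t\<^sub>0 \<mu>" by blast
  then obtain \<phi> \<psi> C where t\<^sub>0: "0 < t\<^sub>0"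
    and fam: "\<forall>t\<in>{0..<t\<^sub>0}. ahlfors_regular CARD('d) flat_plane (\<mu> t) \<and>
           (\<forall>x\<in>- flat_plane.
              degenerate_op CARD('d) \<alpha> flat_plane (\<mu> t)
                (regularized_dist CARD('d) \<alpha> flat_plane (\<mu> t)) x = 0) \<and>
           ess_bounded (\<phi> t) \<and>
           has_density (\<mu> t) (hausdorff_on CARD('d) flat_plane) (\<lambda>z. 1 + \<phi> t (fst z))"
    and \<psi>: "locally_integrable \<psi>" "\<not> (\<exists>c. AE y in lebesgue. \<psi> y = c)"
    and lim: "((\<lambda>t. bmo_norm (\<lambda>y. \<phi> t y - t * \<psi> y) / ennreal t) \<longlongrightarrow> 0) (at_right 0)"
    and bmo: "\<forall>t\<in>{0..<t\<^sub>0}. bmo_norm (\<phi> t) \<le> ennreal (C * t) \<and>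
           \<bar>LINT y:ball 0 1|lebesgue. \<phi> t y\<bar> \<le> C * t"
    and mean: "(\<lambda>t. LINT y:ball 0 1|lebesgue. \<phi> t y - t * \<psi> y) \<in> o[at_right 0](\<lambda>t. t)"
    unfolding nontrivial_flat_family_def by blast
  define s where "s = real CARD('d) + \<alpha>"
  have ne: "\<alpha> \<noteq> real CARD('k) - 2" using assms by simp
  have "\<exists>c. AE y in lebesgue. \<psi> y = c"
  proof (rule linearized_density_constant[where 'b = "real^'k", OF \<open>0 < \<alpha>\<close> _ t\<^sub>0 _ _ \<psi>(1) lim _ mean])
    show "s = real DIM(real^'d) + \<alpha>" by (simp add: s_def)
    show "ess_bounded (\<phi> t)" if "t \<in> {0..<t\<^sub>0}" for t using fam that by blast
    show "bmo_norm (\<phi> t) \<le> ennreal (C * t)" if "t \<in> {0..<t\<^sub>0}" for t using bmo that by blast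
    show "s * (\<Sum>b\<in>Basis. (riesz_potential.mom (\<lambda>y. 1 + \<phi> t y) s b z)\<^sup>2)
      = \<alpha> * riesz_potential.pot (\<lambda>y. 1 + \<phi> t y) s z * riesz_potential.pot2 (\<lambda>y. 1 + \<phi> t y) s z"
      if t: "t \<in> {0..<t\<^sub>0}" and z: "snd z \<noteq> 0" for t and z :: "(real^'d) \<times> (real^'k)"
      using fam[rule_format, OF t] by (intro flat_solution_identity[OF \<open>0 < \<alpha>\<close> ne s_def _ _ _ _ z]) auto
  qed
  with \<psi>(2) show False by blast
qed

end
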